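(* Let $X=\{X(t)\}$ be a supOU process with characteristic quadruple $(a,b,\mu_L,\pi)$, finite variance $\sigma^2=\mathrm{Var}\,X(1)$ and zero mean, and let $X^*(t)=\int_0^t X(s)\,ds$, $t\ge 0$. If $\int_0^\infty\xi^{-1}\pi(d\xi)<\infty$, then as $T\to\infty$ $$\left\{\frac{1}{T^{1/2}}X^*(Tt)\right\}_{t\ge0}\longrightarrow\{\widetilde\sigma B(t)\}_{t\ge0}$$ in the sense of convergence of all finite dimensional distributions, where $\{B(t)\}$ is standard Brownian motion and $$\widetilde\sigma^2=2\sigma^2\int_0^\infty\xi^{-1}\pi(d\xi).$$
   Context: SupOU process: let $\pi$ be a probability measure on $\mathbb{R}_+=(0,\infty)$ and let $\kappa_L(\zeta)=\log \mathbb{E}e^{i\zeta L(1)}$ be the cumulant function of an infinitely divisible random variable $L(1)$ with Lévy–Khintchine triplet $(a,b,\mu_L)$: $\kappa_L(\zeta)=i\zeta a-\frac{\zeta^2}{2}b+\int_{\mathbb{R}}(e^{i\zeta x}-1-i\zeta x\mathbf{1}_{[-1,1]}(x))\mu_L(dx)$. Let $\Lambda$ be the homogeneous Lévy basis (independently scattered infinitely divisible random measure) on $\mathbb{R}_+\times\mathbb{R}$ with $\log\mathbb{E}e^{i\zeta\Lambda(A)}=(\pi\times \mathrm{Leb})(A)\,\kappa_L(\zeta)$ for Borel sets $A$ (of finite measure). The supOU process with characteristic quadruple $(a,b,\mu_L,\pi)$ is the strictly stationary process $$X(t)=\int_{\mathbb{R}_+}\int_{\mathbb{R}}e^{-\xi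 t+s}\mathbf{1}_{[0,\infty)}(\xi t-s)\,\Lambda(d\xi,ds),\quad t\in\mathbb{R},$$ where the stochastic integral is in the sense of Rajput–Rosiński: for $\Lambda$-integrable $f$, $\log\mathbb{E}\exp(i\zeta\int f\,d\Lambda)=\int\int\kappa_L(\zeta f(\xi,s))\,ds\,\pi(d\xi)$. Under zero mean and finite variance of $X$, $\int x^2\mu_L(dx)<\infty$, $\mathbb{E}L(1)=0$ and $\kappa_L(\zeta)=-\frac{\zeta^2}{2}b+\int_{\mathbb{R}}(e^{i\zeta x}-1-i\zeta x)\mu_L(dx)$. *)

theory Defs
  imports "HOL-Probability.Probability"
begin

definition levy_triplet :: "real \<Rightarrow> real \<Rightarrow> real measure \<Rightarrow> bool" where
  "levy_triplet a b \<mu> \<longleftrightarrow>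
     0 \<le> b \<and> sets \<mu> = sets borel \<and> emeasure \<mu> {0} = 0 \<and>
     (\<integral>\<^sup>+ x. ennreal (min 1 (x\<^sup>2)) \<partial>\<mu>) < \<infinity>"

definition levy_cumulant :: "real \<Rightarrow> real \<Rightarrow> real measure \<Rightarrow> real \<Rightarrow> complex" where
  "levy_cumulant a b \<mu> \<zeta> =
     \<i> * of_real (\<zeta> * a) - of_real (\<zeta>\<^sup>2 / 2 * b) +
     (\<integral> x. (exp (\<i> * of_real (\<zeta> * x)) - 1 - \<i> * of_real (\<zeta> * x * indicator {-1..1} x)) \<partial>\<mu>)"

text \<open>Throughout, \<open>\<nu>\<close> is the intensity measure; the random measure \<open>\<Lambda>\<close>
  is only constrained on the \<open>\<delta>\<close>-ring of measurable sets of finite \<open>\<nu>\<close>-measure.\<close>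

definition finite_sets :: "'e measure \<Rightarrow> 'e set set" where
  "finite_sets \<nu> = {A \<in> sets \<nu>. emeasure \<nu> A < \<infinity>}"

text \<open>The equation \<open>log E exp (i \<zeta> \<Lambda> A) = \<nu> A * \<kappa> \<zeta>\<close> uses the distinguished logarithm, so it is
  stated in exponentiated form. For \<open>\<kappa>\<close> a Levy cumulant function it contains the infinite
  divisibility of \<open>\<Lambda> A\<close>.\<close>

definition levy_basis ::
  "'w measure \<Rightarrow> 'e measure \<Rightarrow> (real \<Rightarrow> complex) \<Rightarrow> ('e set \<Rightarrow> 'w \<Rightarrow> real) \<Rightarrow> bool" where
  "levy_basis M \<nu> \<kappa> \<Lambda> \<longleftrightarrow>
     (\<forall>A\<in>finite_sets \<nu>. \<Lambda> A \<in> borel_measurable M) \<and>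
     (\<forall>A :: nat \<Rightarrow> 'e set. range A \<subseteq> finite_sets \<nu> \<and> disjoint_family A \<longrightarrow>
        prob_space.indep_vars M (\<lambda>_. borel) (\<lambda>n. \<Lambda> (A n)) UNIV \<and>
        ((\<Union>n. A n) \<in> finite_sets \<nu> \<longrightarrow>
           (AE \<omega> in M. (\<lambda>n. \<Lambda> (A n) \<omega>) sums \<Lambda> (\<Union>n. A n) \<omega>))) \<and>
     (\<forall>A\<in>finite_sets \<nu>. \<forall>\<zeta>.
        char (distr M borel (\<Lambda> A)) \<zeta> = exp (of_real (measure \<nu> A) * \<kappa> \<zeta>))"

definition tendsto_in_prob ::
  "'w measure \<Rightarrow> (nat \<Rightarrow> 'w \<Rightarrow> real) \<Rightarrow> ('w \<Rightarrow> real) \<Rightarrow> bool" where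
  "tendsto_in_prob M Y Z \<longleftrightarrow>
     (\<forall>n. Y n \<in> borel_measurable M) \<and> Z \<in> borel_measurable M \<and>
     (\<forall>\<epsilon>>0. (\<lambda>n. measure M {\<omega>\<in>space M. \<epsilon> < \<bar>Y n \<omega> - Z \<omega>\<bar>}) \<longlonglongrightarrow> 0)"

text \<open>Integral over \<open>A\<close> of a simple function \<open>g\<close>, written as
  \<open>g = (\<Sum>y\<noteq>0. y * indicator {x. g x = y})\<close>.\<close>

definition simple_stoch_integral ::
  "'e measure \<Rightarrow> ('e set \<Rightarrow> 'w \<Rightarrow> real) \<Rightarrow> 'e set \<Rightarrow> ('e \<Rightarrow> real) \<Rightarrow> 'w \<Rightarrow> real" where
  "simple_stoch_integral \<nu> \<Lambda> A g \<omega> =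
     (\<Sum>y\<in>g ` space \<nu> - {0}. y * \<Lambda> (A \<inter> {x\<in>space \<nu>. g x = y}) \<omega>)"

text \<open>\<open>f\<close> is \<open>\<Lambda>\<close>-integrable with integral \<open>Y\<close>: some sequence of simple functions converges to \<open>f\<close>
  almost everywhere, and its integrals converge in probability over every measurable set \<open>A\<close>
  (not only over the whole space). The integral is determined only up to null sets, whence a
  relation.\<close>

definition has_stoch_integral ::
  "'w measure \<Rightarrow> 'e measure \<Rightarrow> ('e set \<Rightarrow> 'w \<Rightarrow> real) \<Rightarrow> ('e \<Rightarrow> real) \<Rightarrow> ('w \<Rightarrow> real) \<Rightarrow> bool" where
  "has_stoch_integral M \<nu> \<Lambda> f Y \<longleftrightarrow>
     f \<in> borel_measurable \<nu> \<and>
     (\<exists>g :: nat \<Rightarrow> 'e \<Rightarrow> real.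
        (\<forall>n. simple_function \<nu> (g n) \<and> emeasure \<nu> {x\<in>space \<nu>. g n x \<noteq> 0} < \<infinity>) \<and>
        (AE x in \<nu>. (\<lambda>n. g n x) \<longlonglongrightarrow> f x) \<and>
        (\<forall>A\<in>sets \<nu>. \<exists>Z. tendsto_in_prob M (\<lambda>n. simple_stoch_integral \<nu> \<Lambda> A (g n)) Z) \<and>
        tendsto_in_prob M (\<lambda>n. simple_stoch_integral \<nu> \<Lambda> (space \<nu>) (g n)) Y)"

definition supOU_kernel :: "real \<Rightarrow> real \<times> real \<Rightarrow> real" where
  "supOU_kernel t = (\<lambda>(\<xi>, s). exp (- \<xi> * t + s) * indicator {0..} (\<xi> * t - s))"

definition supOU_process ::
  "'w measure \<Rightarrow> real \<Rightarrow> real \<Rightarrow> real measure \<Rightarrow> real measure \<Rightarrow> (real \<Rightarrow> 'w \<Rightarrow> real) \<Rightarrow> bool" where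
  "supOU_process M a b \<mu> \<pi> X \<longleftrightarrow>
     prob_space M \<and> levy_triplet a b \<mu> \<and>
     prob_space \<pi> \<and> sets \<pi> = sets (restrict_space borel {0<..}) \<and>
     (\<exists>\<Lambda>. levy_basis M (\<pi> \<Otimes>\<^sub>M lborel) (levy_cumulant a b \<mu>) \<Lambda> \<and>
          (\<forall>t. has_stoch_integral M (\<pi> \<Otimes>\<^sub>M lborel) \<Lambda> (supOU_kernel t) (X t)))"

text \<open>A pathwise integral: \<open>supOU_process\<close> fixes each \<open>X t\<close> only up to a null set, so this is meaningful
  for jointly measurable versions of \<open>X\<close>.\<close>

definition integrated_process :: "(real \<Rightarrow> 'w \<Rightarrow> real) \<Rightarrow> real \<Rightarrow> 'w \<Rightarrow> real" where
  "integrated_process X t \<omega> = (LBINT s:{0..t}. X s \<omega>)"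

definition standard_brownian_motion :: "'w measure \<Rightarrow> (real \<Rightarrow> 'w \<Rightarrow> real) \<Rightarrow> bool" where
  "standard_brownian_motion N B \<longleftrightarrow>
     prob_space N \<and>
     (\<forall>t\<ge>0. B t \<in> borel_measurable N) \<and>
     (AE \<omega> in N. B 0 \<omega> = 0) \<and>
     (\<forall>(n :: nat) t. 0 \<le> t 0 \<and> mono t \<longrightarrow>
        prob_space.indep_vars N (\<lambda>_. borel) (\<lambda>i \<omega>. B (t (Suc i)) \<omega> - B (t i) \<omega>) {..<n}) \<and>
     (\<forall>s t. 0 \<le> s \<and> s < t \<longrightarrow>
        distributed N lborel (\<lambda>\<omega>. B t \<omega> - B s \<omega>) (normal_density 0 (sqrt (t - s)))) \<and>
     (AE \<omega> in N. continuous_on {0..} (\<lambda>t. B t \<omega>))"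

text \<open>For every finite set \<open>J\<close> of times in \<open>I\<close>, weak convergence in \<open>\<real>\<^sup>J\<close> of the random vectors
  \<open>(Y T t)\<^sub>t\<close>, \<open>t \<in> J\<close>, to \<open>(Z t)\<^sub>t\<close>, \<open>t \<in> J\<close>, tested on bounded continuous functions.
  The two processes may live on different probability spaces.\<close>

definition fdd_tendsto ::
  "real set \<Rightarrow> 'w measure \<Rightarrow> ('i \<Rightarrow> real \<Rightarrow> 'w \<Rightarrow> real) \<Rightarrow>
   'v measure \<Rightarrow> (real \<Rightarrow> 'v \<Rightarrow> real) \<Rightarrow> 'i filter \<Rightarrow> bool" where
  "fdd_tendsto I M Y N Z F \<longleftrightarrow>
     (\<forall>J \<phi>. finite J \<and> J \<subseteq> I \<and>
        continuous_map (powertop_real J) euclideanreal \<phi> \<and>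
        bounded (\<phi> ` topspace (powertop_real J)) \<longrightarrow>
        ((\<lambda>T. \<integral>\<omega>. \<phi> (\<lambda>t\<in>J. Y T t \<omega>) \<partial>M) \<longlongrightarrow> (\<integral>\<omega>. \<phi> (\<lambda>t\<in>J. Z t \<omega>) \<partial>N)) F)"

end

theory Submission
  imports Defs
begin

text \<open>
  Let \<open>\<kappa>\<close> be the cumulant function of the noise with its drift removed and \<open>v = Var L(1)\<close>, so that
  \<open>\<bar>\<kappa> z\<bar> \<le> v z\<^sup>2 / 2\<close> and \<open>\<kappa> z \<sim> - v z\<^sup>2 / 2\<close> as \<open>z \<rightarrow> 0\<close>. If \<open>Y = \<integral> f d\<Lambda>\<close> with \<open>f\<close> square integrable and
  \<open>E Y = 0\<close>, then \<open>E exp (i Y) = exp (\<integral> \<kappa> (f) d\<nu>)\<close>. Approximating in mean square by Riemann sums, the same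
  holds for the integrated process, with kernel \<open>F \<tau> (\<xi>, s) = \<integral>\<^bsub>0\<^esub>\<^bsup>\<tau>\<^esup> f\<^bsub>u\<^esub> (\<xi>, s) du \<le> 1 / \<xi>\<close>. Substituting
  \<open>s = \<xi> T w\<close>, the rescaled kernel \<open>F (T t) (\<xi>, \<xi> T w)\<close> tends to \<open>1 / \<xi>\<close> for \<open>0 < w < t\<close> and to \<open>0\<close> otherwise,
  while \<open>T \<kappa> (y / sqrt T) \<rightarrow> - v y\<^sup>2 / 2\<close>. Hence the joint cumulants converge to
  \<open>- (v / 2) (\<integral> 1 / \<xi> d\<pi>) \<integral> (\<Sum> c\<^bsub>t\<^esub> 1\<^bsub>{0 < w < t}\<^esub>)\<^sup>2 dw\<close>, those of the Brownian motion, and \<open>\<sigma>\<^sup>2 = v / 2\<close>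
  because the supOU kernel has squared norm \<open>1 / 2\<close>.

  The formula for \<open>E exp (i Y)\<close> has to be proved for approximating simple functions that are not dominated.
  By a gliding hump argument, convergence of the integrals over every set makes the contribution of the
  complement of a large set, where the approximation is bounded, negligible up to a deterministic shift,
  and the shift vanishes because \<open>Y\<close> is centred.
\<close>

section \<open>Characteristic functions and convergence in probability\<close>

text \<open>The definition of the stochastic integral offers almost everywhere convergent integrands
  without domination, and limits in probability over sets; neither a cumulant formula nor a second
  moment of the noise is available at the start. Both are extracted from moduli of characteristic
  functions: real parts of the exponent are nonpositive, so they define finite measures, while
  imaginary parts may drift. Moduli leave a unimodular multiplicative factor undetermined; zero mean
  forces it to be 1 + O(z^2), and such a function is constant. The second moment of the jump measure
  is deduced from the finite variance of X(1) by applying Fatou's lemma in the jump size and in the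
  kernel variable. In the scaling limit the obstacle is a domination uniform in T when only 1 /
  \<xi> is integrable: for noise before time 0 two different bounds of the integrated kernel are
  multiplied, since the square of either alone is too large. Weak convergence of vectors rests on
  one-dimensional Levy continuity for tightness and on trigonometric polynomials.\<close>

lemma norm_iexp_diff_le: "cmod (iexp x - iexp y) \<le> \<bar>x - y\<bar>"
proof -
  have "iexp x - iexp y = iexp y * (iexp (x - y) - 1)"
    by (simp add: algebra_simps flip: exp_add)
  then have "cmod (iexp x - iexp y) = cmod (iexp (x - y) - 1)"
    by (simp add: norm_mult)
  also have "\<dots> \<le> \<bar>x - y\<bar>"
    using iexp_approx1[of "x - y" 0] by simp
  finally show ?thesis .
qed

lemma norm_iexp_diff_le_2: "cmod (iexp x - iexp y) \<le> 2"
  by (rule order_trans[OF norm_triangle_ineq4]) simp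

lemma char_distr:
  assumes "Y \<in> borel_measurable M"
  shows "char (distr M borel Y) \<zeta> = (\<integral>\<omega>. iexp (\<zeta> * Y \<omega>) \<partial>M)"
  unfolding char_def using assms by (subst integral_distr) auto

text \<open>Off the event |Y n - Z| > \<delta> the integrands differ by at most |\<zeta>| *
  \<delta>, because \<open>iexp\<close> is 1-Lipschitz; on that event they differ by at most
  2.\<close>

lemma (in prob_space) tendsto_in_prob_char:
  assumes "tendsto_in_prob M Y Z"
  shows "(\<lambda>n. char (distr M borel (Y n)) \<zeta>) \<longlonglongrightarrow> char (distr M borel Z) \<zeta>"
proof -
  have [measurable]: "Y n \<in> borel_measurable M" "Z \<in> borel_measurable M" for n
    using assms by (auto simp: tendsto_in_prob_def)
  have lim: "(\<lambda>n. prob {\<omega>\<in>space M. \<epsilon> < \<bar>Y n \<omega> - Z \<omega>\<bar>}) \<longlonglongrightarrow> 0" if "\<epsilon> > 0" for \<epsilon>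
    using assms that by (auto simp: tendsto_in_prob_def)
  have bound: "cmod (char (distr M borel (Y n)) \<zeta> - char (distr M borel Z) \<zeta>)
      \<le> \<bar>\<zeta>\<bar> * \<delta> + 2 * prob {\<omega>\<in>space M. \<delta> < \<bar>Y n \<omega> - Z \<omega>\<bar>}" if "\<delta> > 0" for \<delta> n
  proof -
    let ?A = "{\<omega>\<in>space M. \<delta> < \<bar>Y n \<omega> - Z \<omega>\<bar>}"
    have "cmod (char (distr M borel (Y n)) \<zeta> - char (distr M borel Z) \<zeta>)
        = cmod (\<integral>\<omega>. iexp (\<zeta> * Y n \<omega>) - iexp (\<zeta> * Z \<omega>) \<partial>M)"
      by (simp add: char_distr integrable_iexp del: of_real_mult)
    also have "\<dots> \<le> (\<integral>\<omega>. cmod (iexp (\<zeta> * Y n \<omega>) - iexp (\<zeta> * Z \<omega>)) \<partial>M)"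
      by (rule integral_norm_bound)
    also have "\<dots> \<le> (\<integral>\<omega>. \<bar>\<zeta>\<bar> * \<delta> + 2 * indicator ?A \<omega> \<partial>M)"
    proof (rule integral_mono)
      show "integrable M (\<lambda>\<omega>. cmod (iexp (\<zeta> * Y n \<omega>) - iexp (\<zeta> * Z \<omega>)))"
        by (rule integrable_const_bound[where B=2]) (auto intro: norm_iexp_diff_le_2 simp del: of_real_mult)
      show "integrable M (\<lambda>\<omega>. \<bar>\<zeta>\<bar> * \<delta> + 2 * indicator ?A \<omega>)"
        by (intro Bochner_Integration.integrable_add integrable_mult_right) (auto simp: integrable_indicator_iff emeasure_eq_measure)
    next
      fix \<omega> assume "\<omega> \<in> space M"
      show "cmod (iexp (\<zeta> * Y n \<omega>) - iexp (\<zeta> * Z \<omega>)) \<le> \<bar>\<zeta>\<bar> * \<delta> + 2 * indicator ?A \<omega>"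
      proof (cases "\<omega> \<in> ?A")
        case True
        then show ?thesis
          using norm_iexp_diff_le_2[of "\<zeta> * Y n \<omega>" "\<zeta> * Z \<omega>"] \<open>\<delta> > 0\<close>
          by (simp add: add_increasing del: of_real_mult)
      next
        case False
        then have "\<bar>Y n \<omega> - Z \<omega>\<bar> \<le> \<delta>" using \<open>\<omega> \<in> space M\<close> by auto
        then have "\<bar>\<zeta> * Y n \<omega> - \<zeta> * Z \<omega>\<bar> \<le> \<bar>\<zeta>\<bar> * \<delta>"
          by (simp add: abs_mult mult_left_mono flip: right_diff_distrib)
        then show ?thesis
          using norm_iexp_diff_le[of "\<zeta> * Y n \<omega>" "\<zeta> * Z \<omega>"] False by (simp del: of_real_mult)
      qed
    qed
    also have "\<dots> = \<bar>\<zeta>\<bar> * \<delta> + 2 * prob ?A"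
      by (subst Bochner_Integration.integral_add) (auto simp: integrable_indicator_iff emeasure_eq_measure prob_space)
    finally show ?thesis .
  qed
  show ?thesis
  proof (rule LIMSEQ_I)
    fix r :: real assume "r > 0"
    \<comment> \<open>The added 1 keeps the quotient meaningful at \<zeta> = 0. Half of r is spent
      on the Lipschitz part, and a probability below r / 4, entering with factor 2, takes the other
      half.\<close>
    define \<delta> where "\<delta> = r / (2 * (\<bar>\<zeta>\<bar> + 1))"
    have "\<delta> > 0" using \<open>r > 0\<close> by (simp add: \<delta>_def)
    have "\<bar>\<zeta>\<bar> * \<delta> \<le> (\<bar>\<zeta>\<bar> + 1) * \<delta>" using \<open>\<delta> > 0\<close> by (intro mult_right_mono) auto
    also have "\<dots> = r / 2" by (simp add: \<delta>_def field_simps)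
    finally have 1: "\<bar>\<zeta>\<bar> * \<delta> \<le> r / 2" .
    obtain N where N: "\<And>n. n \<ge> N \<Longrightarrow> prob {\<omega>\<in>space M. \<delta> < \<bar>Y n \<omega> - Z \<omega>\<bar>} < r / 4"
      using LIMSEQ_D[OF lim[OF \<open>\<delta> > 0\<close>], of "r/4"] \<open>r > 0\<close> by auto
    show "\<exists>no. \<forall>n\<ge>no. norm (char (distr M borel (Y n)) \<zeta> - char (distr M borel Z) \<zeta>) < r"
    proof (intro exI allI impI)
      fix n assume "n \<ge> N"
      show "norm (char (distr M borel (Y n)) \<zeta> - char (distr M borel Z) \<zeta>) < r"
        using bound[OF \<open>\<delta> > 0\<close>, of n] N[OF \<open>n \<ge> N\<close>] 1 by linarith
    qed
  qed
qed

text \<open>The linear relations are assumed only almost surely, because the random measure is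
  additive only almost surely and simple integrals inherit this.\<close>

lemma (in prob_space) tendsto_in_prob_linear:
  assumes "tendsto_in_prob M Y Z" "tendsto_in_prob M Y' Z'"
    and meas: "\<And>n. V n \<in> borel_measurable M" "W \<in> borel_measurable M"
    and V: "\<And>n. AE \<omega> in M. V n \<omega> = c * Y n \<omega> + c' * Y' n \<omega>"
    and W: "AE \<omega> in M. W \<omega> = c * Z \<omega> + c' * Z' \<omega>"
  shows "tendsto_in_prob M V W"
  unfolding tendsto_in_prob_def
proof (intro conjI allI impI)
  fix \<epsilon> :: real assume "\<epsilon> > 0"
  have [measurable]: "Y n \<in> borel_measurable M" "Z \<in> borel_measurable M"
    "Y' n \<in> borel_measurable M" "Z' \<in> borel_measurable M"
    "V n \<in> borel_measurable M" "W \<in> borel_measurable M" for n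
    using assms by (auto simp: tendsto_in_prob_def)
  define \<delta> where "\<delta> = \<epsilon> / (2 * (\<bar>c\<bar> + \<bar>c'\<bar> + 1))"
  have "\<delta> > 0" using \<open>\<epsilon> > 0\<close> by (simp add: \<delta>_def add_nonneg_pos)
  have small: "(\<bar>c\<bar> + \<bar>c'\<bar>) * \<delta> < \<epsilon>"
  proof -
    have "(\<bar>c\<bar> + \<bar>c'\<bar>) * \<delta> \<le> (\<bar>c\<bar> + \<bar>c'\<bar> + 1) * \<delta>" using \<open>\<delta> > 0\<close> by (intro mult_right_mono) auto
    also have "\<dots> = \<epsilon> / 2" by (simp add: \<delta>_def field_simps add_nonneg_pos)
    finally show ?thesis using \<open>\<epsilon> > 0\<close> by simp
  qed
  let ?A = "\<lambda>n. {\<omega>\<in>space M. \<delta> < \<bar>Y n \<omega> - Z \<omega>\<bar>}"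
  let ?B = "\<lambda>n. {\<omega>\<in>space M. \<delta> < \<bar>Y' n \<omega> - Z' \<omega>\<bar>}"
  have le: "prob {\<omega>\<in>space M. \<epsilon> < \<bar>V n \<omega> - W \<omega>\<bar>} \<le> prob (?A n) + prob (?B n)" for n
  proof -
    have "prob {\<omega>\<in>space M. \<epsilon> < \<bar>V n \<omega> - W \<omega>\<bar>} \<le> prob (?A n \<union> ?B n)"
    proof (rule finite_measure_mono_AE)
      show "AE \<omega> in M. \<omega> \<in> {\<omega>\<in>space M. \<epsilon> < \<bar>V n \<omega> - W \<omega>\<bar>} \<longrightarrow> \<omega> \<in> ?A n \<union> ?B n"
        using V[of n] W
      proof eventually_elim
        case (elim \<omega>)
        show ?case
        proof
          assume *: "\<omega> \<in> {\<omega>\<in>space M. \<epsilon> < \<bar>V n \<omega> - W \<omega>\<bar>}"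
          show "\<omega> \<in> ?A n \<union> ?B n"
          proof (rule ccontr)
            assume "\<omega> \<notin> ?A n \<union> ?B n"
            with * have 1: "\<bar>Y n \<omega> - Z \<omega>\<bar> \<le> \<delta>" "\<bar>Y' n \<omega> - Z' \<omega>\<bar> \<le> \<delta>" by auto
            have "\<bar>V n \<omega> - W \<omega>\<bar> = \<bar>c * (Y n \<omega> - Z \<omega>) + c' * (Y' n \<omega> - Z' \<omega>)\<bar>"
              using elim by (simp add: algebra_simps)
            also have "\<dots> \<le> \<bar>c\<bar> * \<bar>Y n \<omega> - Z \<omega>\<bar> + \<bar>c'\<bar> * \<bar>Y' n \<omega> - Z' \<omega>\<bar>"
              by (rule order_trans[OF abs_triangle_ineq]) (simp add: abs_mult)
            also have "\<dots> \<le> \<bar>c\<bar> * \<delta> + \<bar>c'\<bar> * \<delta>" using 1 by (intro add_mono mult_left_mono) auto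
            finally show False using * small by (simp add: algebra_simps)
          qed
        qed
      qed
    qed measurable
    also have "\<dots> \<le> prob (?A n) + prob (?B n)" by (rule measure_Un_le) measurable
    finally show ?thesis .
  qed
  have "(\<lambda>n. prob (?A n) + prob (?B n)) \<longlonglongrightarrow> 0 + 0"
    using assms \<open>\<delta> > 0\<close> by (intro tendsto_add) (auto simp: tendsto_in_prob_def)
  then have lim: "(\<lambda>n. prob (?A n) + prob (?B n)) \<longlonglongrightarrow> 0" by simp
  show "(\<lambda>n. prob {\<omega>\<in>space M. \<epsilon> < \<bar>V n \<omega> - W \<omega>\<bar>}) \<longlonglongrightarrow> 0"
  proof (rule tendsto_sandwich[OF _ _ tendsto_const lim])
    show "\<forall>\<^sub>F n in sequentially. 0 \<le> prob {\<omega>\<in>space M. \<epsilon> < \<bar>V n \<omega> - W \<omega>\<bar>}" by simp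
    show "\<forall>\<^sub>F n in sequentially. prob {\<omega>\<in>space M. \<epsilon> < \<bar>V n \<omega> - W \<omega>\<bar>} \<le> prob (?A n) + prob (?B n)"
      by (rule always_eventually) (use le in blast)
  qed
qed (use meas in auto)

text \<open>The random variable \<open>iexp (s * x)\<close> has variance \<open>1 - \<bar>char P s\<bar>\<^sup>2\<close>; hence characteristic functions
  of modulus close to one are close to being multiplicative.\<close>

lemma (in real_distribution) char_add_approx:
  "cmod (char M (s + t) - char M s * char M t) \<le> sqrt (1 - (cmod (char M s))\<^sup>2)"
proof -
  let ?c = "char M s"
  let ?D = "\<lambda>x. iexp (s * x) - ?c"
  have bD: "cmod (?D x) \<le> 2" for x
    by (rule order_trans[OF norm_triangle_ineq4]) (use cmod_char_le_1[of s] in simp)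
  have [simp]: "integrable M (\<lambda>x. iexp (r * x))" for r by (rule integrable_iexp) auto
  have iD: "integrable M (\<lambda>x. cmod (?D x))"
    by (rule integrable_const_bound[where B=2]) (use bD in auto)
  have "(cmod (?D x))\<^sup>2 \<le> 2\<^sup>2" for x by (rule power_mono[OF bD]) auto
  then have iD2: "integrable M (\<lambda>x. (cmod (?D x))\<^sup>2)"
    by (intro integrable_const_bound[where B="2\<^sup>2"]) auto
  have D2: "(\<integral>x. (cmod (?D x))\<^sup>2 \<partial>M) = 1 - (cmod ?c)\<^sup>2"
  proof -
    have "(cmod (?D x))\<^sup>2 = 1 + (cmod ?c)\<^sup>2 - 2 * Re (cnj ?c * iexp (s * x))" for x
    proof -
      have "(cmod (?D x))\<^sup>2 = (cmod (iexp (s*x)))\<^sup>2 + (cmod ?c)\<^sup>2 - 2 * Re (cnj ?c * iexp (s * x))"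
        unfolding cmod_power2 by (simp add: power2_eq_square algebra_simps)
      then show ?thesis by simp
    qed
    then have "(\<integral>x. (cmod (?D x))\<^sup>2 \<partial>M) = (\<integral>x. 1 + (cmod ?c)\<^sup>2 - 2 * Re (cnj ?c * iexp (s * x)) \<partial>M)"
      by simp
    also have "\<dots> = 1 + (cmod ?c)\<^sup>2 - 2 * (\<integral>x. Re (cnj ?c * iexp (s * x)) \<partial>M)"
    proof -
      have "integrable M (\<lambda>x. cnj ?c * iexp (s * x))" by (rule integrable_mult_right) (simp del: of_real_mult)
      then have "integrable M (\<lambda>x. 2 * Re (cnj ?c * iexp (s * x)))"
        by (rule integrable_mult_right[OF integrable_Re])
      then have "(\<integral>x. 1 + (cmod ?c)\<^sup>2 - 2 * Re (cnj ?c * iexp (s * x)) \<partial>M)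
          = (\<integral>x. 1 + (cmod ?c)\<^sup>2 \<partial>M) - (\<integral>x. 2 * Re (cnj ?c * iexp (s * x)) \<partial>M)"
        by (intro Bochner_Integration.integral_diff) simp_all
      then show ?thesis
        unfolding lebesgue_integral_const integral_mult_right_zero prob_space by simp
    qed
    also have "(\<integral>x. Re (cnj ?c * iexp (s * x)) \<partial>M) = Re (cnj ?c * ?c)"
      by (subst integral_Re) (auto simp: char_def simp del: times_complex.sel of_real_mult)
    also have "\<dots> = (cmod ?c)\<^sup>2" unfolding cmod_power2 by (simp add: power2_eq_square)
    finally show ?thesis by simp
  qed
  \<comment> \<open>Jensen's inequality for the square passes from the variance of
    \<open>iexp (s * x)\<close> to its first absolute deviation, which bounds the covariance
    below.\<close>
  have D: "(\<integral>x. cmod (?D x) \<partial>M)\<^sup>2 \<le> (\<integral>x. (cmod (?D x))\<^sup>2 \<partial>M)"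
    by (rule jensens_inequality[where I=UNIV and q="\<lambda>x. x\<^sup>2"]) (use iD iD2 convex_power2 in auto)
  have "char M (s + t) - ?c * char M t = (\<integral>x. ?D x * iexp (t * x) \<partial>M)"
  proof -
    have "(\<integral>x. ?D x * iexp (t * x) \<partial>M) = (\<integral>x. iexp ((s + t) * x) - ?c * iexp (t * x) \<partial>M)"
      by (intro Bochner_Integration.integral_cong) (auto simp: algebra_simps exp_add)
    also have "\<dots> = char M (s + t) - ?c * char M t"
      by (subst Bochner_Integration.integral_diff) (auto simp: char_def simp del: of_real_mult)
    finally show ?thesis by simp
  qed
  also have "cmod \<dots> \<le> (\<integral>x. cmod (?D x * iexp (t * x)) \<partial>M)" by (rule integral_norm_bound)
  also have "\<dots> = (\<integral>x. cmod (?D x) \<partial>M)" by (simp add: norm_mult)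
  also have "\<dots> \<le> sqrt (1 - (cmod ?c)\<^sup>2)"
    by (rule real_le_rsqrt) (use D D2 in simp)
  finally show ?thesis .
qed

section \<open>Second moments recovered from characteristic functions\<close>

lemma one_minus_cos_scaled_tendsto:
  "(\<lambda>n. 2 * (real (Suc n))\<^sup>2 * (1 - cos (x / real (Suc n)))) \<longlonglongrightarrow> x\<^sup>2"
proof -
  have "((\<lambda>h. sin (x / 2 * h)) has_real_derivative cos (x / 2 * 0) * (x / 2)) (at 0)"
    by (auto intro!: derivative_eq_intros)
  then have "((\<lambda>h. sin (x / 2 * h) / h) \<longlongrightarrow> x / 2) (at 0)"
    by (simp add: has_field_derivative_iff)
  moreover have "filterlim (\<lambda>n. 1 / real (Suc n)) (at 0) sequentially"
    using LIMSEQ_inverse_real_of_nat by (auto simp: filterlim_at inverse_eq_divide)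
  ultimately have "(\<lambda>n. sin (x / 2 * (1 / real (Suc n))) / (1 / real (Suc n))) \<longlonglongrightarrow> x / 2"
    by (rule filterlim_compose)
  then have "(\<lambda>n. 4 * (sin (x / 2 * (1 / real (Suc n))) / (1 / real (Suc n)))\<^sup>2) \<longlonglongrightarrow> 4 * (x / 2)\<^sup>2"
    by (intro tendsto_mult tendsto_const tendsto_power)
  moreover have "4 * (sin (x / 2 * (1 / real (Suc n))) / (1 / real (Suc n)))\<^sup>2
      = 2 * (real (Suc n))\<^sup>2 * (1 - cos (x / real (Suc n)))" for n
  proof -
    have "cos (x / real (Suc n)) = 1 - 2 * (sin (x / 2 * (1 / real (Suc n))))\<^sup>2"
      using cos_double_sin[of "x / 2 * (1 / real (Suc n))"] by (simp del: of_nat_Suc)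
    then show ?thesis by (simp add: power_divide power_mult_distrib)
  qed
  ultimately have "(\<lambda>n. 2 * (real (Suc n))\<^sup>2 * (1 - cos (x / real (Suc n)))) \<longlonglongrightarrow> 4 * (x / 2)\<^sup>2"
    by (simp only:)
  then show ?thesis by (simp add: power_divide del: of_nat_Suc)
qed

lemma one_minus_cos_le: "1 - cos x \<le> x\<^sup>2 / 2" for x :: real
proof -
  have "1 - cos x = 2 * (sin (x / 2))\<^sup>2"
    using cos_double_sin[of "x / 2"] by simp
  also have "\<dots> \<le> 2 * (x / 2)\<^sup>2"
    using abs_sin_x_le_abs_x[of "x / 2"] by (intro mult_left_mono abs_le_square_iff[THEN iffD1]) auto
  finally show ?thesis by (simp add: power_divide)
qed

text \<open>Fatou's lemma for the nonnegative functions 2 n^2 (1 - cos (Y / n)), which tend to Y^2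
  and whose integrals are expressed by characteristic functions or cumulants. Extended integrals
  allow its use before the second moment is known to be finite.\<close>

lemma nn_integral_square_le_liminf:
  assumes [measurable]: "Y \<in> borel_measurable M"
  shows "(\<integral>\<^sup>+\<omega>. ennreal ((Y \<omega>)\<^sup>2) \<partial>M)
    \<le> liminf (\<lambda>n. \<integral>\<^sup>+\<omega>. ennreal (2 * (real (Suc n))\<^sup>2 * (1 - cos (Y \<omega> / real (Suc n)))) \<partial>M)"
proof -
  have "(\<integral>\<^sup>+\<omega>. ennreal ((Y \<omega>)\<^sup>2) \<partial>M)
      = (\<integral>\<^sup>+\<omega>. liminf (\<lambda>n. ennreal (2 * (real (Suc n))\<^sup>2 * (1 - cos (Y \<omega> / real (Suc n))))) \<partial>M)"
    by (intro nn_integral_cong lim_imp_Liminf[symmetric] tendsto_ennrealI one_minus_cos_scaled_tendsto) simp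
  also have "\<dots> \<le> liminf (\<lambda>n. \<integral>\<^sup>+\<omega>. ennreal (2 * (real (Suc n))\<^sup>2 * (1 - cos (Y \<omega> / real (Suc n)))) \<partial>M)"
    by (rule nn_integral_liminf) measurable
  finally show ?thesis .
qed

text \<open>Symmetrisation: 1 - |char s|^2 is the mean of 1 - cos (s (Y - Y')) for an independent
  copy Y', so the bound makes the second moment of Y - Y' finite by Fatou. Conditioning on a
  suitable value of Y' then makes Y - c square integrable for some constant c. Since only moduli
  enter, an unknown deterministic shift of \<open>Y\<close> does not matter.\<close>

lemma (in prob_space) square_integrable_if_char:
  assumes Y[measurable]: "Y \<in> borel_measurable M"
    and bound: "\<And>n. 1 - (cmod (char (distr M borel Y) (1 / real (Suc n))))\<^sup>2 \<le> C / (real (Suc n))\<^sup>2"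
  shows "integrable M (\<lambda>\<omega>. (Y \<omega>)\<^sup>2)"
proof -
  let ?\<phi> = "\<lambda>n. char (distr M borel Y) (1 / real (Suc n))"
  \<comment> \<open>The conditional mean of 2 n^2 (1 - cos ((Y - Y') / n)) given Y' = y, written out
    by the addition formula, with Suc n in the place of n.\<close>
  let ?h = "\<lambda>n y. 2 * (real (Suc n))\<^sup>2 * (1 - (cos (y / real (Suc n)) * Re (?\<phi> n) + sin (y / real (Suc n)) * Im (?\<phi> n)))"
  have int: "integrable M (\<lambda>\<omega>. cos (r * Y \<omega> + s))" "integrable M (\<lambda>\<omega>. sin (r * Y \<omega> + s))" for r s
    by (auto intro!: integrable_const_bound[where B=1])
  have int': "integrable M (\<lambda>\<omega>. cos (Y \<omega> / r))" "integrable M (\<lambda>\<omega>. sin (Y \<omega> / r))" for r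
    by (auto intro!: integrable_const_bound[where B=1])
  have Re: "Re (?\<phi> n) = (\<integral>\<omega>. cos (Y \<omega> / real (Suc n)) \<partial>M)"
    and Im: "Im (?\<phi> n) = (\<integral>\<omega>. sin (Y \<omega> / real (Suc n)) \<partial>M)" for n
    by (simp_all add: char_distr integrable_iexp Re_exp Im_exp del: of_real_mult of_real_divide of_nat_Suc
        flip: integral_Re integral_Im)
  have hint: "(\<integral>\<^sup>+\<omega>. ennreal (2 * (real (Suc n))\<^sup>2 * (1 - cos ((Y \<omega> - y) / real (Suc n)))) \<partial>M) = ennreal (?h n y)" for n y
  proof -
    have eq: "1 - cos ((Y \<omega> - y) / real (Suc n)) = 1 - (cos (y / real (Suc n)) * cos (Y \<omega> / real (Suc n)) + sin (y / real (Suc n)) * sin (Y \<omega> / real (Suc n)))" for \<omega>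
      by (simp add: diff_divide_distrib cos_diff mult.commute)
    have "(\<integral>\<^sup>+\<omega>. ennreal (2 * (real (Suc n))\<^sup>2 * (1 - cos ((Y \<omega> - y) / real (Suc n)))) \<partial>M)
       = ennreal (\<integral>\<omega>. 2 * (real (Suc n))\<^sup>2 * (1 - cos ((Y \<omega> - y) / real (Suc n))) \<partial>M)"
    proof (rule nn_integral_eq_integral)
      have "integrable M (\<lambda>\<omega>. cos ((Y \<omega> - y) / real (Suc n)))"
        by (rule integrable_const_bound[where B=1]) auto
      then show "integrable M (\<lambda>\<omega>. 2 * (real (Suc n))\<^sup>2 * (1 - cos ((Y \<omega> - y) / real (Suc n))))" by simp
    qed simp
    also have "(\<integral>\<omega>. 2 * (real (Suc n))\<^sup>2 * (1 - cos ((Y \<omega> - y) / real (Suc n))) \<partial>M)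
       = (\<integral>\<omega>. 2 * (real (Suc n))\<^sup>2 * (1 - (cos (y / real (Suc n)) * cos (Y \<omega> / real (Suc n)) + sin (y / real (Suc n)) * sin (Y \<omega> / real (Suc n)))) \<partial>M)"
      unfolding eq ..
    also have "\<dots> = ennreal (?h n y)"
      by (simp add: Re Im int' prob_space del: of_nat_Suc)
    finally show ?thesis .
  qed
  have inner: "(\<integral>\<^sup>+\<omega>. ennreal ((Y \<omega> - y)\<^sup>2) \<partial>M) \<le> liminf (\<lambda>n. ennreal (?h n y))" for y
    using nn_integral_square_le_liminf[of "\<lambda>\<omega>. Y \<omega> - y" M] unfolding hint by simp
  have hnn: "0 \<le> ?h n y" for n y
  proof -
    have "cmod (?\<phi> n) \<le> 1"
      by (rule real_distribution.cmod_char_le_1) (auto simp: real_distribution_distr)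
    moreover have "cos (y / real (Suc n)) * Re (?\<phi> n) + sin (y / real (Suc n)) * Im (?\<phi> n) = Re (cnj (cis (y / real (Suc n))) * ?\<phi> n)"
      by simp
    moreover have "\<dots> \<le> cmod (cnj (cis (y / real (Suc n))) * ?\<phi> n)" by (rule complex_Re_le_cmod)
    ultimately show ?thesis by (simp add: norm_mult)
  qed
  have outer: "(\<integral>\<^sup>+\<omega>. ennreal (?h n (Y \<omega>)) \<partial>M) \<le> ennreal (2 * C)" for n
  proof -
    have "(\<integral>\<^sup>+\<omega>. ennreal (?h n (Y \<omega>)) \<partial>M) = ennreal (\<integral>\<omega>. ?h n (Y \<omega>) \<partial>M)"
      by (rule nn_integral_eq_integral)
        (use hnn in \<open>auto simp del: of_nat_Suc intro!: integrable_mult_right Bochner_Integration.integrable_diff Bochner_Integration.integrable_add integrable_mult_left int'\<close>)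
    also have "(\<integral>\<omega>. ?h n (Y \<omega>) \<partial>M) = 2 * (real (Suc n))\<^sup>2 * (1 - (cmod (?\<phi> n))\<^sup>2)"
      unfolding cmod_power2 by (simp add: int' prob_space power2_eq_square flip: Re Im del: of_nat_Suc)
    also have "\<dots> \<le> 2 * (real (Suc n))\<^sup>2 * (C / (real (Suc n))\<^sup>2)"
      by (intro mult_left_mono bound) auto
    also have "\<dots> = 2 * C" by simp
    finally show ?thesis by (auto intro: ennreal_leI)
  qed
  \<comment> \<open>The iterated integral over \<open>M\<close> plays the role of the independent
    copy; Fatou is applied a second time, now to the outer variable.\<close>
  have "(\<integral>\<^sup>+\<omega>'. (\<integral>\<^sup>+\<omega>. ennreal ((Y \<omega> - Y \<omega>')\<^sup>2) \<partial>M) \<partial>M) \<le> (\<integral>\<^sup>+\<omega>'. liminf (\<lambda>n. ennreal (?h n (Y \<omega>'))) \<partial>M)"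
    by (intro nn_integral_mono inner)
  also have "\<dots> \<le> liminf (\<lambda>n. \<integral>\<^sup>+\<omega>. ennreal (?h n (Y \<omega>)) \<partial>M)"
    by (rule nn_integral_liminf) measurable
  also have "\<dots> \<le> ennreal (2 * C)"
    using outer by (intro Liminf_le always_eventually) (auto simp del: of_nat_Suc)
  finally have fin: "(\<integral>\<^sup>+\<omega>'. (\<integral>\<^sup>+\<omega>. ennreal ((Y \<omega> - Y \<omega>')\<^sup>2) \<partial>M) \<partial>M) \<noteq> \<infinity>"
    by (auto simp: top_unique)
  have "AE \<omega>' in M. (\<integral>\<^sup>+\<omega>. ennreal ((Y \<omega> - Y \<omega>')\<^sup>2) \<partial>M) \<noteq> \<infinity>"
    by (rule nn_integral_noteq_infinite[OF _ fin]) measurable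
  \<comment> \<open>On a space of mass one, what holds almost everywhere holds somewhere; the value
    of \<open>Y\<close> at such a point serves as the centre c.\<close>
  then have "\<not> (\<forall>c. (\<integral>\<^sup>+\<omega>. ennreal ((Y \<omega> - c)\<^sup>2) \<partial>M) = \<infinity>)"
    by (intro notI) (simp add: AE_False)
  then obtain c where c: "(\<integral>\<^sup>+\<omega>. ennreal ((Y \<omega> - c)\<^sup>2) \<partial>M) \<noteq> \<infinity>"
    by blast
  have "integrable M (\<lambda>\<omega>. (Y \<omega> - c)\<^sup>2)"
    by (rule integrableI_nonneg) (use c in \<open>auto simp: less_top\<close>)
  then have "integrable M (\<lambda>\<omega>. 2 * (Y \<omega> - c)\<^sup>2 + 2 * c\<^sup>2)" by auto
  then show ?thesis
  proof (rule Bochner_Integration.integrable_bound)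
    show "AE \<omega> in M. norm ((Y \<omega>)\<^sup>2) \<le> norm (2 * (Y \<omega> - c)\<^sup>2 + 2 * c\<^sup>2)"
    proof (rule AE_I2)
      fix \<omega>
      have "0 \<le> (Y \<omega> - 2 * c)\<^sup>2" by simp
      then show "norm ((Y \<omega>)\<^sup>2) \<le> norm (2 * (Y \<omega> - c)\<^sup>2 + 2 * c\<^sup>2)"
        by (simp add: power2_eq_square algebra_simps)
    qed
  qed measurable
qed

text \<open>If the limit l were positive, mass close to l would keep sliding down the sequence
  \<open>D\<close>. Alternating choices of depth and index isolate disjoint blocks, each heavy for
  its own measure; the union of every second block would then have oscillating measure, against
  setwise convergence. This is the argument behind the Vitali-Hahn-Saks theorem.\<close>

lemma gliding_hump:
  fixes m :: "nat \<Rightarrow> 'a measure"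
  assumes sets: "\<And>n. sets (m n) = S" and fin: "\<And>n. finite_measure (m n)"
    and conv: "\<And>A. A \<in> S \<Longrightarrow> convergent (\<lambda>n. measure (m n) A)"
    and D: "\<And>j. D j \<in> S" "decseq D"
    and null: "\<And>n. (\<lambda>j. measure (m n) (D j)) \<longlonglongrightarrow> 0"
  shows "(\<lambda>j. lim (\<lambda>n. measure (m n) (D j))) \<longlonglongrightarrow> 0"
proof -
  define c where "c j = lim (\<lambda>n. measure (m n) (D j))" for j
  have D_mono: "D j' \<subseteq> D j" if "j \<le> j'" for j j'
    using D(2) that by (auto simp: decseq_def)
  have mono: "measure (m n) A \<le> measure (m n) B" if "A \<subseteq> B" "B \<in> S" for n A B
    using finite_measure.finite_measure_mono[OF fin that(1)] that sets by auto
  have diff: "measure (m n) (D j - D j') = measure (m n) (D j) - measure (m n) (D j')" if "j \<le> j'" for n j j'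
    using finite_measure.finite_measure_Diff[OF fin] D D_mono[OF that] sets by auto
  have c: "(\<lambda>n. measure (m n) (D j)) \<longlonglongrightarrow> c j" for j
    unfolding c_def using conv[OF D(1)] by (simp add: convergent_LIMSEQ_iff)
  have "decseq c"
    by (rule decseq_SucI) (auto intro!: LIMSEQ_le[OF c c] mono D D_mono)
  moreover have c0: "c j \<ge> 0" for j
    by (rule LIMSEQ_le_const[OF c]) auto
  ultimately obtain l where l: "c \<longlonglongrightarrow> l" "\<And>j. l \<le> c j"
    using decseq_convergent[of c 0] by auto
  have "l \<ge> 0" by (rule LIMSEQ_le_const[OF l(1)]) (use c0 in auto)
  have "l = 0"
  proof (rule ccontr)
    assume "l \<noteq> 0"
    \<comment> \<open>The eighth creates the gap used below: at its own index a block has mass above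
      7 e - e = 6 e, while the remainder of the union has mass below 2 e + e = 3 e.\<close>
    define e where "e = l / 8"
    have e: "e > 0" "l = 8 * e" using \<open>l \<ge> 0\<close> \<open>l \<noteq> 0\<close> by (auto simp: e_def)
    obtain j0 where j0: "c j0 < l + e"
      using order_tendstoD(2)[OF l(1), of "l + e"] e by (auto simp: eventually_sequentially)
    \<comment> \<open>State of the construction: the block from depth j to j' is heavy for
      \<open>m n\<close>, while what lies between \<open>j0\<close> and j and what lies beyond j'
      are light for the same measure.\<close>
    define P where "P = (\<lambda>(j, j', n). j0 \<le> j \<and> j < j' \<and> 6 * e < measure (m n) (D j - D j') \<and>
      measure (m n) (D j0 - D j) < 2 * e \<and> measure (m n) (D j') < e)"
    have step: "\<exists>n j'. N < n \<and> P (j, j', n)" if "j0 \<le> j" for j N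
    proof -
      have "eventually (\<lambda>n. measure (m n) (D j) > l - e) sequentially"
        using order_tendstoD(1)[OF c, of "l - e" j] l(2)[of j] e by auto
      moreover have "(\<lambda>n. measure (m n) (D j0 - D j)) \<longlonglongrightarrow> c j0 - c j"
        unfolding diff[OF that] by (intro tendsto_diff c)
      then have "eventually (\<lambda>n. measure (m n) (D j0 - D j) < 2 * e) sequentially"
        by (rule order_tendstoD(2)) (use j0 l(2)[of j] e in auto)
      moreover have "eventually (\<lambda>n. N < n) sequentially" by (rule eventually_gt_at_top)
      ultimately have "eventually (\<lambda>n. measure (m n) (D j) > l - e \<and>
          measure (m n) (D j0 - D j) < 2 * e \<and> N < n) sequentially"
        by eventually_elim auto
      then obtain n where n: "measure (m n) (D j) > l - e" "measure (m n) (D j0 - D j) < 2 * e" "N < n"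
        by (auto dest: eventually_happens)
      have "eventually (\<lambda>j'. measure (m n) (D j') < e \<and> j < j') sequentially"
        using order_tendstoD(2)[OF null[of n], of e] e eventually_gt_at_top by (auto intro: eventually_conj)
      then obtain j' where "measure (m n) (D j') < e" "j < j'"
        by (auto dest: eventually_happens)
      then show ?thesis
        using n that e diff[of j j' n] by (intro exI[of _ n] exI[of _ j']) (auto simp: P_def)
    qed
    have "\<exists>f. \<forall>k. P (f k) \<and> (fst (f (Suc k)) = fst (snd (f k)) \<and> snd (snd (f k)) < snd (snd (f (Suc k))))"
    proof (rule dependent_nat_choice)
      show "\<exists>x. P x" using step[of j0 0] by auto
    next
      fix x :: "nat \<times> nat \<times> nat" and k :: nat
      assume "P x"
      then obtain n j' where "snd (snd x) < n" "P (fst (snd x), j', n)"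
        using step[of "fst (snd x)" "snd (snd x)"] by (auto simp: P_def)
      then show "\<exists>y. P y \<and> (fst y = fst (snd x) \<and> snd (snd x) < snd (snd y))" by force
    qed
    then obtain f where f: "\<And>k. P (f k)" "\<And>k. fst (f (Suc k)) = fst (snd (f k))"
      "\<And>k. snd (snd (f k)) < snd (snd (f (Suc k)))" by blast
    define J where "J k = fst (f k)" for k
    define n where "n k = snd (snd (f k))" for k
    have fk: "f k = (J k, J (Suc k), n k)" for k
      by (simp add: J_def n_def f(2))
    have PJ: "j0 \<le> J k" "J k < J (Suc k)" "6 * e < measure (m (n k)) (D (J k) - D (J (Suc k)))"
      "measure (m (n k)) (D j0 - D (J k)) < 2 * e" "measure (m (n k)) (D (J (Suc k))) < e" for k
      using f(1)[of k] unfolding fk P_def by auto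
    have sm: "strict_mono J" "strict_mono n"
      using PJ(2) f(3) by (auto simp: strict_mono_Suc_iff n_def)
    \<comment> \<open>Every second block is left out, so that the measures with odd position have
      their heavy block outside of \<open>A\<close>.\<close>
    define A where "A = (\<Union>k. D (J (2 * k)) - D (J (Suc (2 * k))))"
    have DS: "D i - D j \<in> S" for i j using D(1) sets[of 0] by (metis sets.Diff)
    have "A \<in> sets (m 0)" unfolding A_def using DS sets by (intro sets.countable_UN) auto
    then have AS: "A \<in> S" using sets by simp
    have even: "6 * e < measure (m (n (2 * k))) A" for k
      using PJ(3)[of "2 * k"] by (rule less_le_trans) (rule mono[OF _ AS], auto simp: A_def)
    have odd: "measure (m (n (Suc (2 * k)))) A < 3 * e" for k
    proof -
      let ?k = "Suc (2 * k)"
      \<comment> \<open>At an odd position the union misses the heavy block and is contained in the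
        light head and the light tail.\<close>
      have "A \<subseteq> (D j0 - D (J ?k)) \<union> D (J (Suc ?k))"
      proof
        fix x assume "x \<in> A"
        then obtain i where i: "x \<in> D (J (2 * i))" "x \<notin> D (J (Suc (2 * i)))" by (auto simp: A_def)
        show "x \<in> (D j0 - D (J ?k)) \<union> D (J (Suc ?k))"
        proof (cases "i \<le> k")
          case True
          then have "D (J ?k) \<subseteq> D (J (Suc (2 * i)))"
            using sm(1) by (intro D_mono) (simp add: strict_mono_less_eq)
          then show ?thesis using i D_mono[OF PJ(1)[of "2 * i"]] by auto
        next
          case False
          then have "D (J (2 * i)) \<subseteq> D (J (Suc ?k))"
            using sm(1) by (intro D_mono) (simp add: strict_mono_less_eq)
          then show ?thesis using i by auto
        qed
      qed
      then have "measure (m (n ?k)) A \<le> measure (m (n ?k)) ((D j0 - D (J ?k)) \<union> D (J (Suc ?k)))"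
        using DS D(1) sets[of 0] by (intro mono) (auto simp flip: sets)
      also have "\<dots> \<le> measure (m (n ?k)) (D j0 - D (J ?k)) + measure (m (n ?k)) (D (J (Suc ?k)))"
        using DS D(1) sets by (intro measure_Un_le) auto
      also have "\<dots> < 3 * e" using PJ(4,5)[of ?k] by simp
      finally show ?thesis .
    qed
    obtain L where L: "(\<lambda>i. measure (m i) A) \<longlonglongrightarrow> L" using conv[OF AS] by (auto simp: convergent_def)
    have s1: "strict_mono (\<lambda>k. n (2 * k))" and s2: "strict_mono (\<lambda>k. n (Suc (2 * k)))"
      using sm(2) by (auto simp: strict_mono_def)
    have "6 * e \<le> L"
      using LIMSEQ_subseq_LIMSEQ[OF L s1] by (rule LIMSEQ_le_const) (use even in \<open>auto simp: o_def intro: less_imp_le\<close>)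
    moreover have "L \<le> 3 * e"
      using LIMSEQ_subseq_LIMSEQ[OF L s2] by (rule LIMSEQ_le_const2) (use odd in \<open>auto simp: o_def intro: less_imp_le\<close>)
    ultimately show False using e by simp
  qed
  then show ?thesis using l(1) by (simp add: c_def[abs_def])
qed

section \<open>Stochastic integrals with respect to a Levy basis\<close>

lemma iexp_mult_left: "iexp (r * (c * x)) = iexp ((r * c) * x)"
  by (simp add: mult.assoc)

text \<open>These properties of the exponent are all that is used to split off the negligible part
  of an integral. \<open>Re_exponent_double\<close> says |char (2 \<zeta>)| \<ge> |char \<zeta>|^4
  for the values of the random measure; for Levy cumulants it stems from 1 - cos (2 x) \<le> 4 (1 -
  cos x).\<close>

locale levy_noise = prob_space M + sigma_finite_measure \<nu>
  for M :: "'w measure" and \<nu> :: "'e measure" +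
  fixes \<kappa> :: "real \<Rightarrow> complex" and \<Lambda> :: "'e set \<Rightarrow> 'w \<Rightarrow> real"
  assumes basis: "levy_basis M \<nu> \<kappa> \<Lambda>"
    and exponent_0: "\<kappa> 0 = 0"
    and isCont_exponent: "\<And>\<zeta>. isCont \<kappa> \<zeta>"
    and Re_exponent_le_0: "\<And>\<zeta>. Re (\<kappa> \<zeta>) \<le> 0"
    and Re_exponent_double: "\<And>\<zeta>. 4 * Re (\<kappa> \<zeta>) \<le> Re (\<kappa> (2 * \<zeta>))"
begin

lemma measurable_basis: "A \<in> finite_sets \<nu> \<Longrightarrow> \<Lambda> A \<in> borel_measurable M"
  using basis by (auto simp: levy_basis_def)

lemma char_basis: "A \<in> finite_sets \<nu> \<Longrightarrow>
    char (distr M borel (\<Lambda> A)) \<zeta> = exp (of_real (measure \<nu> A) * \<kappa> \<zeta>)"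
  using basis by (auto simp: levy_basis_def)

lemma basis_sums:
  fixes A :: "nat \<Rightarrow> 'e set"
  assumes "range A \<subseteq> finite_sets \<nu>" "disjoint_family A" "(\<Union>n. A n) \<in> finite_sets \<nu>"
  shows "AE \<omega> in M. (\<lambda>n. \<Lambda> (A n) \<omega>) sums \<Lambda> (\<Union>n. A n) \<omega>"
  using basis assms by (auto simp: levy_basis_def)

lemma basis_indep:
  fixes A :: "nat \<Rightarrow> 'e set"
  assumes "range A \<subseteq> finite_sets \<nu>" "disjoint_family A"
  shows "indep_vars (\<lambda>_. borel) (\<lambda>n. \<Lambda> (A n)) UNIV"
  using basis assms by (auto simp: levy_basis_def)

text \<open>A constant series converges only if its terms vanish. This lets the axioms for sequences
  of sets be applied to finite families padded with empty sets.\<close>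

lemma basis_empty: "AE \<omega> in M. \<Lambda> {} \<omega> = 0"
proof -
  have "AE \<omega> in M. (\<lambda>n::nat. \<Lambda> {} \<omega>) sums \<Lambda> (\<Union>n::nat. {}) \<omega>"
    by (rule basis_sums) (auto simp: finite_sets_def disjoint_family_on_def)
  then show ?thesis
  proof eventually_elim
    case (elim \<omega>)
    then have "(\<lambda>n::nat. \<Lambda> {} \<omega>) \<longlonglongrightarrow> 0" by (intro summable_LIMSEQ_zero sums_summable)
    then show ?case by (simp add: LIMSEQ_const_iff)
  qed
qed

text \<open>The axioms of the random measure speak of sequences, so the finite family is enumerated
  and continued by empty sets; independence of the sequence then restricts to the finite
  part.\<close>

lemma
  assumes "finite I" and A: "\<And>i. i \<in> I \<Longrightarrow> A i \<in> finite_sets \<nu>" and disj: "disjoint_family_on A I"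
  shows basis_finite_Union: "AE \<omega> in M. \<Lambda> (\<Union>i\<in>I. A i) \<omega> = (\<Sum>i\<in>I. \<Lambda> (A i) \<omega>)"
    and char_basis_sum: "char (distr M borel (\<lambda>\<omega>. \<Sum>i\<in>I. c i * \<Lambda> (A i) \<omega>)) \<zeta>
      = (\<Prod>i\<in>I. exp (of_real (measure \<nu> (A i)) * \<kappa> (\<zeta> * c i)))"
proof -
  obtain h where h: "bij_betw h {0..<card I} I"
    using ex_bij_betw_nat_finite[OF \<open>finite I\<close>] by auto
  let ?n = "card I"
  define A' where "A' k = (if k < ?n then A (h k) else {})" for k
  have hI: "h k \<in> I" if "k < ?n" for k using h that by (auto simp: bij_betw_def)
  have inj: "inj_on h {0..<?n}" using h by (simp add: bij_betw_def)
  have ran: "range A' \<subseteq> finite_sets \<nu>"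
    using A hI by (auto simp: A'_def finite_sets_def)
  have dis: "disjoint_family A'"
    unfolding disjoint_family_on_def
  proof (intro ballI impI)
    fix k l :: nat assume "k \<noteq> l"
    show "A' k \<inter> A' l = {}"
    proof (cases "k < ?n \<and> l < ?n")
      case True
      then have "h k \<noteq> h l" using inj \<open>k \<noteq> l\<close> by (auto simp: inj_on_def)
      then show ?thesis using True disj hI by (auto simp: A'_def disjoint_family_on_def)
    qed (auto simp: A'_def)
  qed
  have UN: "(\<Union>k. A' k) = (\<Union>i\<in>I. A i)"
  proof -
    have "(\<Union>k. A' k) = (\<Union>k\<in>{0..<?n}. A (h k))" by (auto simp: A'_def)
    also have "\<dots> = (\<Union>i\<in>h ` {0..<?n}. A i)" by blast
    also have "h ` {0..<?n} = I" using h by (simp add: bij_betw_def)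
    finally show ?thesis .
  qed
  have "(\<Union>k. A' k) \<in> finite_sets \<nu>"
    unfolding UN finite_sets_def
  proof (intro CollectI conjI)
    show "(\<Union>i\<in>I. A i) \<in> sets \<nu>" using A \<open>finite I\<close> by (auto simp: finite_sets_def)
    have "emeasure \<nu> (\<Union>i\<in>I. A i) \<le> (\<Sum>i\<in>I. emeasure \<nu> (A i))"
      using A \<open>finite I\<close> by (intro emeasure_subadditive_finite) (auto simp: finite_sets_def)
    also have "\<dots> < \<infinity>" using A \<open>finite I\<close> by (simp add: finite_sets_def)
    finally show "emeasure \<nu> (\<Union>i\<in>I. A i) < \<infinity>" .
  qed
  from basis_sums[OF ran dis this] basis_empty
  show "AE \<omega> in M. \<Lambda> (\<Union>i\<in>I. A i) \<omega> = (\<Sum>i\<in>I. \<Lambda> (A i) \<omega>)"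
  proof eventually_elim
    case (elim \<omega>)
    have "(\<lambda>k. \<Lambda> (A' k) \<omega>) sums (\<Sum>k\<in>{0..<?n}. \<Lambda> (A' k) \<omega>)"
      by (rule sums_finite) (auto simp: A'_def elim(2))
    then have "\<Lambda> (\<Union>k. A' k) \<omega> = (\<Sum>k\<in>{0..<?n}. \<Lambda> (A' k) \<omega>)"
      using elim(1) by (rule sums_unique2[symmetric])
    also have "\<dots> = (\<Sum>k\<in>{0..<?n}. \<Lambda> (A (h k)) \<omega>)" by (simp add: A'_def)
    also have "\<dots> = (\<Sum>i\<in>I. \<Lambda> (A i) \<omega>)" by (rule sum.reindex_bij_betw[OF h])
    finally show ?case by (simp add: UN)
  qed
  have "indep_vars (\<lambda>_. borel) (\<lambda>k. \<Lambda> (A' k)) {0..<?n}"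
    using basis_indep[OF ran dis] by (rule indep_vars_subset) simp
  then have indep: "indep_vars (\<lambda>_. borel) (\<lambda>k \<omega>. c (h k) * \<Lambda> (A' k) \<omega>) {0..<?n}"
    by (rule indep_vars_compose2) measurable
  have "(\<Sum>i\<in>I. c i * \<Lambda> (A i) \<omega>) = (\<Sum>k\<in>{0..<?n}. c (h k) * \<Lambda> (A' k) \<omega>)" for \<omega>
    by (subst sum.reindex_bij_betw[OF h, symmetric]) (simp add: A'_def)
  then have "char (distr M borel (\<lambda>\<omega>. \<Sum>i\<in>I. c i * \<Lambda> (A i) \<omega>)) \<zeta>
      = (\<Prod>k\<in>{0..<?n}. char (distr M borel (\<lambda>\<omega>. c (h k) * \<Lambda> (A' k) \<omega>)) \<zeta>)"
    using char_distr_sum[OF indep] by simp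
  also have "\<dots> = (\<Prod>k\<in>{0..<?n}. exp (of_real (measure \<nu> (A (h k))) * \<kappa> (\<zeta> * c (h k))))"
  proof (rule prod.cong[OF refl])
    fix k assume k: "k \<in> {0..<?n}"
    then have A: "A (h k) \<in> finite_sets \<nu>" using A hI by auto
    have [measurable]: "\<Lambda> (A (h k)) \<in> borel_measurable M" by (rule measurable_basis[OF A])
    have "char (distr M borel (\<lambda>\<omega>. c (h k) * \<Lambda> (A (h k)) \<omega>)) \<zeta> = char (distr M borel (\<Lambda> (A (h k)))) (\<zeta> * c (h k))"
      by (subst (1 2) char_distr) (auto simp: iexp_mult_left simp del: of_real_mult)
    then show "char (distr M borel (\<lambda>\<omega>. c (h k) * \<Lambda> (A' k) \<omega>)) \<zeta> = exp (of_real (measure \<nu> (A (h k))) * \<kappa> (\<zeta> * c (h k)))"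
      using k by (simp add: char_basis[OF A] A'_def)
  qed
  also have "\<dots> = (\<Prod>i\<in>I. exp (of_real (measure \<nu> (A i)) * \<kappa> (\<zeta> * c i)))"
    by (rule prod.reindex_bij_betw[OF h])
  finally show "char (distr M borel (\<lambda>\<omega>. \<Sum>i\<in>I. c i * \<Lambda> (A i) \<omega>)) \<zeta>
      = (\<Prod>i\<in>I. exp (of_real (measure \<nu> (A i)) * \<kappa> (\<zeta> * c i)))" .
qed

section \<open>Integrals of simple functions\<close>

definition elementary :: "('e \<Rightarrow> real) \<Rightarrow> bool" where
  "elementary g \<longleftrightarrow> simple_function \<nu> g \<and> emeasure \<nu> {x\<in>space \<nu>. g x \<noteq> 0} < \<infinity>"

lemma elementary_level_set:
  assumes "elementary g" "y \<noteq> 0" "A \<in> sets \<nu>"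
  shows "A \<inter> {x\<in>space \<nu>. g x = y} \<in> finite_sets \<nu>"
proof -
  have [measurable]: "g \<in> borel_measurable \<nu>"
    using assms by (auto simp: elementary_def borel_measurable_simple_function)
  have "emeasure \<nu> (A \<inter> {x\<in>space \<nu>. g x = y}) \<le> emeasure \<nu> {x\<in>space \<nu>. g x \<noteq> 0}"
    using assms(2) by (intro emeasure_mono) auto
  also have "\<dots> < \<infinity>" using assms by (simp add: elementary_def)
  finally show ?thesis using assms by (auto simp: finite_sets_def)
qed

lemma measurable_simple_stoch_integral:
  assumes "elementary g" "A \<in> sets \<nu>"
  shows "simple_stoch_integral \<nu> \<Lambda> A g \<in> borel_measurable M"
proof -
  have "(\<lambda>\<omega>. \<Sum>y\<in>g ` space \<nu> - {0}. y * \<Lambda> (A \<inter> {x\<in>space \<nu>. g x = y}) \<omega>) \<in> borel_measurable M"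
    by (intro borel_measurable_sum borel_measurable_times borel_measurable_const measurable_basis
        elementary_level_set assms) auto
  then show ?thesis by (simp add: simple_stoch_integral_def[abs_def])
qed

text \<open>The level sets of \<open>u \<circ> h\<close> are unions of level sets of \<open>h\<close>; for \<open>h = (\<lambda>x. (g x, g' x))\<close> this
  represents the integrals of \<open>g\<close>, \<open>g'\<close> and their linear combinations over a common partition.\<close>

lemma simple_stoch_integral_comp:
  assumes "finite (h ` space \<nu>)" and A: "A \<in> sets \<nu>"
    and C: "C \<subseteq> h ` space \<nu>" "\<And>c. c \<in> h ` space \<nu> \<Longrightarrow> u c \<noteq> 0 \<Longrightarrow> c \<in> C"
    and fin: "\<And>c. c \<in> C \<Longrightarrow> A \<inter> {x\<in>space \<nu>. h x = c} \<in> finite_sets \<nu>"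
  shows "AE \<omega> in M. simple_stoch_integral \<nu> \<Lambda> A (\<lambda>x. u (h x)) \<omega>
    = (\<Sum>c\<in>C. u c * \<Lambda> (A \<inter> {x\<in>space \<nu>. h x = c}) \<omega>)"
proof -
  let ?Y = "(\<lambda>x. u (h x)) ` space \<nu> - {0}"
  let ?C = "\<lambda>y. {c \<in> {c\<in>C. u c \<noteq> 0}. u c = y}"
  have finC: "finite C" using C(1) assms(1) by (rule finite_subset)
  have finY: "finite ?Y" using assms(1) by (metis finite_Diff finite_imageI image_image)
  have "AE \<omega> in M. \<forall>y\<in>?Y. \<Lambda> (A \<inter> {x\<in>space \<nu>. u (h x) = y}) \<omega> = (\<Sum>c\<in>?C y. \<Lambda> (A \<inter> {x\<in>space \<nu>. h x = c}) \<omega>)"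
  proof (rule AE_finite_allI[OF finY])
    fix y assume y: "y \<in> ?Y"
    have "A \<inter> {x\<in>space \<nu>. u (h x) = y} = (\<Union>c\<in>?C y. A \<inter> {x\<in>space \<nu>. h x = c})"
      using y C by auto
    moreover have "AE \<omega> in M. \<Lambda> (\<Union>c\<in>?C y. A \<inter> {x\<in>space \<nu>. h x = c}) \<omega> = (\<Sum>c\<in>?C y. \<Lambda> (A \<inter> {x\<in>space \<nu>. h x = c}) \<omega>)"
      by (rule basis_finite_Union) (use finC fin in \<open>auto simp: disjoint_family_on_def\<close>)
    ultimately show "AE \<omega> in M. \<Lambda> (A \<inter> {x\<in>space \<nu>. u (h x) = y}) \<omega> = (\<Sum>c\<in>?C y. \<Lambda> (A \<inter> {x\<in>space \<nu>. h x = c}) \<omega>)"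
      by simp
  qed
  then show ?thesis
  proof eventually_elim
    case (elim \<omega>)
    let ?L = "\<lambda>c. \<Lambda> (A \<inter> {x\<in>space \<nu>. h x = c}) \<omega>"
    have "simple_stoch_integral \<nu> \<Lambda> A (\<lambda>x. u (h x)) \<omega> = (\<Sum>y\<in>?Y. y * (\<Sum>c\<in>?C y. ?L c))"
      unfolding simple_stoch_integral_def using elim by (intro sum.cong refl) (auto intro: arg_cong2[where f="(*)"])
    also have "\<dots> = (\<Sum>y\<in>?Y. \<Sum>c\<in>?C y. u c * ?L c)"
      unfolding sum_distrib_left by (intro sum.cong refl) auto
    also have "\<dots> = (\<Sum>c\<in>{c\<in>C. u c \<noteq> 0}. u c * ?L c)"
      by (rule sum.group) (use finC finY C in auto)
    also have "\<dots> = (\<Sum>c\<in>C. u c * ?L c)"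
      by (rule sum.mono_neutral_left) (use finC in auto)
    finally show ?case .
  qed
qed

lemma elementary_linear:
  assumes "elementary g" "elementary g'"
  shows "elementary (\<lambda>x. c * g x + c' * g' x)"
proof -
  have [measurable]: "g \<in> borel_measurable \<nu>" "g' \<in> borel_measurable \<nu>"
    using assms by (auto simp: elementary_def borel_measurable_simple_function)
  have "emeasure \<nu> {x\<in>space \<nu>. c * g x + c' * g' x \<noteq> 0}
      \<le> emeasure \<nu> ({x\<in>space \<nu>. g x \<noteq> 0} \<union> {x\<in>space \<nu>. g' x \<noteq> 0})"
    by (intro emeasure_mono) auto
  also have "\<dots> \<le> emeasure \<nu> {x\<in>space \<nu>. g x \<noteq> 0} + emeasure \<nu> {x\<in>space \<nu>. g' x \<noteq> 0}"
    by (intro emeasure_subadditive) auto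
  also have "\<dots> < \<infinity>" using assms by (auto simp: elementary_def)
  finally show ?thesis
    using assms by (auto simp: elementary_def)
qed

lemma simple_stoch_integral_linear:
  assumes g: "elementary g" "elementary g'" and A: "A \<in> sets \<nu>"
  shows "AE \<omega> in M. simple_stoch_integral \<nu> \<Lambda> A (\<lambda>x. c * g x + c' * g' x) \<omega>
    = c * simple_stoch_integral \<nu> \<Lambda> A g \<omega> + c' * simple_stoch_integral \<nu> \<Lambda> A g' \<omega>"
proof -
  let ?h = "\<lambda>x. (g x, g' x)"
  \<comment> \<open>The joint level set over (0, 0) may have infinite measure and is dropped; every
    other one lies in a nonzero level set of \<open>g\<close> or of \<open>g'\<close>.\<close>
  let ?C = "?h ` space \<nu> - {(0, 0)}"
  have "finite (g ` space \<nu> \<times> g' ` space \<nu>)"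
    using g by (auto simp: elementary_def simple_function_def)
  then have fin: "finite (?h ` space \<nu>)" by (rule finite_subset[rotated]) auto
  have lev: "A \<inter> {x\<in>space \<nu>. ?h x = p} \<in> finite_sets \<nu>" if "p \<in> ?C" for p
  proof -
    obtain y y' where p: "p = (y, y')" by (cases p)
    have [measurable]: "g \<in> borel_measurable \<nu>" "g' \<in> borel_measurable \<nu>"
      using g by (auto simp: elementary_def borel_measurable_simple_function)
    have s: "A \<inter> {x\<in>space \<nu>. ?h x = p} \<in> sets \<nu>" unfolding p using A by simp measurable
    have "y \<noteq> 0 \<or> y' \<noteq> 0" using that p by auto
    then consider "y \<noteq> 0" | "y' \<noteq> 0" by blast
    then have "emeasure \<nu> (A \<inter> {x\<in>space \<nu>. ?h x = p}) < \<infinity>"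
    proof cases
      case 1
      have "emeasure \<nu> (A \<inter> {x\<in>space \<nu>. ?h x = p}) \<le> emeasure \<nu> (A \<inter> {x\<in>space \<nu>. g x = y})"
        using A p by (intro emeasure_mono) auto
      then show ?thesis using elementary_level_set[OF g(1) 1 A] by (auto simp: finite_sets_def)
    next
      case 2
      have "emeasure \<nu> (A \<inter> {x\<in>space \<nu>. ?h x = p}) \<le> emeasure \<nu> (A \<inter> {x\<in>space \<nu>. g' x = y'})"
        using A p by (intro emeasure_mono) auto
      then show ?thesis using elementary_level_set[OF g(2) 2 A] by (auto simp: finite_sets_def)
    qed
    then show ?thesis using s by (simp add: finite_sets_def)
  qed
  have rep: "AE \<omega> in M. simple_stoch_integral \<nu> \<Lambda> A (\<lambda>x. u (?h x)) \<omega>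
      = (\<Sum>p\<in>?C. u p * \<Lambda> (A \<inter> {x\<in>space \<nu>. ?h x = p}) \<omega>)" if "u (0, 0) = 0" for u
    by (rule simple_stoch_integral_comp[OF fin A]) (use that lev in auto)
  show ?thesis
    using rep[of fst, simplified] rep[of snd, simplified] rep[of "\<lambda>p. c * fst p + c' * snd p", simplified]
    by eventually_elim (simp add: sum_distrib_left sum.distrib algebra_simps)
qed

text \<open>By \<open>exponent_0\<close> the integrand vanishes where g does, so the integral is a
  finite sum over sets of finite measure.\<close>

lemma set_integrable_exponent_elementary:
  assumes g: "elementary g" and A: "A \<in> sets \<nu>"
  shows "set_integrable \<nu> A (\<lambda>x. \<kappa> (\<zeta> * g x))"
    and "set_lebesgue_integral \<nu> A (\<lambda>x. \<kappa> (\<zeta> * g x))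
      = (\<Sum>y\<in>g ` space \<nu> - {0}. of_real (measure \<nu> (A \<inter> {x\<in>space \<nu>. g x = y})) * \<kappa> (\<zeta> * y))"
proof -
  let ?Y = "g ` space \<nu> - {0}" let ?L = "\<lambda>y. A \<inter> {x\<in>space \<nu>. g x = y}"
  have fin: "finite ?Y" using g by (auto simp: elementary_def simple_function_def)
  have eq: "indicator A x *\<^sub>R \<kappa> (\<zeta> * g x) = (\<Sum>y\<in>?Y. indicator (?L y) x *\<^sub>R \<kappa> (\<zeta> * y))"
    if x: "x \<in> space \<nu>" for x
  proof (cases "g x = 0")
    case True
    then show ?thesis by (auto simp: exponent_0 indicator_def intro!: sum.neutral)
  next
    case False
    then have "(\<Sum>y\<in>?Y. indicator (?L y) x *\<^sub>R \<kappa> (\<zeta> * y)) = (\<Sum>y\<in>{g x}. indicator (?L y) x *\<^sub>R \<kappa> (\<zeta> * y))"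
      using x fin by (intro sum.mono_neutral_right) (auto simp: indicator_def)
    then show ?thesis using x by (auto simp: indicator_def)
  qed
  have int: "integrable \<nu> (\<lambda>x. indicator (?L y) x *\<^sub>R \<kappa> (\<zeta> * y))" if "y \<in> ?Y" for y
    using elementary_level_set[OF g _ A, of y] that
    by (intro integrable_scaleR_left) (auto simp: finite_sets_def integrable_indicator_iff)
  show "set_integrable \<nu> A (\<lambda>x. \<kappa> (\<zeta> * g x))"
    unfolding set_integrable_def using int
    by (subst Bochner_Integration.integrable_cong[OF refl eq]) (auto intro!: Bochner_Integration.integrable_sum)
  have "set_lebesgue_integral \<nu> A (\<lambda>x. \<kappa> (\<zeta> * g x)) = (\<integral>x. (\<Sum>y\<in>?Y. indicator (?L y) x *\<^sub>R \<kappa> (\<zeta> * y)) \<partial>\<nu>)"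
    unfolding set_lebesgue_integral_def by (rule Bochner_Integration.integral_cong[OF refl eq])
  also have "\<dots> = (\<Sum>y\<in>?Y. \<integral>x. indicator (?L y) x *\<^sub>R \<kappa> (\<zeta> * y) \<partial>\<nu>)"
    by (rule Bochner_Integration.integral_sum) (rule int)
  also have "\<dots> = (\<Sum>y\<in>?Y. of_real (measure \<nu> (?L y)) * \<kappa> (\<zeta> * y))"
  proof (rule sum.cong[OF refl])
    fix y assume "y \<in> ?Y"
    then have "?L y \<in> finite_sets \<nu>" using elementary_level_set[OF g _ A] by auto
    then show "(\<integral>x. indicator (?L y) x *\<^sub>R \<kappa> (\<zeta> * y) \<partial>\<nu>) = of_real (measure \<nu> (?L y)) * \<kappa> (\<zeta> * y)"
      by (subst integral_scaleR_left) (auto simp: finite_sets_def integrable_indicator_iff scaleR_conv_of_real)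
  qed
  finally show "set_lebesgue_integral \<nu> A (\<lambda>x. \<kappa> (\<zeta> * g x)) = (\<Sum>y\<in>?Y. of_real (measure \<nu> (?L y)) * \<kappa> (\<zeta> * y))" .
qed

lemma char_simple_stoch_integral:
  assumes g: "elementary g" and A: "A \<in> sets \<nu>"
  shows "char (distr M borel (simple_stoch_integral \<nu> \<Lambda> A g)) \<zeta>
    = exp (set_lebesgue_integral \<nu> A (\<lambda>x. \<kappa> (\<zeta> * g x)))"
proof -
  let ?Y = "g ` space \<nu> - {0}" let ?L = "\<lambda>y. A \<inter> {x\<in>space \<nu>. g x = y}"
  have fin: "finite ?Y" using g by (auto simp: elementary_def simple_function_def)
  have L: "?L y \<in> finite_sets \<nu>" if "y \<in> ?Y" for y
    using elementary_level_set[OF g _ A] that by auto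
  have "char (distr M borel (\<lambda>\<omega>. \<Sum>y\<in>?Y. y * \<Lambda> (?L y) \<omega>)) \<zeta>
      = (\<Prod>y\<in>?Y. exp (of_real (measure \<nu> (?L y)) * \<kappa> (\<zeta> * y)))"
    by (rule char_basis_sum[OF fin L]) (auto simp: disjoint_family_on_def)
  also have "\<dots> = exp (set_lebesgue_integral \<nu> A (\<lambda>x. \<kappa> (\<zeta> * g x)))"
    by (simp add: set_integrable_exponent_elementary(2)[OF g A] exp_sum[OF fin])
  finally show ?thesis by (simp add: simple_stoch_integral_def[abs_def])
qed

lemma has_stoch_integral_alt:
  "has_stoch_integral M \<nu> \<Lambda> f Y \<longleftrightarrow>
     f \<in> borel_measurable \<nu> \<and>
     (\<exists>g :: nat \<Rightarrow> 'e \<Rightarrow> real.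
        (\<forall>n. elementary (g n)) \<and>
        (AE x in \<nu>. (\<lambda>n. g n x) \<longlonglongrightarrow> f x) \<and>
        (\<forall>A\<in>sets \<nu>. \<exists>Z. tendsto_in_prob M (\<lambda>n. simple_stoch_integral \<nu> \<Lambda> A (g n)) Z) \<and>
        tendsto_in_prob M (\<lambda>n. simple_stoch_integral \<nu> \<Lambda> (space \<nu>) (g n)) Y)"
  unfolding has_stoch_integral_def elementary_def ..

lemma has_stoch_integral_0: "has_stoch_integral M \<nu> \<Lambda> (\<lambda>_. 0) (\<lambda>_. 0)"
proof -
  have "simple_stoch_integral \<nu> \<Lambda> A (\<lambda>_. 0) = (\<lambda>_. 0)" for A
    by (auto simp: simple_stoch_integral_def fun_eq_iff intro!: sum.neutral)
  moreover have "tendsto_in_prob M (\<lambda>n _. 0) (\<lambda>_. 0)" by (simp add: tendsto_in_prob_def)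
  ultimately show ?thesis
    unfolding has_stoch_integral_def by (intro conjI exI[of _ "\<lambda>n x. 0"]) auto
qed

text \<open>Combining the two approximating sequences preserves convergence over every measurable
  set. This closure makes Riemann sums of the process stochastic integrals themselves.\<close>

lemma has_stoch_integral_linear:
  assumes "has_stoch_integral M \<nu> \<Lambda> f Y" "has_stoch_integral M \<nu> \<Lambda> f' Y'"
  shows "has_stoch_integral M \<nu> \<Lambda> (\<lambda>x. c * f x + c' * f' x) (\<lambda>\<omega>. c * Y \<omega> + c' * Y' \<omega>)"
proof -
  obtain g where [measurable]: "f \<in> borel_measurable \<nu>" and g: "\<And>n. elementary (g n)"
    "AE x in \<nu>. (\<lambda>n. g n x) \<longlonglongrightarrow> f x"
    "\<And>A. A \<in> sets \<nu> \<Longrightarrow> \<exists>Z. tendsto_in_prob M (\<lambda>n. simple_stoch_integral \<nu> \<Lambda> A (g n)) Z"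
    "tendsto_in_prob M (\<lambda>n. simple_stoch_integral \<nu> \<Lambda> (space \<nu>) (g n)) Y"
    using assms(1) unfolding has_stoch_integral_alt by blast
  obtain g' where [measurable]: "f' \<in> borel_measurable \<nu>" and g': "\<And>n. elementary (g' n)"
    "AE x in \<nu>. (\<lambda>n. g' n x) \<longlonglongrightarrow> f' x"
    "\<And>A. A \<in> sets \<nu> \<Longrightarrow> \<exists>Z. tendsto_in_prob M (\<lambda>n. simple_stoch_integral \<nu> \<Lambda> A (g' n)) Z"
    "tendsto_in_prob M (\<lambda>n. simple_stoch_integral \<nu> \<Lambda> (space \<nu>) (g' n)) Y'"
    using assms(2) unfolding has_stoch_integral_alt by blast
  let ?k = "\<lambda>n x. c * g n x + c' * g' n x"
  have k: "elementary (?k n)" for n by (rule elementary_linear[OF g(1) g'(1)])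
  have lim: "tendsto_in_prob M (\<lambda>n. simple_stoch_integral \<nu> \<Lambda> A (?k n)) (\<lambda>\<omega>. c * Z \<omega> + c' * Z' \<omega>)"
    if "A \<in> sets \<nu>" "tendsto_in_prob M (\<lambda>n. simple_stoch_integral \<nu> \<Lambda> A (g n)) Z"
      "tendsto_in_prob M (\<lambda>n. simple_stoch_integral \<nu> \<Lambda> A (g' n)) Z'" for A Z Z'
    using that(2,3)
  proof (rule tendsto_in_prob_linear)
    show "simple_stoch_integral \<nu> \<Lambda> A (?k n) \<in> borel_measurable M" for n
      by (rule measurable_simple_stoch_integral[OF k that(1)])
    have "Z \<in> borel_measurable M" "Z' \<in> borel_measurable M" using that by (auto simp: tendsto_in_prob_def)
    then show "(\<lambda>\<omega>. c * Z \<omega> + c' * Z' \<omega>) \<in> borel_measurable M" by simp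
    show "AE \<omega> in M. simple_stoch_integral \<nu> \<Lambda> A (?k n) \<omega>
        = c * simple_stoch_integral \<nu> \<Lambda> A (g n) \<omega> + c' * simple_stoch_integral \<nu> \<Lambda> A (g' n) \<omega>" for n
      by (rule simple_stoch_integral_linear[OF g(1) g'(1) that(1)])
  qed simp
  show ?thesis
    unfolding has_stoch_integral_alt
  proof (intro conjI exI[of _ ?k] allI ballI)
    show "AE x in \<nu>. (\<lambda>n. ?k n x) \<longlonglongrightarrow> c * f x + c' * f' x"
      using g(2) g'(2) by eventually_elim (intro tendsto_intros)
    show "\<exists>Z. tendsto_in_prob M (\<lambda>n. simple_stoch_integral \<nu> \<Lambda> A (?k n)) Z" if "A \<in> sets \<nu>" for A
      using lim[OF that] g(3)[OF that] g'(3)[OF that] by blast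
    show "tendsto_in_prob M (\<lambda>n. simple_stoch_integral \<nu> \<Lambda> (space \<nu>) (?k n)) (\<lambda>\<omega>. c * Y \<omega> + c' * Y' \<omega>)"
      by (rule lim[OF _ g(4) g'(4)]) simp
  qed (auto intro: k)
qed

lemma has_stoch_integral_sum:
  assumes "finite K" "\<And>k. k \<in> K \<Longrightarrow> has_stoch_integral M \<nu> \<Lambda> (f k) (Y k)"
  shows "has_stoch_integral M \<nu> \<Lambda> (\<lambda>x. \<Sum>k\<in>K. c k * f k x) (\<lambda>\<omega>. \<Sum>k\<in>K. c k * Y k \<omega>)"
  using assms
proof (induction K rule: finite_induct)
  case empty
  then show ?case using has_stoch_integral_0 by simp
next
  case (insert k K)
  then have "has_stoch_integral M \<nu> \<Lambda> (\<lambda>x. c k * f k x + 1 * (\<Sum>k\<in>K. c k * f k x))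
      (\<lambda>\<omega>. c k * Y k \<omega> + 1 * (\<Sum>k\<in>K. c k * Y k \<omega>))"
    by (intro has_stoch_integral_linear) auto
  with insert show ?case by simp
qed

end

section \<open>Characteristic function of a general stochastic integral\<close>

context levy_noise
begin

lemma continuous_on_exponent: "continuous_on S \<kappa>"
  by (intro continuous_at_imp_continuous_on ballI isCont_exponent)

lemma measurable_exponent [measurable]: "\<kappa> \<in> borel_measurable borel"
  by (rule borel_measurable_continuous_onI[OF continuous_on_exponent])

lemma exponent_bounded:
  obtains K where "\<And>y. \<bar>y\<bar> \<le> r \<Longrightarrow> cmod (\<kappa> y) \<le> K"
proof -
  have "compact (\<kappa> ` {-r..r})" by (intro compact_continuous_image continuous_on_exponent) simp
  then obtain K where "\<And>z. z \<in> \<kappa> ` {-r..r} \<Longrightarrow> cmod z \<le> K"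
    using compact_imp_bounded bounded_iff by metis
  then show ?thesis by (intro that[of K]) (auto simp: abs_le_iff)
qed

lemma real_distribution_distrI: "Y \<in> borel_measurable M \<Longrightarrow> real_distribution (distr M borel Y)"
  by (simp add: real_distribution_distr)

text \<open>Infinite divisibility enters through \<open>Re_exponent_double\<close>, which rules out zeros of the
  characteristic function of the limit.\<close>

lemma char_limit_nonzero:
  assumes g: "\<And>n. elementary (g n)"
    and lim: "tendsto_in_prob M (\<lambda>n. simple_stoch_integral \<nu> \<Lambda> (space \<nu>) (g n)) Y"
  shows "char (distr M borel Y) \<zeta> \<noteq> 0"
proof -
  let ?m = "\<lambda>n \<zeta>. \<integral>x. Re (\<kappa> (\<zeta> * g n x)) \<partial>\<nu>"
  have sint: "integrable \<nu> (\<lambda>x. \<kappa> (\<zeta> * g n x))" for n \<zeta>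
    using set_integrable_exponent_elementary(1)[OF g sets.top, of \<zeta> n]
    unfolding set_integrable_def by (simp cong: Bochner_Integration.integrable_cong)
  have "set_lebesgue_integral \<nu> (space \<nu>) (\<lambda>x. \<kappa> (\<zeta> * g n x)) = (\<integral>x. \<kappa> (\<zeta> * g n x) \<partial>\<nu>)" for n \<zeta>
    unfolding set_lebesgue_integral_def by (intro Bochner_Integration.integral_cong) auto
  then have norm: "cmod (char (distr M borel (simple_stoch_integral \<nu> \<Lambda> (space \<nu>) (g n))) \<zeta>) = exp (?m n \<zeta>)" for n \<zeta>
    by (simp add: char_simple_stoch_integral[OF g] sint)
  have L: "(\<lambda>n. exp (?m n \<zeta>)) \<longlonglongrightarrow> cmod (char (distr M borel Y) \<zeta>)" for \<zeta>
    using tendsto_norm[OF tendsto_in_prob_char[OF lim, of \<zeta>]] unfolding norm .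
  \<comment> \<open>The inequality for the exponent is integrated and exponentiated for each simple
    integrand, and then survives the limit.\<close>
  have double: "cmod (char (distr M borel Y) \<zeta>) ^ 4 \<le> cmod (char (distr M borel Y) (2 * \<zeta>))" for \<zeta>
  proof (rule LIMSEQ_le[OF tendsto_power[OF L] L], intro exI allI impI)
    fix n
    have "4 * ?m n \<zeta> = (\<integral>x. 4 * Re (\<kappa> (\<zeta> * g n x)) \<partial>\<nu>)" by simp
    also have "\<dots> \<le> ?m n (2 * \<zeta>)"
    proof (rule integral_mono)
      show "4 * Re (\<kappa> (\<zeta> * g n x)) \<le> Re (\<kappa> (2 * \<zeta> * g n x))" for x
        using Re_exponent_double[of "\<zeta> * g n x"] by (simp add: mult.assoc)
    qed (intro integrable_mult_right integrable_Re sint)+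
    finally show "exp (?m n \<zeta>) ^ 4 \<le> exp (?m n (2 * \<zeta>))"
      by (simp flip: exp_of_nat_mult)
  qed
  interpret Y: real_distribution "distr M borel Y"
    by (rule real_distribution_distrI) (use lim in \<open>simp add: tendsto_in_prob_def\<close>)
  \<comment> \<open>By continuity at 0 the characteristic function is nonzero at \<zeta> / 2^k for
    some k; k doublings lead back to \<zeta>.\<close>
  have "filterlim (\<lambda>k. \<zeta> / 2 ^ k) (nhds 0) sequentially"
    using LIMSEQ_inverse_realpow_zero[of 2] tendsto_mult_right_zero[of "\<lambda>k. inverse (2 ^ k)" sequentially \<zeta>]
    by (simp add: divide_inverse)
  then have "(\<lambda>k. char (distr M borel Y) (\<zeta> / 2 ^ k)) \<longlonglongrightarrow> char (distr M borel Y) 0"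
    by (rule isCont_tendsto_compose[OF Y.isCont_char])
  then have "(\<lambda>k. cmod (char (distr M borel Y) (\<zeta> / 2 ^ k))) \<longlonglongrightarrow> 1"
    using tendsto_norm Y.char_zero by fastforce
  then have "eventually (\<lambda>k. cmod (char (distr M borel Y) (\<zeta> / 2 ^ k)) > 0) sequentially"
    by (rule order_tendstoD(1)) simp
  then obtain k where k: "cmod (char (distr M borel Y) (\<zeta> / 2 ^ k)) > 0"
    by (auto dest: eventually_happens)
  have "cmod (char (distr M borel Y) (2 ^ l * (\<zeta> / 2 ^ k))) > 0" for l
  proof (induction l)
    case (Suc l)
    then have "0 < cmod (char (distr M borel Y) (2 ^ l * (\<zeta> / 2 ^ k))) ^ 4" by simp
    also have "\<dots> \<le> cmod (char (distr M borel Y) (2 * (2 ^ l * (\<zeta> / 2 ^ k))))" by (rule double)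
    finally show ?case by (simp add: mult.assoc)
  qed (use k in simp)
  from this[of k] show ?thesis by simp
qed

text \<open>On \<open>E j\<close> the approximating simple functions are uniformly bounded, so dominated convergence
  identifies the contribution of \<open>E j\<close>; on the complement the gliding hump argument applies.\<close>

theorem stoch_integral_char:
  assumes "has_stoch_integral M \<nu> \<Lambda> f Y"
  obtains E Z where
    "incseq E" "\<And>j. E j \<in> sets \<nu>" "\<And>j. emeasure \<nu> (E j) < \<infinity>"
    "AE x in \<nu>. x \<in> (\<Union>j. E j)" "\<And>j x. x \<in> E j \<Longrightarrow> \<bar>f x\<bar> \<le> real j"
    "\<And>j. Z j \<in> borel_measurable M"
    "\<And>j \<zeta>. char (distr M borel Y) \<zeta>
       = exp (set_lebesgue_integral \<nu> (E j) (\<lambda>x. \<kappa> (\<zeta> * f x))) * char (distr M borel (Z j)) \<zeta>"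
    "\<And>\<zeta>. (\<lambda>j. cmod (char (distr M borel (Z j)) \<zeta>)) \<longlonglongrightarrow> 1"
    "\<And>\<zeta>. char (distr M borel Y) \<zeta> \<noteq> 0"
proof -
  obtain g where f[measurable]: "f \<in> borel_measurable \<nu>" and g: "\<And>n. elementary (g n)"
    and ae: "AE x in \<nu>. (\<lambda>n. g n x) \<longlonglongrightarrow> f x"
    and limA: "\<And>A. A \<in> sets \<nu> \<Longrightarrow> \<exists>Z. tendsto_in_prob M (\<lambda>n. simple_stoch_integral \<nu> \<Lambda> A (g n)) Z"
    and limY: "tendsto_in_prob M (\<lambda>n. simple_stoch_integral \<nu> \<Lambda> (space \<nu>) (g n)) Y"
    using assms unfolding has_stoch_integral_alt by blast
  have [measurable]: "g n \<in> borel_measurable \<nu>" for n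
    using g by (auto simp: elementary_def borel_measurable_simple_function)
  obtain S where S: "range S \<subseteq> sets \<nu>" "(\<Union>i. S i) = space \<nu>" "\<And>i. emeasure \<nu> (S i) \<noteq> \<infinity>" "incseq S"
    using sigma_finite_incseq by blast
  \<comment> \<open>One bound j holds for all approximants at once. Pointwise convergent sequences
    are bounded, so these sets still exhaust the space up to a null set, and \<open>S j\<close>
    keeps their measure finite.\<close>
  define E where "E j = {x \<in> S j. (\<forall>n. \<bar>g n x\<bar> \<le> real j) \<and> \<bar>f x\<bar> \<le> real j}" for j
  define D where "D j = space \<nu> - E j" for j
  have Ssub: "S j \<subseteq> space \<nu>" for j using S(2) by auto
  have E_sets[measurable]: "E j \<in> sets \<nu>" for j
  proof -
    have "E j = S j \<inter> {x \<in> space \<nu>. (\<forall>n. \<bar>g n x\<bar> \<le> real j) \<and> \<bar>f x\<bar> \<le> real j}"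
      using Ssub by (auto simp: E_def)
    then show ?thesis using S(1) by auto
  qed
  have D_sets[measurable]: "D j \<in> sets \<nu>" for j by (simp add: D_def)
  have E_inc: "incseq E"
  proof (rule incseq_SucI)
    fix j
    have "S j \<subseteq> S (Suc j)" using S(4) by (rule incseq_SucD)
    then show "E j \<subseteq> E (Suc j)" by (force simp: E_def intro: order_trans)
  qed
  have E_fin: "emeasure \<nu> (E j) < \<infinity>" for j
  proof -
    have "emeasure \<nu> (E j) \<le> emeasure \<nu> (S j)" using S(1) by (intro emeasure_mono) (auto simp: E_def)
    then show ?thesis using S(3)[of j] by (auto simp: less_top intro: le_less_trans)
  qed
  have E_AE: "AE x in \<nu>. x \<in> (\<Union>j. E j)"
    using ae AE_space
  proof eventually_elim
    case (elim x)
    then obtain i where i: "x \<in> S i" using S(2) by auto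
    obtain B where B: "\<And>n. \<bar>g n x\<bar> \<le> B"
      using convergent_imp_Bseq[OF convergentI[OF elim(1)]] by (auto simp: Bseq_def)
    obtain j :: nat where j: "real j \<ge> max (max B \<bar>f x\<bar>) (real i)" using real_arch_simple by blast
    have "S i \<subseteq> S j" using S(4) j by (auto simp: incseq_def)
    moreover have "\<bar>g n x\<bar> \<le> real j" for n using B[of n] j by simp
    ultimately have "x \<in> E j" using i j by (auto simp: E_def)
    then show ?case by auto
  qed
  have "\<exists>Z. \<forall>A\<in>sets \<nu>. tendsto_in_prob M (\<lambda>n. simple_stoch_integral \<nu> \<Lambda> A (g n)) (Z A)"
    using limA by (intro bchoice) auto
  then obtain Z where Z: "\<And>A. A \<in> sets \<nu> \<Longrightarrow> tendsto_in_prob M (\<lambda>n. simple_stoch_integral \<nu> \<Lambda> A (g n)) (Z A)"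
    by blast
  let ?I = "\<lambda>A n \<zeta>. set_lebesgue_integral \<nu> A (\<lambda>x. \<kappa> (\<zeta> * g n x))"
  have char_lim: "(\<lambda>n. exp (?I A n \<zeta>)) \<longlonglongrightarrow> char (distr M borel (Z A)) \<zeta>" if "A \<in> sets \<nu>" for A \<zeta>
    using tendsto_in_prob_char[OF Z[OF that], of \<zeta>] by (simp add: char_simple_stoch_integral[OF g that])
  have char_limY: "(\<lambda>n. exp (?I (space \<nu>) n \<zeta>)) \<longlonglongrightarrow> char (distr M borel Y) \<zeta>" for \<zeta>
    using tendsto_in_prob_char[OF limY, of \<zeta>] by (simp add: char_simple_stoch_integral[OF g sets.top])
  have sint: "set_integrable \<nu> A (\<lambda>x. \<kappa> (\<zeta> * g n x))" if "A \<in> sets \<nu>" for A n \<zeta>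
    by (rule set_integrable_exponent_elementary(1)[OF g that])
  have nz: "char (distr M borel Y) \<zeta> \<noteq> 0" for \<zeta> by (rule char_limit_nonzero[OF g limY])
  have E_lim: "(\<lambda>n. ?I (E j) n \<zeta>) \<longlonglongrightarrow> set_lebesgue_integral \<nu> (E j) (\<lambda>x. \<kappa> (\<zeta> * f x))" for j \<zeta>
  proof -
    obtain K where K: "\<And>y. \<bar>y\<bar> \<le> \<bar>\<zeta>\<bar> * real j \<Longrightarrow> cmod (\<kappa> y) \<le> K" using exponent_bounded[of "\<bar>\<zeta>\<bar> * real j"] by blast
    show ?thesis
      unfolding set_lebesgue_integral_def
    proof (rule integral_dominated_convergence[where w="\<lambda>x. K * indicator (E j) x"])
      show "integrable \<nu> (\<lambda>x. K * indicator (E j) x)"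
        using E_fin[of j] by (intro integrable_mult_right) (simp add: integrable_indicator_iff)
      show "AE x in \<nu>. (\<lambda>n. indicator (E j) x *\<^sub>R \<kappa> (\<zeta> * g n x)) \<longlonglongrightarrow> indicator (E j) x *\<^sub>R \<kappa> (\<zeta> * f x)"
        using ae
      proof eventually_elim
        case (elim x)
        then show ?case
          by (intro tendsto_scaleR tendsto_const isCont_tendsto_compose[OF isCont_exponent] tendsto_mult)
      qed
      show "AE x in \<nu>. cmod (indicator (E j) x *\<^sub>R \<kappa> (\<zeta> * g n x)) \<le> K * indicator (E j) x" for n
      proof (rule AE_I2)
        fix x
        show "cmod (indicator (E j) x *\<^sub>R \<kappa> (\<zeta> * g n x)) \<le> K * indicator (E j) x"
        proof (cases "x \<in> E j")
          case True
          then have "\<bar>\<zeta> * g n x\<bar> \<le> \<bar>\<zeta>\<bar> * real j" by (auto simp: abs_mult E_def intro: mult_left_mono)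
          then show ?thesis using K True by simp
        qed simp
      qed
    qed measurable
  qed
  have split: "?I (space \<nu>) n \<zeta> = ?I (E j) n \<zeta> + ?I (D j) n \<zeta>" for n j \<zeta>
  proof -
    have "E j \<union> D j = space \<nu>" using Ssub by (auto simp: D_def E_def)
    then show ?thesis
      using set_integral_Un[of "E j" "D j" \<nu>, OF _ sint sint] by (auto simp: D_def)
  qed
  have prod: "char (distr M borel Y) \<zeta>
       = exp (set_lebesgue_integral \<nu> (E j) (\<lambda>x. \<kappa> (\<zeta> * f x))) * char (distr M borel (Z (D j))) \<zeta>" for j \<zeta>
  proof (rule LIMSEQ_unique[OF char_limY])
    show "(\<lambda>n. exp (?I (space \<nu>) n \<zeta>)) \<longlonglongrightarrow>
       exp (set_lebesgue_integral \<nu> (E j) (\<lambda>x. \<kappa> (\<zeta> * f x))) * char (distr M borel (Z (D j))) \<zeta>"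
      unfolding split[of _ _ j] exp_add by (intro tendsto_mult tendsto_exp E_lim char_lim) simp
  qed
  have lim1: "(\<lambda>j. cmod (char (distr M borel (Z (D j))) \<zeta>)) \<longlonglongrightarrow> 1" for \<zeta>
  proof -
    \<comment> \<open>For fixed \<zeta> this is a finite measure whose mass on a set A is minus the
      logarithm of the modulus of the characteristic function of the simple integral over A. Limits
      in probability over every A thus turn into setwise convergence, which the gliding hump
      requires.\<close>
    define m where "m n = density \<nu> (\<lambda>x. ennreal (- Re (\<kappa> (\<zeta> * g n x))))" for n
    have m_eq: "emeasure (m n) A = ennreal (- Re (?I A n \<zeta>))" "- Re (?I A n \<zeta>) \<ge> 0" if A[measurable]: "A \<in> sets \<nu>" for A n
    proof -
      have i: "integrable \<nu> (\<lambda>x. indicator A x *\<^sub>R \<kappa> (\<zeta> * g n x))"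
        using sint[OF A] by (simp add: set_integrable_def)
      have "emeasure (m n) A = (\<integral>\<^sup>+x. ennreal (- Re (indicator A x *\<^sub>R \<kappa> (\<zeta> * g n x))) \<partial>\<nu>)"
        unfolding m_def by (subst emeasure_density) (auto intro!: nn_integral_cong simp: indicator_def)
      also have "\<dots> = ennreal (\<integral>x. - Re (indicator A x *\<^sub>R \<kappa> (\<zeta> * g n x)) \<partial>\<nu>)"
        by (rule nn_integral_eq_integral) (use integrable_Re[OF i] Re_exponent_le_0 in \<open>auto simp: mult_nonneg_nonpos\<close>)
      also have "(\<integral>x. - Re (indicator A x *\<^sub>R \<kappa> (\<zeta> * g n x)) \<partial>\<nu>) = - Re (?I A n \<zeta>)"
        unfolding set_lebesgue_integral_def integral_Re[OF i, symmetric] by (rule integral_minus)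
      finally show "emeasure (m n) A = ennreal (- Re (?I A n \<zeta>))" .
      have "0 \<le> (\<integral>x. - Re (indicator A x *\<^sub>R \<kappa> (\<zeta> * g n x)) \<partial>\<nu>)"
        by (rule integral_nonneg_AE) (use Re_exponent_le_0 in \<open>auto simp: mult_nonneg_nonpos\<close>)
      also have "\<dots> = - Re (?I A n \<zeta>)"
        unfolding set_lebesgue_integral_def integral_Re[OF i, symmetric] by (rule integral_minus)
      finally show "- Re (?I A n \<zeta>) \<ge> 0" .
    qed
    have m_sets: "sets (m n) = sets \<nu>" "space (m n) = space \<nu>" for n by (simp_all add: m_def)
    have m_fin: "finite_measure (m n)" for n
      by (rule finite_measureI) (simp add: m_sets m_eq(1))
    have measure_m: "measure (m n) A = - Re (?I A n \<zeta>)" if "A \<in> sets \<nu>" for A n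
      using m_eq[OF that, of n] by (simp add: measure_def)
    have exp_m: "exp (- measure (m n) A) = cmod (exp (?I A n \<zeta>))" if "A \<in> sets \<nu>" for A n
      by (simp add: measure_m[OF that])
    have exp_lim: "(\<lambda>n. exp (- measure (m n) A)) \<longlonglongrightarrow> cmod (char (distr M borel (Z A)) \<zeta>)" if "A \<in> sets \<nu>" for A
      unfolding exp_m[OF that] by (intro tendsto_norm char_lim that)
    \<comment> \<open>Smaller sets carry less mass, so the modulus over \<open>A\<close> dominates
      the one over the whole space, whose limit is nonzero; the logarithm can then be taken in the
      limit.\<close>
    have pos: "cmod (char (distr M borel (Z A)) \<zeta>) > 0" if A: "A \<in> sets \<nu>" for A
    proof -
      have "(\<lambda>n. exp (- measure (m n) (space \<nu>))) \<longlonglongrightarrow> cmod (char (distr M borel Y) \<zeta>)"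
        unfolding exp_m[OF sets.top] by (intro tendsto_norm char_limY)
      then have "cmod (char (distr M borel Y) \<zeta>) \<le> cmod (char (distr M borel (Z A)) \<zeta>)"
      proof (rule LIMSEQ_le[OF _ exp_lim[OF A]], intro exI allI impI)
        fix n
        have "measure (m n) A \<le> measure (m n) (space (m n))"
          by (rule finite_measure.bounded_measure[OF m_fin])
        then show "exp (- measure (m n) (space \<nu>)) \<le> exp (- measure (m n) A)" by (simp add: m_sets)
      qed
      moreover have "cmod (char (distr M borel Y) \<zeta>) > 0" using nz by simp
      ultimately show ?thesis by linarith
    qed
    have m_lim: "(\<lambda>n. measure (m n) A) \<longlonglongrightarrow> - ln (cmod (char (distr M borel (Z A)) \<zeta>))" if "A \<in> sets \<nu>" for A
      using tendsto_minus[OF tendsto_ln[OF exp_lim[OF that]]] pos[OF that] by simp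
    have "(\<lambda>j. lim (\<lambda>n. measure (m n) (D j))) \<longlonglongrightarrow> 0"
    proof (rule gliding_hump[OF m_sets(1) m_fin])
      show "convergent (\<lambda>n. measure (m n) A)" if "A \<in> sets \<nu>" for A
        using m_lim[OF that] by (rule convergentI)
      show "D j \<in> sets \<nu>" for j by simp
      show dec: "decseq D" using E_inc by (force simp: decseq_def incseq_def D_def)
      show "(\<lambda>j. measure (m n) (D j)) \<longlonglongrightarrow> 0" for n
      proof -
        have "(\<lambda>j. measure (m n) (D j)) \<longlonglongrightarrow> measure (m n) (\<Inter>j. D j)"
          by (rule finite_measure.finite_Lim_measure_decseq[OF m_fin _ dec]) (auto simp: m_sets)
        \<comment> \<open>For fixed n the masses of the complements vanish, because the complements
          shrink to a null set and \<open>m n\<close> has a density; the gliding hump exchanges this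
          limit with the one in n.\<close>
        moreover have "(\<Inter>j. D j) \<in> null_sets \<nu>"
        proof (rule AE_iff_null_sets[THEN iffD2])
          show "(\<Inter>j. D j) \<in> sets \<nu>" by (rule sets.countable_INT) auto
          show "AE x in \<nu>. x \<notin> (\<Inter>j. D j)" using E_AE by eventually_elim (auto simp: D_def)
        qed
        then have "(\<Inter>j. D j) \<in> null_sets (m n)"
          using absolutely_continuousI_density[of "\<lambda>x. ennreal (- Re (\<kappa> (\<zeta> * g n x)))" \<nu>]
          by (auto simp: absolutely_continuous_def m_def)
        then have "measure (m n) (\<Inter>j. D j) = 0" by (simp add: measure_eq_0_null_sets)
        ultimately show ?thesis by simp
      qed
    qed
    moreover have "lim (\<lambda>n. measure (m n) (D j)) = - ln (cmod (char (distr M borel (Z (D j))) \<zeta>))" for j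
      by (rule limI[OF m_lim]) simp
    ultimately have "(\<lambda>j. - ln (cmod (char (distr M borel (Z (D j))) \<zeta>))) \<longlonglongrightarrow> 0" by simp
    from tendsto_exp[OF tendsto_minus[OF this]] show ?thesis
      using pos[OF D_sets] by simp
  qed
  show ?thesis
  proof (rule that[of E "\<lambda>j. Z (D j)"])
    show "\<bar>f x\<bar> \<le> real j" if "x \<in> E j" for j x using that by (simp add: E_def)
    show "Z (D j) \<in> borel_measurable M" for j using Z[OF D_sets] by (simp add: tendsto_in_prob_def)
  qed (fact E_inc E_sets E_fin E_AE prod lim1 nz)+
qed

end

section \<open>Cumulant functions of finite variance\<close>

lemma iexp_diff_linear_le: "cmod (iexp x - 1 - \<i> * of_real x) \<le> x\<^sup>2 / 2"
  using iexp_approx1[of x 1] by (simp add: algebra_simps power2_eq_square)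

lemma exp_diff_1_le: "cmod (exp z - 1) \<le> exp (cmod z) * cmod z"
  using Taylor_exp_field[of z 0] by simp

lemma exp_diff_linear_le: "cmod (exp z - 1 - z) \<le> exp (cmod z) * (cmod z)\<^sup>2"
  using Taylor_exp_field[of z 1] by (simp add: algebra_simps power2_eq_square)

text \<open>Inside [-1, 1] the second-order Taylor bound applies, outside the trivial bound 2. The
  constant is the sum of both, so that a single multiple of \<open>min 1 (x\<^sup>2)\<close> serves
  everywhere.\<close>

lemma levy_integrand_le:
  "cmod (iexp (\<zeta> * x) - 1 - \<i> * of_real (\<zeta> * x * indicator {-1..1} x)) \<le> (\<zeta>\<^sup>2 / 2 + 2) * min 1 (x\<^sup>2)"
proof (cases "x \<in> {-1..1}")
  case True
  then have "x\<^sup>2 \<le> 1" by (simp add: abs_square_le_1 abs_le_iff)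
  moreover have "cmod (iexp (\<zeta> * x) - 1 - \<i> * of_real (\<zeta> * x)) \<le> (\<zeta> * x)\<^sup>2 / 2"
    by (rule iexp_diff_linear_le)
  moreover have "(\<zeta> * x)\<^sup>2 / 2 \<le> (\<zeta>\<^sup>2 / 2 + 2) * x\<^sup>2" by (simp add: power_mult_distrib algebra_simps)
  ultimately show ?thesis using True by (simp add: min_def del: of_real_mult)
next
  case False
  then have "\<bar>x\<bar> > 1" by auto
  then have "x\<^sup>2 > 1" by (metis abs_square_less_1 abs_square_eq_1 linorder_neqE_linordered_idom order_less_asym less_irrefl)
  have "cmod (iexp (\<zeta> * x) - 1) \<le> 2"
    using norm_iexp_diff_le_2[of "\<zeta> * x" 0] by simp
  also have "\<dots> \<le> \<zeta>\<^sup>2 / 2 + 2" by simp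
  finally show ?thesis using False \<open>x\<^sup>2 > 1\<close> by (simp add: min_def del: of_real_mult)
qed

locale levy_measure =
  fixes a b :: real and \<mu> :: "real measure"
  assumes triplet: "levy_triplet a b \<mu>"
begin

lemma gaussian_part_nonneg: "0 \<le> b"
  and sets_levy [measurable_cong]: "sets \<mu> = sets borel"
  using triplet by (auto simp: levy_triplet_def)

lemma integrable_min_1_square: "integrable \<mu> (\<lambda>x. min 1 (x\<^sup>2))"
  by (rule integrableI_nonneg) (use triplet in \<open>auto simp: levy_triplet_def\<close>)

lemma integrable_levy_integrand:
  "integrable \<mu> (\<lambda>x. iexp (\<zeta> * x) - 1 - \<i> * of_real (\<zeta> * x * indicator {-1..1} x))"
proof (rule Bochner_Integration.integrable_bound)
  show "integrable \<mu> (\<lambda>x. (\<zeta>\<^sup>2 / 2 + 2) * min 1 (x\<^sup>2))"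
    by (intro integrable_mult_right integrable_min_1_square)
  show "AE x in \<mu>. cmod (iexp (\<zeta> * x) - 1 - \<i> * of_real (\<zeta> * x * indicator {-1..1} x))
      \<le> norm ((\<zeta>\<^sup>2 / 2 + 2) * min 1 (x\<^sup>2))"
    by (intro AE_I2 order_trans[OF levy_integrand_le]) simp
qed measurable

lemma isCont_levy_cumulant: "isCont (levy_cumulant a b \<mu>) \<zeta>"
  unfolding continuous_within tendsto_at_iff_sequentially comp_def
proof (intro allI impI)
  fix X :: "nat \<Rightarrow> real" assume X: "X \<longlonglongrightarrow> \<zeta>"
  obtain B where B: "\<And>n. \<bar>X n\<bar> \<le> B" "B > 0"
    using convergent_imp_Bseq[OF convergentI[OF X]] by (auto simp: Bseq_def)
  have "(\<lambda>n. \<integral>x. (iexp (X n * x) - 1 - \<i> * of_real (X n * x * indicator {-1..1} x)) \<partial>\<mu>)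
      \<longlonglongrightarrow> (\<integral>x. (iexp (\<zeta> * x) - 1 - \<i> * of_real (\<zeta> * x * indicator {-1..1} x)) \<partial>\<mu>)"
  proof (rule integral_dominated_convergence)
    show "integrable \<mu> (\<lambda>x. (B\<^sup>2 / 2 + 2) * min 1 (x\<^sup>2))"
      by (intro integrable_mult_right integrable_min_1_square)
    show "AE x in \<mu>. cmod (iexp (X n * x) - 1 - \<i> * of_real (X n * x * indicator {-1..1} x))
        \<le> (B\<^sup>2 / 2 + 2) * min 1 (x\<^sup>2)" for n
    proof (intro AE_I2 order_trans[OF levy_integrand_le] mult_right_mono)
      have "(X n)\<^sup>2 \<le> B\<^sup>2" using B by (auto simp: abs_le_square_iff[symmetric])
      then show "(X n)\<^sup>2 / 2 + 2 \<le> B\<^sup>2 / 2 + 2" by simp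
    qed simp
    show "AE x in \<mu>. (\<lambda>n. iexp (X n * x) - 1 - \<i> * of_real (X n * x * indicator {-1..1} x))
        \<longlonglongrightarrow> iexp (\<zeta> * x) - 1 - \<i> * of_real (\<zeta> * x * indicator {-1..1} x)"
      by (intro AE_I2 tendsto_intros X)
  qed measurable
  then show "(\<lambda>n. levy_cumulant a b \<mu> (X n)) \<longlonglongrightarrow> levy_cumulant a b \<mu> \<zeta>"
    unfolding levy_cumulant_def by (intro tendsto_intros X) auto
qed

lemma Re_levy_cumulant: "Re (levy_cumulant a b \<mu> \<zeta>) = - (\<zeta>\<^sup>2 / 2 * b) - (\<integral>x. 1 - cos (\<zeta> * x) \<partial>\<mu>)"
  and integrable_one_minus_cos: "integrable \<mu> (\<lambda>x. 1 - cos (\<zeta> * x))"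
proof -
  have eq: "Re (iexp (\<zeta> * x) - 1 - \<i> * of_real (\<zeta> * x * indicator {-1..1} x)) = - (1 - cos (\<zeta> * x))" for x
    by (simp add: Re_exp del: of_real_mult)
  have "integrable \<mu> (\<lambda>x. - (- (1 - cos (\<zeta> * x))))"
    using integrable_Re[OF integrable_levy_integrand[of \<zeta>]] unfolding eq by (rule integrable_minus)
  then show "integrable \<mu> (\<lambda>x. 1 - cos (\<zeta> * x))" by simp
  have "Re (\<integral>x. (iexp (\<zeta> * x) - 1 - \<i> * of_real (\<zeta> * x * indicator {-1..1} x)) \<partial>\<mu>) = (\<integral>x. - (1 - cos (\<zeta> * x)) \<partial>\<mu>)"
    unfolding integral_Re[OF integrable_levy_integrand, symmetric] eq ..
  also have "\<dots> = - (\<integral>x. 1 - cos (\<zeta> * x) \<partial>\<mu>)" by (rule integral_minus)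
  finally show "Re (levy_cumulant a b \<mu> \<zeta>) = - (\<zeta>\<^sup>2 / 2 * b) - (\<integral>x. 1 - cos (\<zeta> * x) \<partial>\<mu>)"
    unfolding levy_cumulant_def plus_complex.sel minus_complex.sel by (simp only:) simp
qed

lemma levy_cumulant_0: "levy_cumulant a b \<mu> 0 = 0"
  by (simp add: levy_cumulant_def)

lemma Re_levy_cumulant_le_0: "Re (levy_cumulant a b \<mu> \<zeta>) \<le> 0"
proof -
  have "0 \<le> (\<integral>x. 1 - cos (\<zeta> * x) \<partial>\<mu>)" by (rule integral_nonneg_AE) simp
  moreover have "0 \<le> \<zeta>\<^sup>2 / 2 * b" using gaussian_part_nonneg by simp
  ultimately show ?thesis unfolding Re_levy_cumulant by linarith
qed

text \<open>The difference 4 (1 - cos x) - (1 - cos (2 x)) equals 2 (1 - cos x)^2, and the Gaussian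
  part scales exactly by 4.\<close>

lemma Re_levy_cumulant_double:
  "4 * Re (levy_cumulant a b \<mu> \<zeta>) \<le> Re (levy_cumulant a b \<mu> (2 * \<zeta>))"
proof -
  have "(\<integral>x. 1 - cos (2 * \<zeta> * x) \<partial>\<mu>) \<le> (\<integral>x. 4 * (1 - cos (\<zeta> * x)) \<partial>\<mu>)"
  proof (rule integral_mono)
    fix x
    have "cos (2 * (\<zeta> * x)) = 2 * (cos (\<zeta> * x))\<^sup>2 - 1" by (rule cos_double_cos)
    moreover have "0 \<le> (1 - cos (\<zeta> * x))\<^sup>2" by simp
    ultimately show "1 - cos (2 * \<zeta> * x) \<le> 4 * (1 - cos (\<zeta> * x))"
      by (simp add: power2_eq_square algebra_simps)
  qed (intro integrable_mult_right integrable_one_minus_cos)+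
  then have "(\<integral>x. 1 - cos (2 * \<zeta> * x) \<partial>\<mu>) \<le> 4 * (\<integral>x. 1 - cos (\<zeta> * x) \<partial>\<mu>)"
    by (simp only: integral_mult_right_zero)
  moreover have "(2 * \<zeta>)\<^sup>2 / 2 * b = 4 * (\<zeta>\<^sup>2 / 2 * b)" by (simp add: power_mult_distrib)
  ultimately show ?thesis unfolding Re_levy_cumulant by (simp only: right_diff_distrib mult_minus_right diff_mono order_refl)
qed

text \<open>Fatou along the arguments y / n. The second moment may still be infinite at this stage,
  hence the extended integral; the Gaussian part only enlarges the right-hand side.\<close>

lemma nn_integral_square_le_liminf_cumulant:
  "ennreal (y\<^sup>2) * (\<integral>\<^sup>+x. ennreal (x\<^sup>2) \<partial>\<mu>)
    \<le> liminf (\<lambda>n. ennreal (2 * (real (Suc n))\<^sup>2 * - Re (levy_cumulant a b \<mu> (y / real (Suc n)))))"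
proof -
  have "ennreal (y\<^sup>2) * (\<integral>\<^sup>+x. ennreal (x\<^sup>2) \<partial>\<mu>) = (\<integral>\<^sup>+x. ennreal ((y * x)\<^sup>2) \<partial>\<mu>)"
    by (subst nn_integral_cmult[symmetric]) (auto simp: power_mult_distrib ennreal_mult)
  also have "\<dots> \<le> liminf (\<lambda>n. \<integral>\<^sup>+x. ennreal (2 * (real (Suc n))\<^sup>2 * (1 - cos (y * x / real (Suc n)))) \<partial>\<mu>)"
    by (rule nn_integral_square_le_liminf) measurable
  also have "\<dots> \<le> liminf (\<lambda>n. ennreal (2 * (real (Suc n))\<^sup>2 * - Re (levy_cumulant a b \<mu> (y / real (Suc n)))))"
  proof (intro Liminf_mono always_eventually allI)
    fix n
    have eq: "y * x / real (Suc n) = y / real (Suc n) * x" for x by simp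
    have "(\<integral>\<^sup>+x. ennreal (2 * (real (Suc n))\<^sup>2 * (1 - cos (y * x / real (Suc n)))) \<partial>\<mu>)
        = ennreal (\<integral>x. 2 * (real (Suc n))\<^sup>2 * (1 - cos (y / real (Suc n) * x)) \<partial>\<mu>)"
      unfolding eq
      by (subst nn_integral_eq_integral[symmetric])
        (intro integrable_mult_right integrable_one_minus_cos, auto)
    also have "\<dots> = ennreal (2 * (real (Suc n))\<^sup>2 * (\<integral>x. 1 - cos (y / real (Suc n) * x) \<partial>\<mu>))"
      by (subst integral_mult_right_zero) simp
    also have "\<dots> \<le> ennreal (2 * (real (Suc n))\<^sup>2 * - Re (levy_cumulant a b \<mu> (y / real (Suc n))))"
      using gaussian_part_nonneg by (intro ennreal_leI mult_left_mono) (auto simp: Re_levy_cumulant simp del: of_nat_Suc)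
    finally show "(\<integral>\<^sup>+x. ennreal (2 * (real (Suc n))\<^sup>2 * (1 - cos (y * x / real (Suc n)))) \<partial>\<mu>)
        \<le> ennreal (2 * (real (Suc n))\<^sup>2 * - Re (levy_cumulant a b \<mu> (y / real (Suc n))))" .
  qed
  finally show ?thesis .
qed

end

text \<open>All jumps are compensated, not only those in [-1, 1], and no drift is left: the exponent
  of mean zero noise. The drift of the given triplet survives only as a deterministic shift of the
  integrals, which zero mean removes.\<close>

definition centred_cumulant :: "real \<Rightarrow> real measure \<Rightarrow> real \<Rightarrow> complex" where
  "centred_cumulant b \<mu> \<zeta> = - of_real (\<zeta>\<^sup>2 / 2 * b) + (\<integral>x. (iexp (\<zeta> * x) - 1 - \<i> * of_real (\<zeta> * x)) \<partial>\<mu>)"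

locale levy_measure_L2 = levy_measure +
  assumes second_moment: "integrable \<mu> (\<lambda>x. x\<^sup>2)"
begin

text \<open>The variance of the noise per unit of intensity: minus twice the quadratic coefficient
  of \<open>centred_cumulant\<close> at 0.\<close>

definition v :: real where "v = b + (\<integral>x. x\<^sup>2 \<partial>\<mu>)"

lemma v_nonneg: "0 \<le> v"
  using gaussian_part_nonneg by (simp add: v_def integral_nonneg_AE)

lemma integrable_centred_integrand: "integrable \<mu> (\<lambda>x. iexp (\<zeta> * x) - 1 - \<i> * of_real (\<zeta> * x))"
proof (rule Bochner_Integration.integrable_bound)
  show "integrable \<mu> (\<lambda>x. \<zeta>\<^sup>2 / 2 * x\<^sup>2)" by (intro integrable_mult_right second_moment)
  show "AE x in \<mu>. cmod (iexp (\<zeta> * x) - 1 - \<i> * of_real (\<zeta> * x)) \<le> norm (\<zeta>\<^sup>2 / 2 * x\<^sup>2)"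
    using iexp_diff_linear_le[of "\<zeta> * _"] by (intro AE_I2) (simp add: power_mult_distrib del: of_real_mult)
qed measurable

text \<open>Jumps outside [-1, 1] satisfy |x| \<le> x^2, so their first moment exists, and
  compensating them as well changes only the drift.\<close>

lemma levy_cumulant_eq_centred:
  obtains d where "\<And>\<zeta>. levy_cumulant a b \<mu> \<zeta> = \<i> * of_real (\<zeta> * d) + centred_cumulant b \<mu> \<zeta>"
proof
  fix \<zeta>
  let ?r = "\<lambda>x. x * (1 - indicator {-1..1} x)"
  have r: "integrable \<mu> ?r"
  proof (rule Bochner_Integration.integrable_bound[OF second_moment])
    show "AE x in \<mu>. norm (?r x) \<le> norm (x\<^sup>2)"
    proof (rule AE_I2)
      fix x :: real
      show "norm (?r x) \<le> norm (x\<^sup>2)"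
      proof (cases "\<bar>x\<bar> \<le> 1")
        case False
        then have "1 * \<bar>x\<bar> \<le> \<bar>x\<bar> * \<bar>x\<bar>" by (intro mult_right_mono) auto
        then show ?thesis using False by (auto simp: power2_eq_square abs_mult indicator_def)
      qed (auto simp: indicator_def)
    qed
  qed measurable
  have "(\<integral>x. (iexp (\<zeta> * x) - 1 - \<i> * of_real (\<zeta> * x * indicator {-1..1} x)) \<partial>\<mu>)
      = (\<integral>x. (iexp (\<zeta> * x) - 1 - \<i> * of_real (\<zeta> * x)) + \<i> * of_real \<zeta> * of_real (?r x) \<partial>\<mu>)"
    by (intro Bochner_Integration.integral_cong) (auto simp: algebra_simps)
  also have "\<dots> = (\<integral>x. (iexp (\<zeta> * x) - 1 - \<i> * of_real (\<zeta> * x)) \<partial>\<mu>) + (\<integral>x. \<i> * of_real \<zeta> * of_real (?r x) \<partial>\<mu>)"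
    by (intro Bochner_Integration.integral_add integrable_centred_integrand integrable_mult_right integrable_of_real r)
  also have "(\<integral>x. \<i> * of_real \<zeta> * of_real (?r x) \<partial>\<mu>) = \<i> * of_real \<zeta> * of_real (\<integral>x. ?r x \<partial>\<mu>)"
    by (simp only: integral_mult_right_zero integral_complex_of_real)
  finally show "levy_cumulant a b \<mu> \<zeta> = \<i> * of_real (\<zeta> * (a + (\<integral>x. ?r x \<partial>\<mu>))) + centred_cumulant b \<mu> \<zeta>"
    unfolding levy_cumulant_def centred_cumulant_def by (simp add: algebra_simps)
qed

text \<open>A modulus of continuity made for mean-square arguments: integrated over a kernel it
  gives a square term and a cross term open to Cauchy-Schwarz. At y = 0 it becomes the basic bound v
  / 2 * x^2.\<close>

lemma centred_cumulant_diff_le: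
  "cmod (centred_cumulant b \<mu> x - centred_cumulant b \<mu> y) \<le> v * ((x - y)\<^sup>2 / 2 + \<bar>x - y\<bar> * \<bar>y\<bar>)"
proof -
  let ?B = "(x - y)\<^sup>2 / 2 + \<bar>x - y\<bar> * \<bar>y\<bar>"
  let ?c = "\<lambda>\<zeta> u. iexp (\<zeta> * u) - 1 - \<i> * of_real (\<zeta> * u)"
  have pt: "cmod (?c x u - ?c y u) \<le> ?B * u\<^sup>2" for u
  proof -
    let ?z = "\<i> * of_real ((x - y) * u)"
    \<comment> \<open>Factoring exp (i x u) as exp (i y u) exp (i (x - y) u) separates the
      second-order Taylor remainder of the increment from a cross term that carries the factor
      |y|.\<close>
    have "?c x u - ?c y u = iexp (y * u) * (iexp ((x - y) * u) - 1 - ?z) + ?z * (iexp (y * u) - 1)"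
    proof -
      have "iexp (x * u) = iexp (y * u) * iexp ((x - y) * u)" by (simp add: algebra_simps flip: exp_add)
      then show ?thesis by (simp add: algebra_simps)
    qed
    also have "cmod \<dots> \<le> cmod (iexp (y * u) * (iexp ((x - y) * u) - 1 - ?z)) + cmod (?z * (iexp (y * u) - 1))"
      by (rule norm_triangle_ineq)
    also have "\<dots> = cmod (iexp ((x - y) * u) - 1 - ?z) + \<bar>(x - y) * u\<bar> * cmod (iexp (y * u) - 1)"
      by (simp add: norm_mult abs_mult del: of_real_diff of_real_mult)
    also have "\<dots> \<le> ((x - y) * u)\<^sup>2 / 2 + \<bar>(x - y) * u\<bar> * \<bar>y * u\<bar>"
      using norm_iexp_diff_le[of "y * u" 0]
      by (intro add_mono iexp_diff_linear_le mult_left_mono) auto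
    also have "\<dots> = ?B * u\<^sup>2"
    proof -
      have "\<bar>(x - y) * u\<bar> * \<bar>y * u\<bar> = \<bar>(x - y) * y\<bar> * \<bar>u * u\<bar>"
        by (simp only: abs_mult mult_ac)
      also have "\<dots> = \<bar>x - y\<bar> * \<bar>y\<bar> * u\<^sup>2"
        by (simp only: abs_mult abs_mult_self_eq power2_eq_square)
      finally show ?thesis by (simp only: power_mult_distrib distrib_right times_divide_eq_left)
    qed
    finally show ?thesis .
  qed
  have eq: "centred_cumulant b \<mu> x - centred_cumulant b \<mu> y
      = of_real (b * ((y\<^sup>2 - x\<^sup>2) / 2)) + (\<integral>u. ?c x u - ?c y u \<partial>\<mu>)"
  proof -
    have "(\<integral>u. ?c x u - ?c y u \<partial>\<mu>) = (\<integral>u. ?c x u \<partial>\<mu>) - (\<integral>u. ?c y u \<partial>\<mu>)"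
      by (intro Bochner_Integration.integral_diff integrable_centred_integrand)
    then show ?thesis
      unfolding centred_cumulant_def by (simp only:) (simp add: field_simps)
  qed
  have 1: "cmod (centred_cumulant b \<mu> x - centred_cumulant b \<mu> y) \<le> cmod (of_real (b * ((y\<^sup>2 - x\<^sup>2) / 2))) + cmod (\<integral>u. ?c x u - ?c y u \<partial>\<mu>)"
    unfolding eq by (rule norm_triangle_ineq)
  have 2: "cmod (of_real (b * ((y\<^sup>2 - x\<^sup>2) / 2))) \<le> b * ?B"
  proof -
    have "\<bar>(y\<^sup>2 - x\<^sup>2) / 2\<bar> = \<bar>(x - y)\<^sup>2 / 2 + (x - y) * y\<bar>" by (simp add: power2_eq_square field_simps)
    also have "\<dots> \<le> ?B" by (rule order_trans[OF abs_triangle_ineq]) (simp add: abs_mult)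
    finally show ?thesis
      using gaussian_part_nonneg unfolding norm_of_real abs_mult
      by (simp only: abs_of_nonneg mult_left_mono)
  qed
  have 3: "cmod (\<integral>u. ?c x u - ?c y u \<partial>\<mu>) \<le> (\<integral>u. ?B * u\<^sup>2 \<partial>\<mu>)"
  proof -
    have "cmod (\<integral>u. ?c x u - ?c y u \<partial>\<mu>) \<le> (\<integral>u. cmod (?c x u - ?c y u) \<partial>\<mu>)"
      by (rule integral_norm_bound)
    also have "\<dots> \<le> (\<integral>u. ?B * u\<^sup>2 \<partial>\<mu>)"
    proof (rule integral_mono[OF _ _ pt])
      show "integrable \<mu> (\<lambda>u. cmod (?c x u - ?c y u))"
        by (intro integrable_norm Bochner_Integration.integrable_diff integrable_centred_integrand)
      show "integrable \<mu> (\<lambda>u. ?B * u\<^sup>2)" by (intro integrable_mult_right second_moment)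
    qed
    finally show ?thesis .
  qed
  have 4: "b * ?B + (\<integral>u. ?B * u\<^sup>2 \<partial>\<mu>) = v * ?B"
    unfolding integral_mult_right_zero v_def by (simp only: distrib_right mult.commute)
  show ?thesis using 1 2 3 unfolding 4[symmetric] by (rule order_trans[OF _ add_mono])
qed

lemma centred_cumulant_0 [simp]: "centred_cumulant b \<mu> 0 = 0"
  by (simp add: centred_cumulant_def)

lemma norm_centred_cumulant_le: "cmod (centred_cumulant b \<mu> x) \<le> v / 2 * x\<^sup>2"
  using centred_cumulant_diff_le[of x 0] by simp


end

context levy_measure_L2
begin

text \<open>The cubic Taylor error is used only pointwise in u. The dominating function is the
  quadratic bound u^2 / 2, so the limit rests on the second moment of \<mu> alone.\<close>

lemma centred_cumulant_asymp:
  "((\<lambda>x. centred_cumulant b \<mu> x / of_real (x\<^sup>2)) \<longlongrightarrow> of_real (- v / 2)) (at 0)"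
  unfolding tendsto_at_iff_sequentially comp_def
proof (intro allI impI)
  fix X :: "nat \<Rightarrow> real" assume X0: "\<forall>n. X n \<in> UNIV - {0}" and X: "X \<longlonglongrightarrow> 0"
  let ?c = "\<lambda>y u. (iexp (y * u) - 1 - \<i> * of_real (y * u)) / of_real (y\<^sup>2)"
  have pt: "cmod (?c y u - of_real (- (u\<^sup>2 / 2))) \<le> \<bar>y\<bar> * (\<bar>u\<bar> ^ 3 / 6)" if "y \<noteq> 0" for y u
  proof -
    have "cmod (iexp (y * u) - 1 - \<i> * of_real (y * u) + of_real (y\<^sup>2 * (u\<^sup>2 / 2))) \<le> \<bar>y * u\<bar> ^ 3 / 6"
      using iexp_approx1[of "y * u" 2]
      by (simp add: numeral_eq_Suc power2_eq_square algebra_simps flip: of_real_mult)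
    moreover have "?c y u - of_real (- (u\<^sup>2 / 2))
        = (iexp (y * u) - 1 - \<i> * of_real (y * u) + of_real (y\<^sup>2 * (u\<^sup>2 / 2))) / of_real (y\<^sup>2)"
      using that by (simp add: add_divide_distrib)
    ultimately have "cmod (?c y u - of_real (- (u\<^sup>2 / 2))) \<le> (\<bar>y * u\<bar> ^ 3 / 6) / y\<^sup>2"
      by (simp only: norm_divide norm_of_real abs_power2) (intro divide_right_mono, auto)
    also have "\<dots> = \<bar>y\<bar> * (\<bar>u\<bar> ^ 3 / 6)"
    proof -
      have "r ^ 3 * w / 6 / r\<^sup>2 = r * (w / 6)" if "r \<noteq> 0" for r w :: real
        using that by (simp add: power3_eq_cube power2_eq_square)
      from this[of "\<bar>y\<bar>" "\<bar>u\<bar> ^ 3"] show ?thesis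
        using that by (simp only: abs_mult power_mult_distrib power2_abs abs_eq_0 not_False_eq_True)
    qed
    finally show ?thesis .
  qed
  have "(\<lambda>n. \<integral>u. ?c (X n) u \<partial>\<mu>) \<longlonglongrightarrow> (\<integral>u. of_real (- (u\<^sup>2 / 2)) \<partial>\<mu>)"
  proof (rule integral_dominated_convergence)
    show "integrable \<mu> (\<lambda>u. u\<^sup>2 / 2)" using second_moment by simp
    show "AE u in \<mu>. cmod (?c (X n) u) \<le> u\<^sup>2 / 2" for n
    proof (rule AE_I2)
      fix u
      have "cmod (iexp (X n * u) - 1 - \<i> * of_real (X n * u)) \<le> (X n * u)\<^sup>2 / 2" by (rule iexp_diff_linear_le)
      then show "cmod (?c (X n) u) \<le> u\<^sup>2 / 2"
        using X0 by (simp add: norm_divide norm_power power_mult_distrib field_simps del: of_real_mult)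
    qed
    show "AE u in \<mu>. (\<lambda>n. ?c (X n) u) \<longlonglongrightarrow> of_real (- (u\<^sup>2 / 2))"
    proof (rule AE_I2)
      fix u
      have l0: "(\<lambda>n. \<bar>X n\<bar> * (\<bar>u\<bar> ^ 3 / 6)) \<longlonglongrightarrow> 0"
        using tendsto_mult_left_zero[OF tendsto_rabs_zero[OF X]] .
      have nb: "\<forall>n. cmod (?c (X n) u - of_real (- (u\<^sup>2 / 2))) \<le> \<bar>X n\<bar> * (\<bar>u\<bar> ^ 3 / 6)"
        using pt X0 by blast
      have "(\<lambda>n. ?c (X n) u - of_real (- (u\<^sup>2 / 2))) \<longlonglongrightarrow> 0"
        by (rule Lim_null_comparison[OF always_eventually[OF nb] l0])
      then show "(\<lambda>n. ?c (X n) u) \<longlonglongrightarrow> of_real (- (u\<^sup>2 / 2))" by (rule LIM_zero_cancel)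
    qed
  qed measurable
  then have "(\<lambda>n. of_real (- b / 2) + (\<integral>u. ?c (X n) u \<partial>\<mu>)) \<longlonglongrightarrow> of_real (- b / 2) + of_real (- ((\<integral>u. u\<^sup>2 \<partial>\<mu>) / 2))"
    unfolding integral_complex_of_real by (intro tendsto_add tendsto_const) simp
  moreover have "of_real (- b / 2) + of_real (- ((\<integral>u. u\<^sup>2 \<partial>\<mu>) / 2)) = (of_real (- v / 2) :: complex)"
    by (simp add: v_def add_divide_distrib)
  moreover have "of_real (- b / 2) + (\<integral>u. ?c (X n) u \<partial>\<mu>) = centred_cumulant b \<mu> (X n) / of_real ((X n)\<^sup>2)" for n
    unfolding centred_cumulant_def integral_divide_zero add_divide_distrib using X0 by simp
  ultimately show "(\<lambda>n. centred_cumulant b \<mu> (X n) / of_real ((X n)\<^sup>2)) \<longlonglongrightarrow> of_real (- v / 2)"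
    by simp
qed

lemma centred_cumulant_scaled:
  assumes f: "(f \<longlongrightarrow> y) F" and g: "(g \<longlongrightarrow> 0) F" "eventually (\<lambda>t. g t \<noteq> 0) F"
  shows "((\<lambda>t. centred_cumulant b \<mu> (f t * g t) / of_real ((g t)\<^sup>2)) \<longlongrightarrow> of_real (- v / 2 * y\<^sup>2)) F"
proof -
  \<comment> \<open>The value at 0 fills the removable singularity, so that points with f t = 0 need
    no separate treatment.\<close>
  define q where "q x = (if x = 0 then of_real (- v / 2) else centred_cumulant b \<mu> x / of_real (x\<^sup>2))" for x
  have "isCont q 0"
    unfolding isCont_def using centred_cumulant_asymp
    by (rule Lim_transform_eventually[THEN back_subst[where P="\<lambda>l. (q \<longlongrightarrow> l) (at 0)"]])
      (auto simp: q_def eventually_at_filter)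
  moreover have "((\<lambda>t. f t * g t) \<longlongrightarrow> 0) F" using tendsto_mult[OF f g(1)] by simp
  ultimately have "((\<lambda>t. q (f t * g t)) \<longlongrightarrow> q 0) F" by (rule isCont_tendsto_compose)
  then have "((\<lambda>t. of_real ((f t)\<^sup>2) * q (f t * g t)) \<longlongrightarrow> of_real (y\<^sup>2) * q 0) F"
    by (intro tendsto_mult tendsto_of_real tendsto_power f)
  moreover have "eventually (\<lambda>t. of_real ((f t)\<^sup>2) * q (f t * g t) = centred_cumulant b \<mu> (f t * g t) / of_real ((g t)\<^sup>2)) F"
    using g(2) by eventually_elim (auto simp: q_def power_mult_distrib)
  ultimately have "((\<lambda>t. centred_cumulant b \<mu> (f t * g t) / of_real ((g t)\<^sup>2)) \<longlongrightarrow> of_real (y\<^sup>2) * q 0) F"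
    by (rule Lim_transform_eventually)
  then show ?thesis by (simp add: q_def mult.commute)
qed

lemma isCont_centred_cumulant: "isCont (centred_cumulant b \<mu>) x"
  unfolding isCont_def
proof (rule LIM_zero_cancel, rule Lim_null_comparison[OF always_eventually], intro allI)
  show "cmod (centred_cumulant b \<mu> y - centred_cumulant b \<mu> x) \<le> v * ((y - x)\<^sup>2 / 2 + \<bar>y - x\<bar> * \<bar>x\<bar>)" for y
    by (rule centred_cumulant_diff_le)
  have "((\<lambda>y. v * ((y - x)\<^sup>2 / 2 + \<bar>y - x\<bar> * \<bar>x\<bar>)) \<longlongrightarrow> v * ((x - x)\<^sup>2 / 2 + \<bar>x - x\<bar> * \<bar>x\<bar>)) (at x)"
    by (intro tendsto_intros) auto
  then show "((\<lambda>y. v * ((y - x)\<^sup>2 / 2 + \<bar>y - x\<bar> * \<bar>x\<bar>)) \<longlongrightarrow> 0) (at x)" by simp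
qed

lemma measurable_centred_cumulant [measurable]: "centred_cumulant b \<mu> \<in> borel_measurable borel"
  by (intro borel_measurable_continuous_onI continuous_at_imp_continuous_on ballI isCont_centred_cumulant)

lemma integrable_centred_cumulant:
  assumes [measurable]: "f \<in> borel_measurable \<nu>" and f2: "integrable \<nu> (\<lambda>x. (f x)\<^sup>2)"
  shows "integrable \<nu> (\<lambda>x. centred_cumulant b \<mu> (f x))"
    and "cmod (\<integral>x. centred_cumulant b \<mu> (f x) \<partial>\<nu>) \<le> v / 2 * (\<integral>x. (f x)\<^sup>2 \<partial>\<nu>)"
proof -
  have i: "integrable \<nu> (\<lambda>x. v / 2 * (f x)\<^sup>2)" by (intro integrable_mult_right f2)
  show c: "integrable \<nu> (\<lambda>x. centred_cumulant b \<mu> (f x))"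
    by (rule Bochner_Integration.integrable_bound[OF i])
      (auto intro!: AE_I2 order_trans[OF norm_centred_cumulant_le abs_ge_self] simp del: times_divide_eq_left)
  have "cmod (\<integral>x. centred_cumulant b \<mu> (f x) \<partial>\<nu>) \<le> (\<integral>x. cmod (centred_cumulant b \<mu> (f x)) \<partial>\<nu>)"
    by (rule integral_norm_bound)
  also have "\<dots> \<le> (\<integral>x. v / 2 * (f x)\<^sup>2 \<partial>\<nu>)"
    by (intro integral_mono integrable_norm c i norm_centred_cumulant_le)
  also have "\<dots> = v / 2 * (\<integral>x. (f x)\<^sup>2 \<partial>\<nu>)" by (rule integral_mult_right_zero)
  finally show "cmod (\<integral>x. centred_cumulant b \<mu> (f x) \<partial>\<nu>) \<le> v / 2 * (\<integral>x. (f x)\<^sup>2 \<partial>\<nu>)" .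
qed

end

section \<open>Second moment of the jump measure\<close>

locale levy_basis_noise = prob_space M + sigma_finite_measure \<nu> + levy_measure a b \<mu>
  for M :: "'w measure" and \<nu> :: "'e measure" and a b :: real and \<mu> :: "real measure" +
  fixes \<Lambda> :: "'e set \<Rightarrow> 'w \<Rightarrow> real"
  assumes levy_basis: "levy_basis M \<nu> (levy_cumulant a b \<mu>) \<Lambda>"
begin

sublocale levy_noise M \<nu> "levy_cumulant a b \<mu>" \<Lambda>
  by unfold_locales
    (fact levy_basis levy_cumulant_0 isCont_levy_cumulant Re_levy_cumulant_le_0 Re_levy_cumulant_double)+

lemma has_stoch_integral_measurable:
  assumes "has_stoch_integral M \<nu> \<Lambda> f Y"
  shows "f \<in> borel_measurable \<nu>" "Y \<in> borel_measurable M"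
  using assms by (auto simp: has_stoch_integral_def tendsto_in_prob_def)

text \<open>The modulus of the characteristic function of \<open>Y\<close> is at most that of the
  contribution of \<open>E j\<close>. Hence minus the real part of the cumulant on
  \<open>E j\<close> at 1 / n is bounded by - ln |char (1 / n)|, which is O(1 / n^2) by the finite
  variance. Fatou in the jump size and then in x bounds the product of the second moments of f on
  \<open>E j\<close> and of \<mu>; a kernel of nonzero norm lets the second factor be
  isolated.\<close>

lemma second_moment_levy_measure:
  assumes has: "has_stoch_integral M \<nu> \<Lambda> f Y"
    and Y2: "integrable M (\<lambda>\<omega>. (Y \<omega>)\<^sup>2)"
    and nz: "(\<integral>\<^sup>+x. ennreal ((f x)\<^sup>2) \<partial>\<nu>) \<noteq> 0"
  shows "integrable \<mu> (\<lambda>x. x\<^sup>2)"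
proof -
  let ?\<kappa> = "levy_cumulant a b \<mu>"
  have [measurable]: "f \<in> borel_measurable \<nu>" "Y \<in> borel_measurable M"
    using has_stoch_integral_measurable[OF has] .
  define s where "s = (\<integral>\<omega>. (Y \<omega>)\<^sup>2 \<partial>M)"
  interpret Y: real_distribution "distr M borel Y" by (rule real_distribution_distrI) measurable
  obtain E Z where
    E: "incseq E" "\<And>j. E j \<in> sets \<nu>" "\<And>j. emeasure \<nu> (E j) < \<infinity>"
      "AE x in \<nu>. x \<in> (\<Union>j. E j)" "\<And>j x. x \<in> E j \<Longrightarrow> \<bar>f x\<bar> \<le> real j"
    and Z: "\<And>j. Z j \<in> borel_measurable M"
    and char: "\<And>j \<zeta>. char (distr M borel Y) \<zeta>
       = exp (set_lebesgue_integral \<nu> (E j) (\<lambda>x. ?\<kappa> (\<zeta> * f x))) * char (distr M borel (Z j)) \<zeta>"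
    using stoch_integral_char[OF has] by metis
  note [measurable] = E(2)
  have sint: "set_integrable \<nu> (E j) (\<lambda>x. ?\<kappa> (\<zeta> * f x))" for j \<zeta>
  proof -
    obtain K where K: "\<And>y. \<bar>y\<bar> \<le> \<bar>\<zeta>\<bar> * real j \<Longrightarrow> cmod (?\<kappa> y) \<le> K"
      using exponent_bounded[of "\<bar>\<zeta>\<bar> * real j"] by blast
    show ?thesis
      unfolding set_integrable_def
    proof (rule integrableI_bounded_set_indicator[where B=K])
      show "AE x in \<nu>. x \<in> E j \<longrightarrow> cmod (?\<kappa> (\<zeta> * f x)) \<le> K"
        using E(5) by (intro AE_I2 impI K) (auto simp: abs_mult intro: mult_left_mono)
    qed (use E(3)[of j] in auto)
  qed
  have upper: "\<forall>\<^sub>F n in sequentially. \<forall>j. 2 * (real (Suc n))\<^sup>2 *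
      - Re (set_lebesgue_integral \<nu> (E j) (\<lambda>x. ?\<kappa> (f x / real (Suc n)))) \<le> 2 * s"
  proof -
    have "(\<lambda>n. char (distr M borel Y) (1 / real (Suc n))) \<longlonglongrightarrow> char (distr M borel Y) 0"
      using LIMSEQ_inverse_real_of_nat by (intro isCont_tendsto_compose[OF Y.isCont_char]) (simp add: inverse_eq_divide)
    then have "(\<lambda>n. cmod (char (distr M borel Y) (1 / real (Suc n)))) \<longlonglongrightarrow> 1"
      using tendsto_norm Y.char_zero by fastforce
    \<comment> \<open>A modulus r above 1 / 2 gives - ln r \<le> 2 (1 - r), which removes the
      logarithm.\<close>
    then have "\<forall>\<^sub>F n in sequentially. 1/2 < cmod (char (distr M borel Y) (1 / real (Suc n)))"
      by (rule order_tendstoD(1)) simp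
    then show ?thesis
    proof eventually_elim
      case (elim n)
      let ?r = "cmod (char (distr M borel Y) (1 / real (Suc n)))"
      show ?case
      proof
        fix j
        let ?I = "set_lebesgue_integral \<nu> (E j) (\<lambda>x. ?\<kappa> (f x / real (Suc n)))"
        interpret Z: real_distribution "distr M borel (Z j)" by (rule real_distribution_distrI[OF Z])
        have "?r \<le> exp (Re ?I)"
          using char[of "1 / real (Suc n)" j] Z.cmod_char_le_1[of "1 / real (Suc n)"]
          by (simp add: norm_mult mult_left_le del: of_nat_Suc)
        then have "ln ?r \<le> ln (exp (Re ?I))" using elim by (subst ln_le_cancel_iff) auto
        then have "ln ?r \<le> Re ?I" by (simp only: ln_exp)
        moreover have "- ln ?r \<le> 2 * (1 - ?r)"
        proof -
          have "- ln ?r = ln (1 / ?r)" using elim by (simp add: ln_div)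
          also have "\<dots> \<le> 1 / ?r - 1" using elim by (intro ln_le_minus_one) auto
          also have "\<dots> = (1 - ?r) / ?r" 
          proof -
            have "?r \<noteq> 0" using elim by linarith
            then show ?thesis by (simp only: diff_divide_distrib divide_self not_False_eq_True)
          qed
          also have "\<dots> \<le> (1 - ?r) / (1/2)"
            using elim Y.cmod_char_le_1[of "1 / real (Suc n)"] by (intro divide_left_mono) auto
          finally show ?thesis by simp
        qed
        \<comment> \<open>The modulus is at least the real part, whose distance to 1 is the mean of
          1 - cos (Y / n), and this is at most Y^2 / (2 n^2).\<close>
        moreover have "1 - ?r \<le> s / (2 * (real (Suc n))\<^sup>2)"
        proof -
          have c: "integrable M (\<lambda>\<omega>. cos (Y \<omega> / real (Suc n)))"
            by (rule integrable_const_bound[where B=1]) auto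
          have "1 - ?r \<le> 1 - Re (char (distr M borel Y) (1 / real (Suc n)))"
            using complex_Re_le_cmod by simp
          also have "Re (char (distr M borel Y) (1 / real (Suc n))) = (\<integral>\<omega>. cos (Y \<omega> / real (Suc n)) \<partial>M)"
            by (simp add: char_distr integrable_iexp Re_exp del: of_real_mult of_real_divide of_nat_Suc flip: integral_Re)
          also have "1 - (\<integral>\<omega>. cos (Y \<omega> / real (Suc n)) \<partial>M) = (\<integral>\<omega>. 1 - cos (Y \<omega> / real (Suc n)) \<partial>M)"
            using c by (simp add: prob_space)
          also have "\<dots> \<le> (\<integral>\<omega>. (Y \<omega>)\<^sup>2 / (2 * (real (Suc n))\<^sup>2) \<partial>M)"
          proof (rule integral_mono)
            show "1 - cos (Y \<omega> / real (Suc n)) \<le> (Y \<omega>)\<^sup>2 / (2 * (real (Suc n))\<^sup>2)" for \<omega>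
              using one_minus_cos_le[of "Y \<omega> / real (Suc n)"] by (simp add: power_divide del: of_nat_Suc)
          qed (use c Y2 in auto)
          also have "\<dots> = s / (2 * (real (Suc n))\<^sup>2)" by (simp add: s_def)
          finally show ?thesis .
        qed
        moreover have "- i \<le> 2 * q" if "(l::real) \<le> (i::real)" "- l \<le> 2 * (1 - (r::real))" "1 - r \<le> (q::real)" for l i r q
          using that by argo
        ultimately have "- Re ?I \<le> 2 * (s / (2 * (real (Suc n))\<^sup>2))" by blast
        then have "2 * (real (Suc n))\<^sup>2 * - Re ?I \<le> 2 * (real (Suc n))\<^sup>2 * (2 * (s / (2 * (real (Suc n))\<^sup>2)))"
          by (intro mult_left_mono) auto
        then show "2 * (real (Suc n))\<^sup>2 * - Re ?I \<le> 2 * s" by (simp del: of_nat_Suc)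
      qed
    qed
  qed
  let ?V = "\<integral>\<^sup>+x. ennreal (x\<^sup>2) \<partial>\<mu>"
  have bound: "(\<integral>\<^sup>+x\<in>E j. ennreal ((f x)\<^sup>2) \<partial>\<nu>) * ?V \<le> ennreal (2 * s)" for j
  proof -
    let ?h = "\<lambda>n x. ennreal (2 * (real (Suc n))\<^sup>2 * - Re (?\<kappa> (f x / real (Suc n)))) * indicator (E j) x"
    have "(\<integral>\<^sup>+x\<in>E j. ennreal ((f x)\<^sup>2) \<partial>\<nu>) * ?V = (\<integral>\<^sup>+x. ennreal ((f x)\<^sup>2) * indicator (E j) x * ?V \<partial>\<nu>)"
      by (rule nn_integral_multc[symmetric]) measurable
    also have "\<dots> \<le> (\<integral>\<^sup>+x. liminf (\<lambda>n. ?h n x) \<partial>\<nu>)"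
    proof (rule nn_integral_mono)
      fix x
      show "ennreal ((f x)\<^sup>2) * indicator (E j) x * ?V \<le> liminf (\<lambda>n. ?h n x)"
        using nn_integral_square_le_liminf_cumulant[of "f x"]
        by (cases "x \<in> E j") (auto simp del: of_nat_Suc)
    qed
    also have "\<dots> \<le> liminf (\<lambda>n. \<integral>\<^sup>+x. ?h n x \<partial>\<nu>)"
      by (rule nn_integral_liminf) measurable
    also have "\<dots> \<le> ennreal (2 * s)"
    proof (rule Liminf_le)
      show "\<forall>\<^sub>F n in sequentially. (\<integral>\<^sup>+x. ?h n x \<partial>\<nu>) \<le> ennreal (2 * s)"
        using upper
      proof eventually_elim
        case (elim n)
        let ?g = "\<lambda>x. indicator (E j) x *\<^sub>R ?\<kappa> (f x / real (Suc n))"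
        have i: "integrable \<nu> ?g"
          using sint[of j "1 / real (Suc n)"] by (simp add: set_integrable_def del: of_nat_Suc)
        have "(\<integral>\<^sup>+x. ?h n x \<partial>\<nu>) = (\<integral>\<^sup>+x. ennreal (2 * (real (Suc n))\<^sup>2 * - Re (?g x)) \<partial>\<nu>)"
          by (intro nn_integral_cong) (simp add: indicator_def del: of_nat_Suc)
        also have "\<dots> = ennreal (\<integral>x. 2 * (real (Suc n))\<^sup>2 * - Re (?g x) \<partial>\<nu>)"
        proof (rule nn_integral_eq_integral)
          show "integrable \<nu> (\<lambda>x. 2 * (real (Suc n))\<^sup>2 * - Re (?g x))"
            by (intro integrable_mult_right integrable_minus integrable_Re i)
          show "AE x in \<nu>. 0 \<le> 2 * (real (Suc n))\<^sup>2 * - Re (?g x)"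
            using Re_levy_cumulant_le_0 by (intro AE_I2 mult_nonneg_nonneg) (auto simp: mult_nonneg_nonpos simp del: of_nat_Suc)
        qed
        also have "(\<integral>x. 2 * (real (Suc n))\<^sup>2 * - Re (?g x) \<partial>\<nu>)
            = 2 * (real (Suc n))\<^sup>2 * - Re (set_lebesgue_integral \<nu> (E j) (\<lambda>x. ?\<kappa> (f x / real (Suc n))))"
          unfolding set_lebesgue_integral_def integral_mult_right_zero integral_minus integral_Re[OF i] ..
        finally show ?case using elim by (simp add: ennreal_leI del: of_nat_Suc)
      qed
    qed simp
    finally show ?thesis .
  qed
  \<comment> \<open>Were the second moment of f zero on every \<open>E j\<close>, f would vanish
    almost everywhere, since these sets exhaust the space.\<close>
  obtain j where j: "(\<integral>\<^sup>+x\<in>E j. ennreal ((f x)\<^sup>2) \<partial>\<nu>) \<noteq> 0"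
  proof (rule ccontr)
    assume "\<not> thesis"
    then have z: "(\<integral>\<^sup>+x\<in>E j. ennreal ((f x)\<^sup>2) \<partial>\<nu>) = 0" for j using that by blast
    have "AE x in \<nu>. \<forall>j. ennreal ((f x)\<^sup>2) * indicator (E j) x = 0"
      using z by (subst AE_all_countable) (auto simp: nn_integral_0_iff_AE)
    with E(4) have "AE x in \<nu>. ennreal ((f x)\<^sup>2) = 0"
      by eventually_elim (auto simp: indicator_def split: if_splits)
    then have "(\<integral>\<^sup>+x. ennreal ((f x)\<^sup>2) \<partial>\<nu>) = 0" by (subst nn_integral_0_iff_AE) auto
    then show False using nz by simp
  qed
  have "?V < \<infinity>"
  proof (rule ccontr)
    assume "\<not> ?V < \<infinity>"
    then have "?V = \<top>" by (metis infinity_ennreal_def less_top)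
    then show False using bound[of j] j by (simp add: ennreal_mult_top top_unique)
  qed
  then show ?thesis by (intro integrableI_nonneg) auto
qed

end

section \<open>Centred integrals: cumulant formula and isometry\<close>

locale levy_basis_noise_L2 = levy_basis_noise M \<nu> a b \<mu> \<Lambda> + levy_measure_L2 a b \<mu>
  for M :: "'w measure" and \<nu> :: "'e measure" and a b :: real and \<mu> :: "real measure"
    and \<Lambda> :: "'e set \<Rightarrow> 'w \<Rightarrow> real"
begin

text \<open>Up to a deterministic shift, whose characteristic function is the multiplicative factor in front,
  the characteristic function of a stochastic integral is that of the centred noise.\<close>

lemma stoch_integral_char_L2:
  assumes has: "has_stoch_integral M \<nu> \<Lambda> f Y" and f2: "integrable \<nu> (\<lambda>x. (f x)\<^sup>2)"
  obtains \<phi> where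
    "\<And>\<zeta>. char (distr M borel Y) \<zeta> = exp (\<integral>x. centred_cumulant b \<mu> (\<zeta> * f x) \<partial>\<nu>) * \<phi> \<zeta>"
    "\<And>\<zeta>. cmod (\<phi> \<zeta>) = 1" "\<And>s t. \<phi> (s + t) = \<phi> s * \<phi> t"
proof -
  let ?\<kappa> = "levy_cumulant a b \<mu>" and ?k = "centred_cumulant b \<mu>"
  have [measurable]: "f \<in> borel_measurable \<nu>" "Y \<in> borel_measurable M"
    using has_stoch_integral_measurable[OF has] .
  obtain d where d: "\<And>\<zeta>. ?\<kappa> \<zeta> = \<i> * of_real (\<zeta> * d) + ?k \<zeta>"
    using levy_cumulant_eq_centred by blast
  obtain E Z where
    E: "incseq E" "\<And>j. E j \<in> sets \<nu>" "\<And>j. emeasure \<nu> (E j) < \<infinity>"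
      "AE x in \<nu>. x \<in> (\<Union>j. E j)" "\<And>j x. x \<in> E j \<Longrightarrow> \<bar>f x\<bar> \<le> real j"
    and Z: "\<And>j. Z j \<in> borel_measurable M"
    and char: "\<And>j \<zeta>. char (distr M borel Y) \<zeta>
       = exp (set_lebesgue_integral \<nu> (E j) (\<lambda>x. ?\<kappa> (\<zeta> * f x))) * char (distr M borel (Z j)) \<zeta>"
    and Z1: "\<And>\<zeta>. (\<lambda>j. cmod (char (distr M borel (Z j)) \<zeta>)) \<longlonglongrightarrow> 1"
    using stoch_integral_char[OF has] by metis
  note [measurable] = E(2) Z
  define W where "W \<zeta> = (\<integral>x. ?k (\<zeta> * f x) \<partial>\<nu>)" for \<zeta>
  define c where "c j = set_lebesgue_integral \<nu> (E j) f" for j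
  define \<phi> where "\<phi> \<zeta> = char (distr M borel Y) \<zeta> * exp (- W \<zeta>)" for \<zeta>
  \<comment> \<open>The drift collected on \<open>E j\<close> is moved into the remainder, so this
    is the characteristic function of a genuine random variable. It converges to \<phi> and its
    modulus tends to 1.\<close>
  define \<phi>' where "\<phi>' j = char (distr M borel (\<lambda>\<omega>. Z j \<omega> + d * c j))" for j
  have f2': "integrable \<nu> (\<lambda>x. (\<zeta> * f x)\<^sup>2)" for \<zeta> using f2 by (simp add: power_mult_distrib)
  have ki: "integrable \<nu> (\<lambda>x. ?k (\<zeta> * f x))" for \<zeta>
    by (rule integrable_centred_cumulant(1)[OF _ f2']) measurable
  have kE: "set_integrable \<nu> (E j) (\<lambda>x. ?k (\<zeta> * f x))" for j \<zeta>
    unfolding set_integrable_def by (rule integrable_mult_indicator[OF E(2) ki])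
  have fE: "set_integrable \<nu> (E j) f" for j
    unfolding set_integrable_def
    by (rule integrableI_bounded_set_indicator[where B="real j"]) (use E(3)[of j] E(5)[of _ j] in auto)
  have split: "set_lebesgue_integral \<nu> (E j) (\<lambda>x. ?\<kappa> (\<zeta> * f x))
      = \<i> * of_real (\<zeta> * (d * c j)) + set_lebesgue_integral \<nu> (E j) (\<lambda>x. ?k (\<zeta> * f x))" for j \<zeta>
  proof -
    have "set_integrable \<nu> (E j) (\<lambda>x. complex_of_real (f x))"
      using fE[of j] unfolding set_integrable_def
      by (auto dest!: integrable_of_real[where 'a=complex] simp: scaleR_conv_of_real)
    then have i: "set_integrable \<nu> (E j) (\<lambda>x. \<i> * of_real (\<zeta> * d) * complex_of_real (f x))"
      by (rule set_integrable_mult_right)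
    have "set_lebesgue_integral \<nu> (E j) (\<lambda>x. ?\<kappa> (\<zeta> * f x))
       = set_lebesgue_integral \<nu> (E j) (\<lambda>x. \<i> * of_real (\<zeta> * d) * complex_of_real (f x) + ?k (\<zeta> * f x))"
      by (simp add: d mult_ac)
    also have "\<dots> = set_lebesgue_integral \<nu> (E j) (\<lambda>x. \<i> * of_real (\<zeta> * d) * complex_of_real (f x))
        + set_lebesgue_integral \<nu> (E j) (\<lambda>x. ?k (\<zeta> * f x))"
      by (rule set_integral_add(2)[OF i kE])
    also have "set_lebesgue_integral \<nu> (E j) (\<lambda>x. \<i> * of_real (\<zeta> * d) * complex_of_real (f x))
        = \<i> * of_real (\<zeta> * d) * of_real (c j)"
      unfolding c_def by (simp only: set_integral_mult_right set_integral_complex_of_real)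
    finally show ?thesis by (simp add: mult_ac)
  qed
  have charZ: "\<phi>' j \<zeta> = char (distr M borel Y) \<zeta> * exp (- set_lebesgue_integral \<nu> (E j) (\<lambda>x. ?k (\<zeta> * f x)))"
    and cmodZ: "cmod (\<phi>' j \<zeta>) = cmod (char (distr M borel (Z j)) \<zeta>)" for j \<zeta>
  proof -
    have 1: "\<phi>' j \<zeta> = iexp (\<zeta> * (d * c j)) * char (distr M borel (Z j)) \<zeta>"
    proof -
      have "\<phi>' j \<zeta> = (\<integral>\<omega>. iexp (\<zeta> * (d * c j)) * iexp (\<zeta> * Z j \<omega>) \<partial>M)"
        unfolding \<phi>'_def by (subst char_distr) (auto simp: algebra_simps simp flip: exp_add intro!: Bochner_Integration.integral_cong)
      also have "\<dots> = iexp (\<zeta> * (d * c j)) * char (distr M borel (Z j)) \<zeta>"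
        by (subst char_distr) (auto simp del: of_real_mult)
      finally show ?thesis .
    qed
    then show "cmod (\<phi>' j \<zeta>) = cmod (char (distr M borel (Z j)) \<zeta>)" by (simp add: norm_mult del: of_real_mult)
    show "\<phi>' j \<zeta> = char (distr M borel Y) \<zeta> * exp (- set_lebesgue_integral \<nu> (E j) (\<lambda>x. ?k (\<zeta> * f x)))"
      unfolding char[of \<zeta> j] split 1 by (simp add: exp_add exp_minus field_simps)
  qed
  have Wlim: "(\<lambda>j. set_lebesgue_integral \<nu> (E j) (\<lambda>x. ?k (\<zeta> * f x))) \<longlonglongrightarrow> W \<zeta>" for \<zeta>
    unfolding W_def set_lebesgue_integral_def
  proof (rule integral_dominated_convergence[where w="\<lambda>x. cmod (?k (\<zeta> * f x))"])
    show "AE x in \<nu>. (\<lambda>j. indicator (E j) x *\<^sub>R ?k (\<zeta> * f x)) \<longlonglongrightarrow> ?k (\<zeta> * f x)"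
      using E(4)
    proof eventually_elim
      case (elim x)
      then obtain j0 where "x \<in> E j0" by auto
      then have "x \<in> E j" if "j \<ge> j0" for j using E(1) that by (auto simp: incseq_def)
      then have "\<forall>\<^sub>F j in sequentially. indicator (E j) x *\<^sub>R ?k (\<zeta> * f x) = ?k (\<zeta> * f x)"
        by (intro eventually_sequentiallyI[of j0]) simp
      then show ?case by (rule tendsto_eventually)
    qed
    show "AE x in \<nu>. cmod (indicator (E j) x *\<^sub>R ?k (\<zeta> * f x)) \<le> cmod (?k (\<zeta> * f x))" for j
      by (rule AE_I2) (simp add: indicator_def)
  qed (use ki in auto)
  have lim: "(\<lambda>j. \<phi>' j \<zeta>) \<longlonglongrightarrow> \<phi> \<zeta>" for \<zeta>
    unfolding charZ \<phi>_def by (intro tendsto_intros Wlim)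
  have norm1: "cmod (\<phi> \<zeta>) = 1" for \<zeta>
    using tendsto_norm[OF lim[of \<zeta>]] Z1[of \<zeta>] unfolding cmodZ by (rule LIMSEQ_unique)
  have mult: "\<phi> (s + t) = \<phi> s * \<phi> t" for s t
  proof -
    have "(\<lambda>j. \<phi>' j (s + t) - \<phi>' j s * \<phi>' j t) \<longlonglongrightarrow> \<phi> (s + t) - \<phi> s * \<phi> t"
      by (intro tendsto_intros lim)
    moreover have "(\<lambda>j. \<phi>' j (s + t) - \<phi>' j s * \<phi>' j t) \<longlonglongrightarrow> 0"
    proof -
      \<comment> \<open>The defect of multiplicativity is controlled by 1 - |\<phi>' j s|^2, which
        tends to 0; hence the limit is exactly multiplicative.\<close>
      have nb: "\<forall>j. cmod (\<phi>' j (s + t) - \<phi>' j s * \<phi>' j t) \<le> sqrt (1 - (cmod (\<phi>' j s))\<^sup>2)"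
        unfolding \<phi>'_def by (intro allI real_distribution.char_add_approx real_distribution_distrI) measurable
      have "(\<lambda>j. sqrt (1 - (cmod (\<phi>' j s))\<^sup>2)) \<longlonglongrightarrow> sqrt (1 - (cmod (\<phi> s))\<^sup>2)"
        by (intro tendsto_intros lim)
      then have l0: "(\<lambda>j. sqrt (1 - (cmod (\<phi>' j s))\<^sup>2)) \<longlonglongrightarrow> 0" by (simp add: norm1)
      show ?thesis by (rule Lim_null_comparison[OF always_eventually[OF nb] l0])
    qed
    ultimately have "\<phi> (s + t) - \<phi> s * \<phi> t = 0" by (rule LIMSEQ_unique)
    then show ?thesis by simp
  qed
  show ?thesis
    by (rule that[of \<phi>, OF _ norm1 mult]) (simp add: \<phi>_def W_def exp_minus field_simps)
qed

text \<open>The modulus of the characteristic function is the exponential of the real part of the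
  cumulant integral, and the latter is O(1 / n^2) at 1 / n. The symmetrised criterion sees only this
  modulus, so the shift need not be known.\<close>

lemma stoch_integral_square_integrable:
  assumes has: "has_stoch_integral M \<nu> \<Lambda> f Y" and f2: "integrable \<nu> (\<lambda>x. (f x)\<^sup>2)"
  shows "integrable M (\<lambda>\<omega>. (Y \<omega>)\<^sup>2)"
proof (rule square_integrable_if_char)
  show [measurable]: "Y \<in> borel_measurable M" using has_stoch_integral_measurable[OF has] by simp
  have [measurable]: "f \<in> borel_measurable \<nu>" using has_stoch_integral_measurable[OF has] by simp
  obtain \<phi> where \<phi>: "\<And>\<zeta>. char (distr M borel Y) \<zeta> = exp (\<integral>x. centred_cumulant b \<mu> (\<zeta> * f x) \<partial>\<nu>) * \<phi> \<zeta>"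
    "\<And>\<zeta>. cmod (\<phi> \<zeta>) = 1"
    using stoch_integral_char_L2[OF has f2] by metis
  fix n
  let ?\<zeta> = "1 / real (Suc n)" let ?F = "\<integral>x. (f x)\<^sup>2 \<partial>\<nu>"
  let ?W = "\<integral>x. centred_cumulant b \<mu> (?\<zeta> * f x) \<partial>\<nu>"
  have "cmod ?W \<le> v / 2 * (\<integral>x. (?\<zeta> * f x)\<^sup>2 \<partial>\<nu>)"
    using f2 by (intro integrable_centred_cumulant(2)) (auto simp: power_mult_distrib power_divide simp del: of_nat_Suc)
  also have "(\<integral>x. (?\<zeta> * f x)\<^sup>2 \<partial>\<nu>) = ?F / (real (Suc n))\<^sup>2"
    by (simp add: power_mult_distrib power_divide del: of_nat_Suc)
  finally have W: "cmod ?W \<le> v / 2 * (?F / (real (Suc n))\<^sup>2)" .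
  have "(cmod (char (distr M borel Y) ?\<zeta>))\<^sup>2 = exp (2 * Re ?W)"
    by (simp add: \<phi> norm_mult exp_double del: of_nat_Suc)
  also have "\<dots> \<ge> 1 + 2 * Re ?W" by (rule exp_ge_add_one_self)
  finally have "1 - (cmod (char (distr M borel Y) ?\<zeta>))\<^sup>2 \<le> 2 * cmod ?W"
    using abs_Re_le_cmod[of ?W] by linarith
  also have "\<dots> \<le> v * ?F / (real (Suc n))\<^sup>2" using W by simp
  finally show "1 - (cmod (char (distr M borel Y) ?\<zeta>))\<^sup>2 \<le> v * ?F / (real (Suc n))\<^sup>2" .
qed

text \<open>The leftover factor \<phi> is multiplicative of modulus one, and both the characteristic
  function of the centred \<open>Y\<close> and the exponential of the cumulant integral are 1 +
  O(\<zeta>^2). Since \<phi> \<zeta> is the n-th power of \<phi> (\<zeta> / n), its distance to 1 is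
  O(1 / n).\<close>

theorem stoch_integral_char_centred:
  assumes has: "has_stoch_integral M \<nu> \<Lambda> f Y" and f2: "integrable \<nu> (\<lambda>x. (f x)\<^sup>2)"
    and mean: "(\<integral>\<omega>. Y \<omega> \<partial>M) = 0"
  shows "char (distr M borel Y) \<zeta> = exp (\<integral>x. centred_cumulant b \<mu> (\<zeta> * f x) \<partial>\<nu>)"
proof -
  have [measurable]: "f \<in> borel_measurable \<nu>" "Y \<in> borel_measurable M"
    using has_stoch_integral_measurable[OF has] .
  have Y2: "integrable M (\<lambda>\<omega>. (Y \<omega>)\<^sup>2)" by (rule stoch_integral_square_integrable[OF has f2])
  have Y1: "integrable M Y" by (rule square_integrable_imp_integrable[OF _ Y2]) measurable
  obtain \<phi> where \<phi>: "\<And>\<zeta>. char (distr M borel Y) \<zeta> = exp (\<integral>x. centred_cumulant b \<mu> (\<zeta> * f x) \<partial>\<nu>) * \<phi> \<zeta>"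
    "\<And>\<zeta>. cmod (\<phi> \<zeta>) = 1" "\<And>s t. \<phi> (s + t) = \<phi> s * \<phi> t"
    using stoch_integral_char_L2[OF has f2] by metis
  define W where "W \<zeta> = (\<integral>x. centred_cumulant b \<mu> (\<zeta> * f x) \<partial>\<nu>)" for \<zeta>
  let ?F = "\<integral>x. (f x)\<^sup>2 \<partial>\<nu>" and ?s = "\<integral>\<omega>. (Y \<omega>)\<^sup>2 \<partial>M"
  have F0: "0 \<le> ?F" "0 \<le> ?s" by (auto intro: integral_nonneg_AE)
  have W: "cmod (W \<zeta>) \<le> v / 2 * ?F * \<zeta>\<^sup>2" for \<zeta>
  proof -
    have "cmod (W \<zeta>) \<le> v / 2 * (\<integral>x. (\<zeta> * f x)\<^sup>2 \<partial>\<nu>)"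
      unfolding W_def using f2 by (intro integrable_centred_cumulant(2)) (auto simp: power_mult_distrib)
    then show ?thesis by (simp add: power_mult_distrib mult_ac)
  qed
  \<comment> \<open>Zero mean enters here: the linear Taylor term integrates to 0, which leaves a
    bound quadratic in \<zeta>.\<close>
  have C: "cmod (char (distr M borel Y) \<zeta> - 1) \<le> ?s / 2 * \<zeta>\<^sup>2" for \<zeta>
  proof -
    let ?g = "\<lambda>\<omega>. iexp (\<zeta> * Y \<omega>) - 1 - \<i> * of_real \<zeta> * of_real (Y \<omega>)"
    have i1: "integrable M (\<lambda>\<omega>. iexp (\<zeta> * Y \<omega>))" by (rule integrable_iexp) auto
    have i2: "integrable M (\<lambda>\<omega>. \<i> * of_real \<zeta> * complex_of_real (Y \<omega>))"
      by (intro integrable_mult_right integrable_of_real Y1)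
    have "(\<integral>\<omega>. ?g \<omega> \<partial>M) = (\<integral>\<omega>. iexp (\<zeta> * Y \<omega>) - 1 \<partial>M) - (\<integral>\<omega>. \<i> * of_real \<zeta> * complex_of_real (Y \<omega>) \<partial>M)"
      by (rule Bochner_Integration.integral_diff) (use i1 i2 in auto)
    also have "(\<integral>\<omega>. \<i> * of_real \<zeta> * complex_of_real (Y \<omega>) \<partial>M) = 0"
      unfolding integral_mult_right_zero integral_complex_of_real mean by simp
    also have "(\<integral>\<omega>. iexp (\<zeta> * Y \<omega>) - 1 \<partial>M) = char (distr M borel Y) \<zeta> - 1"
      using i1 by (subst Bochner_Integration.integral_diff) (auto simp: char_distr prob_space simp del: of_real_mult)
    finally have "cmod (char (distr M borel Y) \<zeta> - 1) = cmod (\<integral>\<omega>. ?g \<omega> \<partial>M)" by simp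
    also have "\<dots> \<le> (\<integral>\<omega>. cmod (?g \<omega>) \<partial>M)" by (rule integral_norm_bound)
    also have "\<dots> \<le> (\<integral>\<omega>. \<zeta>\<^sup>2 / 2 * (Y \<omega>)\<^sup>2 \<partial>M)"
    proof (rule integral_mono)
      show "integrable M (\<lambda>\<omega>. cmod (?g \<omega>))"
        by (intro integrable_norm Bochner_Integration.integrable_diff i1 i2) simp
      show "cmod (?g \<omega>) \<le> \<zeta>\<^sup>2 / 2 * (Y \<omega>)\<^sup>2" for \<omega>
        using iexp_diff_linear_le[of "\<zeta> * Y \<omega>"] by (simp add: power_mult_distrib mult.assoc)
    qed (use Y2 in auto)
    also have "\<dots> = ?s / 2 * \<zeta>\<^sup>2" by simp
    finally show ?thesis .
  qed
  have \<phi>_eq: "\<phi> \<zeta> = char (distr M borel Y) \<zeta> * exp (- W \<zeta>)" for \<zeta>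
    by (simp add: \<phi>(1) W_def exp_minus field_simps)
  have \<phi>_pow: "\<phi> (real n * \<zeta>) = \<phi> \<zeta> ^ n" for n \<zeta>
  proof (induction n)
    case 0
    have "\<phi> 0 * (\<phi> 0 - 1) = 0" using \<phi>(3)[of 0 0] by (simp add: algebra_simps)
    then show ?case using \<phi>(2)[of 0] by auto
  next
    case (Suc n)
    then show ?case using \<phi>(3)[of \<zeta> "real n * \<zeta>"] by (simp add: algebra_simps)
  qed
  have "\<phi> \<zeta> = 1"
  proof -
    let ?w = "v / 2 * ?F * \<zeta>\<^sup>2"
    \<comment> \<open>The coefficient of 1 / n^2 in the bound for \<phi> (\<zeta> / n) - 1. The
      first summand comes from the characteristic function, the second from exp (- W), and
      \<open>exp ?w\<close> bounds the exponential factor in each.\<close>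
    let ?K = "?s / 2 * \<zeta>\<^sup>2 * exp ?w + exp ?w * ?w"
    have w0: "0 \<le> ?w" using v_nonneg F0 by (intro mult_nonneg_nonneg) auto
    have bound: "cmod (\<phi> \<zeta> - 1) \<le> ?K / real (Suc n)" for n
    proof -
      let ?z = "\<zeta> / real (Suc n)"
      have z2: "?z\<^sup>2 = \<zeta>\<^sup>2 / (real (Suc n))\<^sup>2" by (simp add: power_divide del: of_nat_Suc)
      have Wn: "cmod (- W ?z) \<le> ?w / (real (Suc n))\<^sup>2" using W[of ?z] unfolding z2 by simp
      also have "\<dots> \<le> ?w / 1" using w0 by (intro divide_left_mono) auto
      finally have Wn': "cmod (- W ?z) \<le> ?w" by simp
      have "\<phi> ?z - 1 = (char (distr M borel Y) ?z - 1) * exp (- W ?z) + (exp (- W ?z) - 1)"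
        by (simp add: \<phi>_eq algebra_simps del: of_nat_Suc)
      then have "cmod (\<phi> ?z - 1) \<le> cmod (char (distr M borel Y) ?z - 1) * cmod (exp (- W ?z)) + cmod (exp (- W ?z) - 1)"
        by (metis norm_mult norm_triangle_ineq)
      also have "\<dots> \<le> ?s / 2 * ?z\<^sup>2 * exp ?w + exp ?w * (?w / (real (Suc n))\<^sup>2)"
      proof (rule add_mono)
        have "cmod (exp (- W ?z)) \<le> exp (cmod (- W ?z))" by (rule norm_exp)
        also have "\<dots> \<le> exp ?w" using Wn' by (simp only: exp_le_cancel_iff)
        finally have "cmod (exp (- W ?z)) \<le> exp ?w" .
        then show "cmod (char (distr M borel Y) ?z - 1) * cmod (exp (- W ?z)) \<le> ?s / 2 * ?z\<^sup>2 * exp ?w"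
          using F0 by (intro mult_mono C) auto
        show "cmod (exp (- W ?z) - 1) \<le> exp ?w * (?w / (real (Suc n))\<^sup>2)"
        proof (rule order_trans[OF exp_diff_1_le mult_mono])
          show "exp (cmod (- W ?z)) \<le> exp ?w" using Wn' by (simp only: exp_le_cancel_iff)
        qed (use Wn in auto)
      qed
      also have "\<dots> = ?K / (real (Suc n))\<^sup>2" unfolding z2 by (simp add: add_divide_distrib del: of_nat_Suc)
      finally have 1: "cmod (\<phi> ?z - 1) \<le> ?K / (real (Suc n))\<^sup>2" .
      have "\<phi> \<zeta> = \<phi> ?z ^ Suc n" using \<phi>_pow[of "Suc n" ?z] by (simp del: of_nat_Suc power_Suc)
      then have "cmod (\<phi> \<zeta> - 1) = cmod (\<phi> ?z ^ Suc n - 1 ^ Suc n)" by (simp del: of_nat_Suc power_Suc)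
      also have "\<dots> \<le> real (Suc n) * cmod (\<phi> ?z - 1)"
        by (rule norm_power_diff) (simp_all add: \<phi>(2) del: of_nat_Suc)
      also have "\<dots> \<le> real (Suc n) * (?K / (real (Suc n))\<^sup>2)" by (intro mult_left_mono 1) simp
      also have "\<dots> = ?K / real (Suc n)" by (simp add: power2_eq_square del: of_nat_Suc)
      finally show ?thesis .
    qed
    have tl: "(\<lambda>n. ?K / real (Suc n)) \<longlonglongrightarrow> 0"
      unfolding divide_inverse by (rule tendsto_mult_right_zero[OF LIMSEQ_inverse_real_of_nat])
    have "cmod (\<phi> \<zeta> - 1) \<le> 0"
      by (rule LIMSEQ_le_const[OF tl]) (use bound in blast)
    then show ?thesis by simp
  qed
  then show ?thesis using \<phi>(1)[of \<zeta>] by simp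
qed

text \<open>Second-order terms are compared at \<zeta> = 1 / n: the mean of 2 n^2 (1 - cos (Y / n))
  tends to the second moment of \<open>Y\<close>, while n^2 (exp W - 1) has the same limit as n^2 W,
  namely - v / 2 times the squared norm of f.\<close>

theorem stoch_integral_isometry:
  assumes has: "has_stoch_integral M \<nu> \<Lambda> f Y" and f2: "integrable \<nu> (\<lambda>x. (f x)\<^sup>2)"
    and mean: "(\<integral>\<omega>. Y \<omega> \<partial>M) = 0"
  shows "(\<integral>\<omega>. (Y \<omega>)\<^sup>2 \<partial>M) = v * (\<integral>x. (f x)\<^sup>2 \<partial>\<nu>)"
proof -
  have [measurable]: "f \<in> borel_measurable \<nu>" "Y \<in> borel_measurable M"
    using has_stoch_integral_measurable[OF has] .
  have Y2: "integrable M (\<lambda>\<omega>. (Y \<omega>)\<^sup>2)" by (rule stoch_integral_square_integrable[OF has f2])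
  let ?k = "centred_cumulant b \<mu>" and ?F = "\<integral>x. (f x)\<^sup>2 \<partial>\<nu>"
  define W where "W n = (\<integral>x. ?k (1 / real (Suc n) * f x) \<partial>\<nu>)" for n
  have r: "(\<lambda>n. 1 / real (Suc n)) \<longlonglongrightarrow> 0" using LIMSEQ_inverse_real_of_nat by (simp add: inverse_eq_divide)
  have W2: "(\<lambda>n. of_real ((real (Suc n))\<^sup>2) * W n) \<longlonglongrightarrow> of_real (- v / 2 * ?F)"
  proof -
    have "(\<lambda>n. \<integral>x. ?k (f x * (1 / real (Suc n))) / of_real ((1 / real (Suc n))\<^sup>2) \<partial>\<nu>) \<longlonglongrightarrow> (\<integral>x. of_real (- v / 2 * (f x)\<^sup>2) \<partial>\<nu>)"
    proof (rule integral_dominated_convergence[where w="\<lambda>x. v / 2 * (f x)\<^sup>2"])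
      show "AE x in \<nu>. (\<lambda>n. ?k (f x * (1 / real (Suc n))) / of_real ((1 / real (Suc n))\<^sup>2)) \<longlonglongrightarrow> of_real (- v / 2 * (f x)\<^sup>2)"
        by (intro AE_I2 centred_cumulant_scaled tendsto_const r) auto
      show "AE x in \<nu>. cmod (?k (f x * (1 / real (Suc n))) / of_real ((1 / real (Suc n))\<^sup>2)) \<le> v / 2 * (f x)\<^sup>2" for n
      proof (rule AE_I2)
        fix x
        have "cmod (?k (f x * (1 / real (Suc n)))) \<le> v / 2 * (f x * (1 / real (Suc n)))\<^sup>2"
          by (rule norm_centred_cumulant_le)
        then have "cmod (?k (f x * (1 / real (Suc n)))) / (1 / real (Suc n))\<^sup>2
            \<le> v / 2 * (f x * (1 / real (Suc n)))\<^sup>2 / (1 / real (Suc n))\<^sup>2"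
          by (rule divide_right_mono) simp
        also have "\<dots> = v / 2 * (f x)\<^sup>2" by (simp add: power_mult_distrib power_divide del: of_nat_Suc)
        finally show "cmod (?k (f x * (1 / real (Suc n))) / of_real ((1 / real (Suc n))\<^sup>2)) \<le> v / 2 * (f x)\<^sup>2"
          by (simp only: norm_divide norm_of_real abs_power2)
      qed
      show "integrable \<nu> (\<lambda>x. v / 2 * (f x)\<^sup>2)" by (intro integrable_mult_right f2)
    qed measurable
    moreover have "(\<integral>x. ?k (f x * (1 / real (Suc n))) / of_real ((1 / real (Suc n))\<^sup>2) \<partial>\<nu>) = of_real ((real (Suc n))\<^sup>2) * W n" for n
      unfolding W_def integral_divide_zero by (simp add: power_divide mult.commute del: of_nat_Suc)
    ultimately show ?thesis
      unfolding integral_complex_of_real integral_mult_right_zero by simp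
  qed
  have W0: "W \<longlonglongrightarrow> 0"
  proof -
    have "(\<lambda>n. of_real ((1 / real (Suc n))\<^sup>2) * (of_real ((real (Suc n))\<^sup>2) * W n)) \<longlonglongrightarrow> of_real (0\<^sup>2) * of_real (- v / 2 * ?F)"
      by (intro tendsto_mult tendsto_of_real tendsto_power r W2)
    then show ?thesis by (simp add: power_divide del: of_nat_Suc)
  qed
  have E: "(\<lambda>n. of_real ((real (Suc n))\<^sup>2) * (exp (W n) - 1)) \<longlonglongrightarrow> of_real (- v / 2 * ?F)"
  proof -
    \<comment> \<open>n^2 W n is convergent and W n tends to 0, so the quadratic remainder of the
      exponential is negligible at the scale n^2.\<close>
    have nb: "\<forall>n. cmod (of_real ((real (Suc n))\<^sup>2) * (exp (W n) - 1 - W n))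
        \<le> cmod (of_real ((real (Suc n))\<^sup>2) * W n) * (exp (cmod (W n)) * cmod (W n))"
    proof
      fix n
      have "cmod (exp (W n) - 1 - W n) \<le> cmod (W n) * (exp (cmod (W n)) * cmod (W n))"
        using exp_diff_linear_le[of "W n"] by (simp add: power2_eq_square mult_ac)
      then show "cmod (of_real ((real (Suc n))\<^sup>2) * (exp (W n) - 1 - W n))
        \<le> cmod (of_real ((real (Suc n))\<^sup>2) * W n) * (exp (cmod (W n)) * cmod (W n))"
        unfolding norm_mult mult.assoc by (intro mult_left_mono) auto
    qed
    have "(\<lambda>n. cmod (of_real ((real (Suc n))\<^sup>2) * W n) * (exp (cmod (W n)) * cmod (W n)))
        \<longlonglongrightarrow> cmod (of_real (- v / 2 * ?F)) * (exp (cmod 0) * cmod 0)"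
      by (intro tendsto_mult tendsto_norm tendsto_exp W2 W0)
    then have l0: "(\<lambda>n. cmod (of_real ((real (Suc n))\<^sup>2) * W n) * (exp (cmod (W n)) * cmod (W n))) \<longlonglongrightarrow> 0"
      by simp
    have "(\<lambda>n. of_real ((real (Suc n))\<^sup>2) * (exp (W n) - 1 - W n)) \<longlonglongrightarrow> 0"
      by (rule Lim_null_comparison[OF always_eventually[OF nb] l0])
    from tendsto_add[OF this W2] show ?thesis by (simp add: algebra_simps del: of_nat_Suc)
  qed
  have ch: "char (distr M borel Y) (1 / real (Suc n)) = exp (W n)" for n
    unfolding W_def by (rule stoch_integral_char_centred[OF has f2 mean])
  have "(\<lambda>n. \<integral>\<omega>. 2 * (real (Suc n))\<^sup>2 * (1 - cos (Y \<omega> / real (Suc n))) \<partial>M) \<longlonglongrightarrow> (\<integral>\<omega>. (Y \<omega>)\<^sup>2 \<partial>M)"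
  proof (rule integral_dominated_convergence[where w="\<lambda>\<omega>. (Y \<omega>)\<^sup>2"])
    show "AE \<omega> in M. (\<lambda>n. 2 * (real (Suc n))\<^sup>2 * (1 - cos (Y \<omega> / real (Suc n)))) \<longlonglongrightarrow> (Y \<omega>)\<^sup>2"
      by (intro AE_I2 one_minus_cos_scaled_tendsto)
    show "AE \<omega> in M. norm (2 * (real (Suc n))\<^sup>2 * (1 - cos (Y \<omega> / real (Suc n)))) \<le> (Y \<omega>)\<^sup>2" for n
    proof (rule AE_I2)
      fix \<omega>
      have "2 * (real (Suc n))\<^sup>2 * (1 - cos (Y \<omega> / real (Suc n))) \<le> 2 * (real (Suc n))\<^sup>2 * ((Y \<omega> / real (Suc n))\<^sup>2 / 2)"
        by (intro mult_left_mono one_minus_cos_le) auto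
      also have "\<dots> = (Y \<omega>)\<^sup>2" by (simp add: power_divide del: of_nat_Suc)
      finally show "norm (2 * (real (Suc n))\<^sup>2 * (1 - cos (Y \<omega> / real (Suc n)))) \<le> (Y \<omega>)\<^sup>2" by (simp del: of_nat_Suc)
    qed
  qed (use Y2 in auto)
  moreover have "(\<integral>\<omega>. 2 * (real (Suc n))\<^sup>2 * (1 - cos (Y \<omega> / real (Suc n))) \<partial>M)
      = - 2 * Re (of_real ((real (Suc n))\<^sup>2) * (exp (W n) - 1))" for n
  proof -
    have c: "integrable M (\<lambda>\<omega>. cos (Y \<omega> / real (Suc n)))"
      by (rule integrable_const_bound[where B=1]) auto
    have "Re (exp (W n)) = (\<integral>\<omega>. cos (Y \<omega> / real (Suc n)) \<partial>M)"
      by (simp add: ch[symmetric] char_distr integrable_iexp Re_exp del: of_real_mult of_real_divide of_nat_Suc flip: integral_Re)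
    then show ?thesis
      using c by (simp add: prob_space algebra_simps del: of_nat_Suc of_real_power)
  qed
  ultimately have "(\<lambda>n. - 2 * Re (of_real ((real (Suc n))\<^sup>2) * (exp (W n) - 1))) \<longlonglongrightarrow> (\<integral>\<omega>. (Y \<omega>)\<^sup>2 \<partial>M)"
    by (simp only:)
  moreover have "(\<lambda>n. - 2 * Re (of_real ((real (Suc n))\<^sup>2) * (exp (W n) - 1))) \<longlonglongrightarrow> - 2 * Re (of_real (- v / 2 * ?F))"
    by (intro tendsto_mult tendsto_const tendsto_Re E)
  ultimately have "(\<integral>\<omega>. (Y \<omega>)\<^sup>2 \<partial>M) = - 2 * Re (of_real (- v / 2 * ?F))" by (rule LIMSEQ_unique)
  then show ?thesis by simp
qed

end

section \<open>Time integrals in mean square\<close>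

lemma nn_integral_abs_square_le:
  fixes h :: "'a \<Rightarrow> real"
  assumes [measurable]: "h \<in> borel_measurable N"
  shows "(\<integral>\<^sup>+x. ennreal \<bar>h x\<bar> \<partial>N)\<^sup>2 \<le> (\<integral>\<^sup>+x. ennreal ((h x)\<^sup>2) \<partial>N) * emeasure N (space N)"
  using Cauchy_Schwarz_nn_integral[of "\<lambda>x. ennreal \<bar>h x\<bar>" N "\<lambda>_. 1"]
  by (simp add: ennreal_power)

text \<open>Cauchy-Schwarz against the constant 1; for a nonintegrable function the integral is 0 by
  convention and the bound is trivial.\<close>

lemma integral_square_le:
  fixes h :: "'a \<Rightarrow> real"
  assumes [measurable]: "h \<in> borel_measurable N"
  shows "ennreal ((\<integral>x. h x \<partial>N)\<^sup>2) \<le> (\<integral>\<^sup>+x. ennreal ((h x)\<^sup>2) \<partial>N) * emeasure N (space N)"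
proof (cases "integrable N h")
  case True
  have "ennreal ((\<integral>x. h x \<partial>N)\<^sup>2) = (ennreal \<bar>\<integral>x. h x \<partial>N\<bar>)\<^sup>2" by (simp add: ennreal_power)
  also have "\<dots> \<le> (\<integral>\<^sup>+x. ennreal \<bar>h x\<bar> \<partial>N)\<^sup>2"
    using integral_norm_bound_ennreal[OF True] by (intro power_mono) auto
  also have "\<dots> \<le> (\<integral>\<^sup>+x. ennreal ((h x)\<^sup>2) \<partial>N) * emeasure N (space N)"
    by (rule nn_integral_abs_square_le) measurable
  finally show ?thesis .
qed (simp add: not_integrable_integral_eq)

lemma integrable_nn_square:
  fixes h :: "'a \<Rightarrow> real"
  assumes "h \<in> borel_measurable N"
  shows "integrable N (\<lambda>x. (h x)\<^sup>2) \<longleftrightarrow> (\<integral>\<^sup>+x. ennreal ((h x)\<^sup>2) \<partial>N) < \<infinity>"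
  using assms by (simp add: integrable_iff_bounded)

lemma tendsto_0_ennrealI:
  fixes F :: "nat \<Rightarrow> ennreal"
  assumes "\<And>\<epsilon>. 0 < \<epsilon> \<Longrightarrow> \<forall>\<^sub>F n in sequentially. F n \<le> ennreal \<epsilon>"
  shows "F \<longlonglongrightarrow> 0"
proof (rule order_tendstoI)
  fix a :: ennreal assume "0 < a"
  then obtain c where c: "0 < c" "c < a" using dense by blast
  then obtain r where r: "c = ennreal r" "0 \<le> r" by (cases c) auto
  then have "0 < r" using c(1) by auto
  show "\<forall>\<^sub>F n in sequentially. F n < a"
    using assms[OF \<open>0 < r\<close>] by eventually_elim (use c(2) r(1) in auto)
qed simp

text \<open>A density instead of a restricted space: the measure is finite but still lives on all
  reals, so Borel measurability carries over unchanged.\<close>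

definition interval_measure_on :: "real \<Rightarrow> real measure" where
  "interval_measure_on \<tau> = density lborel (\<lambda>u. ennreal (indicator {0..\<tau>} u))"

lemma sets_interval_measure_on [simp, measurable_cong]: "sets (interval_measure_on \<tau>) = sets borel"
  and space_interval_measure_on [simp]: "space (interval_measure_on \<tau>) = UNIV"
  by (simp_all add: interval_measure_on_def)

lemma emeasure_interval_measure_on:
  assumes "A \<in> sets borel"
  shows "emeasure (interval_measure_on \<tau>) A = emeasure lborel ({0..\<tau>} \<inter> A)"
proof -
  have "emeasure (interval_measure_on \<tau>) A = (\<integral>\<^sup>+u. ennreal (indicator {0..\<tau>} u) * indicator A u \<partial>lborel)"
    unfolding interval_measure_on_def using assms by (intro emeasure_density) auto
  also have "\<dots> = (\<integral>\<^sup>+u. indicator ({0..\<tau>} \<inter> A) u \<partial>lborel)"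
    by (intro nn_integral_cong) (auto simp: indicator_def)
  also have "\<dots> = emeasure lborel ({0..\<tau>} \<inter> A)" using assms by (intro nn_integral_indicator) auto
  finally show ?thesis .
qed

lemma integral_interval_measure_on:
  fixes h :: "real \<Rightarrow> real"
  assumes "h \<in> borel_measurable borel"
  shows "(LBINT u:{0..\<tau>}. h u) = (\<integral>u. h u \<partial>interval_measure_on \<tau>)"
  unfolding set_lebesgue_integral_def interval_measure_on_def
  using assms by (subst integral_density) auto

lemma finite_measure_interval_measure_on: "finite_measure (interval_measure_on \<tau>)"
  by (rule finite_measureI) (simp add: emeasure_interval_measure_on emeasure_lborel_Icc_eq)

lemma AE_interval_measure_on: "AE u in interval_measure_on \<tau>. 0 \<le> u \<and> u < \<tau>"
proof -
  have "AE u in lborel. u \<noteq> \<tau>" by (rule AE_lborel_singleton)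
  then show ?thesis
    unfolding interval_measure_on_def by (subst AE_density) (auto simp: indicator_def elim!: eventually_mono)
qed

text \<open>Left endpoints of Suc n equal cells, for an arbitrary family g: the sum for the process
  is the stochastic integral of the same sum for the kernels.\<close>

definition riemann :: "(real \<Rightarrow> 'a \<Rightarrow> real) \<Rightarrow> real \<Rightarrow> nat \<Rightarrow> 'a \<Rightarrow> real" where
  "riemann g \<tau> n x = (\<Sum>i<Suc n. \<tau> / real (Suc n) * g (\<tau> * real i / real (Suc n)) x)"

text \<open>Covers two situations at once: \<open>m\<close> the probability measure with g the
  process, and \<open>m\<close> the intensity measure with g the kernel. The bound and the modulus
  of continuity are uniform over the whole time line.\<close>

locale L2_continuous_process = sigma_finite_measure m for m :: "'a measure" +
  fixes g :: "real \<Rightarrow> 'a \<Rightarrow> real" and C :: real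
  assumes meas: "(\<lambda>(u, x). g u x) \<in> borel_measurable (borel \<Otimes>\<^sub>M m)"
    and bounded_L2: "\<And>u. (\<integral>\<^sup>+x. ennreal ((g u x)\<^sup>2) \<partial>m) \<le> ennreal C"
    and continuous_L2: "\<And>\<epsilon>. 0 < \<epsilon> \<Longrightarrow> \<exists>\<delta>>0. \<forall>u w. \<bar>u - w\<bar> < \<delta> \<longrightarrow> (\<integral>\<^sup>+x. ennreal ((g u x - g w x)\<^sup>2) \<partial>m) \<le> ennreal \<epsilon>"
begin

lemma measurable_section [measurable]: "g u \<in> borel_measurable m"
  and measurable_path: "x \<in> space m \<Longrightarrow> (\<lambda>u. g u x) \<in> borel_measurable borel"
  using measurable_compose[OF measurable_Pair1' meas, of u] measurable_compose[OF measurable_Pair2' meas, of x]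
  by simp_all

lemma measurable_joint: "(\<lambda>(u, x). g u x) \<in> borel_measurable (interval_measure_on \<tau> \<Otimes>\<^sub>M m)"
  using meas by (simp cong: measurable_cong_sets sets_pair_measure_cong)

lemma measurable_time_integral [measurable]: "(\<lambda>x. LBINT u:{0..\<tau>}. g u x) \<in> borel_measurable m"
proof -
  have "(\<lambda>p. indicator {0..\<tau>} (fst p) *\<^sub>R (case p of (u, x) \<Rightarrow> g u x)) \<in> borel_measurable (borel \<Otimes>\<^sub>M m)"
    using meas by measurable
  then have [measurable]: "(\<lambda>p. indicator {0..\<tau>} (fst p) *\<^sub>R (case p of (u, x) \<Rightarrow> g u x)) \<in> borel_measurable (lborel \<Otimes>\<^sub>M m)"
    by (simp cong: measurable_cong_sets sets_pair_measure_cong)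
  have "(\<lambda>(x, u). indicator {0..\<tau>} u *\<^sub>R g u x) \<in> borel_measurable (m \<Otimes>\<^sub>M lborel)"
    using measurable_compose[OF measurable_pair_swap' \<open>_ \<in> borel_measurable (lborel \<Otimes>\<^sub>M m)\<close>]
    by (simp add: case_prod_beta)
  then show ?thesis
    unfolding set_lebesgue_integral_def by (rule sigma_finite_measure.borel_measurable_lebesgue_integral[OF sigma_finite_lborel])
qed

lemma AE_integrable_path:
  assumes "0 \<le> \<tau>"
  shows "AE x in m. integrable (interval_measure_on \<tau>) (\<lambda>u. g u x)"
proof -
  interpret N: finite_measure "interval_measure_on \<tau>" by (rule finite_measure_interval_measure_on)
  interpret P: pair_sigma_finite "interval_measure_on \<tau>" m ..
  have jm[measurable]: "(\<lambda>(u, x). g u x) \<in> borel_measurable (interval_measure_on \<tau> \<Otimes>\<^sub>M m)"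
    by (rule measurable_joint)
  have cm: "(\<lambda>(u, x). ennreal ((g u x)\<^sup>2)) \<in> borel_measurable (interval_measure_on \<tau> \<Otimes>\<^sub>M m)"
    by measurable
  have "(\<integral>\<^sup>+x. (\<integral>\<^sup>+u. ennreal ((g u x)\<^sup>2) \<partial>interval_measure_on \<tau>) \<partial>m)
      = (\<integral>\<^sup>+u. (\<integral>\<^sup>+x. ennreal ((g u x)\<^sup>2) \<partial>m) \<partial>interval_measure_on \<tau>)"
    by (rule P.Fubini'[OF cm])
  also have "\<dots> \<le> (\<integral>\<^sup>+u. ennreal C \<partial>interval_measure_on \<tau>)"
    by (intro nn_integral_mono bounded_L2)
  also have "\<dots> < \<infinity>"
    by (simp add: emeasure_interval_measure_on assms ennreal_mult_less_top)
  finally have fin: "(\<integral>\<^sup>+x. (\<integral>\<^sup>+u. ennreal ((g u x)\<^sup>2) \<partial>interval_measure_on \<tau>) \<partial>m) \<noteq> \<infinity>" by simp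
  have mm: "(\<lambda>x. \<integral>\<^sup>+u. ennreal ((g u x)\<^sup>2) \<partial>interval_measure_on \<tau>) \<in> borel_measurable m"
    using N.borel_measurable_nn_integral_fst[OF measurable_pair_swap[OF cm]] by simp
  have "AE x in m. (\<integral>\<^sup>+u. ennreal ((g u x)\<^sup>2) \<partial>interval_measure_on \<tau>) \<noteq> \<infinity>"
    by (rule nn_integral_noteq_infinite[OF mm fin])
  then show ?thesis
    using AE_space
  proof eventually_elim
    case (elim x)
    have pm: "(\<lambda>u. g u x) \<in> borel_measurable (interval_measure_on \<tau>)"
      using measurable_path[OF elim(2)] by (simp add: interval_measure_on_def)
    have "(\<integral>\<^sup>+u. ennreal ((g u x)\<^sup>2) \<partial>interval_measure_on \<tau>) < \<infinity>"
      using elim(1) by (metis infinity_ennreal_def less_top)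
    then have "integrable (interval_measure_on \<tau>) (\<lambda>u. (g u x)\<^sup>2)"
      by (simp only: integrable_nn_square[OF pm])
    then show ?case by (rule N.square_integrable_imp_integrable[OF pm])
  qed
qed

text \<open>The Riemann sum is the exact time integral of the step process \<open>G\<close>, whose
  value at u is that of g at most one cell earlier. Cauchy-Schwarz in time costs a factor \<tau>,
  and after exchanging the integrals the remaining time integral is at most \<tau> *
  \<epsilon>.\<close>

lemma riemann_sum_L2_bound:
  assumes "0 < \<tau>" and d: "\<And>u w. \<bar>u - w\<bar> < \<delta> \<Longrightarrow> (\<integral>\<^sup>+x. ennreal ((g u x - g w x)\<^sup>2) \<partial>m) \<le> ennreal \<epsilon>"
    and n: "\<tau> / real (Suc n) < \<delta>"
  shows "(\<integral>\<^sup>+x. ennreal (((LBINT u:{0..\<tau>}. g u x) - riemann g \<tau> n x)\<^sup>2) \<partial>m) \<le> ennreal (\<tau>\<^sup>2) * ennreal \<epsilon>"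
proof -
  let ?N = "interval_measure_on \<tau>" and ?t = "\<lambda>i. \<tau> * real i / real (Suc n)"
  interpret N: finite_measure ?N by (rule finite_measure_interval_measure_on)
  interpret P: pair_sigma_finite ?N m ..
  define G where "G u x = (\<Sum>i<Suc n. indicator {?t i..<?t (Suc i)} u * g (?t i) x)" for u x
  have jm[measurable]: "(\<lambda>(u, x). g u x) \<in> borel_measurable (?N \<Otimes>\<^sub>M m)" by (rule measurable_joint)
  have Gm[measurable]: "(\<lambda>(u, x). G u x) \<in> borel_measurable (?N \<Otimes>\<^sub>M m)" unfolding G_def by measurable
  have cm: "(\<lambda>(u, x). ennreal ((g u x - G u x)\<^sup>2)) \<in> borel_measurable (?N \<Otimes>\<^sub>M m)" by measurable
  have t_le: "?t i \<le> ?t j" if "i \<le> j" for i j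
    using that assms(1) by (intro divide_right_mono mult_left_mono) auto
  have cell: "measure ?N {?t i..<?t (Suc i)} = \<tau> / real (Suc n)" if "i < Suc n" for i
  proof -
    have "?t (Suc i) \<le> ?t (Suc n)" "0 \<le> ?t i" using that t_le[of "Suc i" "Suc n"] t_le[of 0 i] by simp_all
    then have "{0..\<tau>} \<inter> {?t i..<?t (Suc i)} = {?t i..<?t (Suc i)}" by auto
    then have "emeasure ?N {?t i..<?t (Suc i)} = ennreal (?t (Suc i) - ?t i)"
      using t_le[of i "Suc i"] by (simp add: emeasure_interval_measure_on)
    moreover have "?t (Suc i) - ?t i = \<tau> / real (Suc n)"
      unfolding diff_divide_distrib[symmetric] right_diff_distrib[symmetric] by simp
    ultimately show ?thesis using assms(1) by (simp add: measure_def)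
  qed
  have G_int: "integrable ?N (\<lambda>u. G u x)" for x
    unfolding G_def by (intro Bochner_Integration.integrable_sum integrable_mult_left) (auto simp: integrable_indicator_iff N.emeasure_eq_measure)
  have G_integral: "(\<integral>u. G u x \<partial>?N) = riemann g \<tau> n x" for x
  proof -
    have "(\<integral>u. G u x \<partial>?N) = (\<Sum>i<Suc n. \<integral>u. indicator {?t i..<?t (Suc i)} u * g (?t i) x \<partial>?N)"
      unfolding G_def by (intro Bochner_Integration.integral_sum integrable_mult_left) (auto simp: integrable_indicator_iff N.emeasure_eq_measure)
    also have "\<dots> = riemann g \<tau> n x"
      unfolding riemann_def by (intro sum.cong refl) (simp add: cell del: of_nat_Suc)
    finally show ?thesis .
  qed
  have "(\<integral>\<^sup>+x. ennreal (((LBINT u:{0..\<tau>}. g u x) - riemann g \<tau> n x)\<^sup>2) \<partial>m)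
      \<le> (\<integral>\<^sup>+x. (\<integral>\<^sup>+u. ennreal ((g u x - G u x)\<^sup>2) \<partial>?N) * ennreal \<tau> \<partial>m)"
  proof (rule nn_integral_mono_AE)
    have "AE x in m. integrable ?N (\<lambda>u. g u x)" using assms(1) by (intro AE_integrable_path) simp
    then show "AE x in m. ennreal (((LBINT u:{0..\<tau>}. g u x) - riemann g \<tau> n x)\<^sup>2)
        \<le> (\<integral>\<^sup>+u. ennreal ((g u x - G u x)\<^sup>2) \<partial>?N) * ennreal \<tau>"
      using AE_space
    proof eventually_elim
      case (elim x)
      have "(LBINT u:{0..\<tau>}. g u x) - riemann g \<tau> n x = (\<integral>u. g u x - G u x \<partial>?N)"
        unfolding integral_interval_measure_on[OF measurable_path[OF elim(2)]] G_integral[symmetric]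
        by (rule Bochner_Integration.integral_diff[symmetric]) (fact elim(1) G_int)+
      moreover have "ennreal ((\<integral>u. g u x - G u x \<partial>?N)\<^sup>2)
          \<le> (\<integral>\<^sup>+u. ennreal ((g u x - G u x)\<^sup>2) \<partial>?N) * emeasure ?N (space ?N)"
        using elim(1) G_int[of x] by (intro integral_square_le) (auto intro: borel_measurable_integrable)
      moreover have "emeasure ?N (space ?N) = ennreal \<tau>"
        using assms(1) by (simp add: emeasure_interval_measure_on)
      ultimately show ?case by simp
    qed
  qed
  also have "\<dots> = (\<integral>\<^sup>+x. (\<integral>\<^sup>+u. ennreal ((g u x - G u x)\<^sup>2) \<partial>?N) \<partial>m) * ennreal \<tau>"
  proof (rule nn_integral_multc)
    show "(\<lambda>x. \<integral>\<^sup>+u. ennreal ((g u x - G u x)\<^sup>2) \<partial>?N) \<in> borel_measurable m"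
      using N.borel_measurable_nn_integral_fst[OF measurable_pair_swap[OF cm]] by simp
  qed
  also have "(\<integral>\<^sup>+x. (\<integral>\<^sup>+u. ennreal ((g u x - G u x)\<^sup>2) \<partial>?N) \<partial>m) = (\<integral>\<^sup>+u. (\<integral>\<^sup>+x. ennreal ((g u x - G u x)\<^sup>2) \<partial>m) \<partial>?N)"
    by (rule P.Fubini'[OF cm])
  also have "\<dots> \<le> (\<integral>\<^sup>+u. ennreal \<epsilon> \<partial>?N)"
  proof (rule nn_integral_mono_AE)
    show "AE u in ?N. (\<integral>\<^sup>+x. ennreal ((g u x - G u x)\<^sup>2) \<partial>m) \<le> ennreal \<epsilon>"
      using AE_interval_measure_on
    proof eventually_elim
      case (elim u)
      \<comment> \<open>The index of the cell containing u; the strict inequality u < \<tau> gives i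
        \<le> n.\<close>
      define i where "i = nat \<lfloor>u * real (Suc n) / \<tau>\<rfloor>"
      have q: "0 \<le> u * real (Suc n) / \<tau>" using elim assms(1) by simp
      have fl: "real (nat \<lfloor>y\<rfloor>) \<le> y" "y < real (nat \<lfloor>y\<rfloor>) + 1" if "0 \<le> y" for y :: real
        using that floor_correct[of y] by simp_all
      have i1: "real i \<le> u * real (Suc n) / \<tau>" "u * real (Suc n) / \<tau> < real i + 1"
        unfolding i_def by (fact fl[OF q])+
      then have i2: "?t i \<le> u" "u < ?t (Suc i)"
        using assms(1) by (simp_all add: field_simps)
      have "real i < real (Suc n)"
      proof -
        have "u * real (Suc n) / \<tau> < \<tau> * real (Suc n) / \<tau>"
          using elim assms(1) by (intro divide_strict_right_mono mult_strict_right_mono) auto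
        then show ?thesis using i1(1) assms(1) by simp
      qed
      then have "i < Suc n" by simp
      have out: "indicator {?t j..<?t (Suc j)} u = (0::real)" if "j \<noteq> i" for j
      proof (cases "j < i")
        case True
        then have "?t (Suc j) \<le> ?t i" by (intro t_le) simp
        then show ?thesis using i2 by simp
      next
        case False
        then have "?t (Suc i) \<le> ?t j" using that by (intro t_le) simp
        then show ?thesis using i2 by simp
      qed
      have "G u x = (\<Sum>j\<in>{i}. indicator {?t j..<?t (Suc j)} u * g (?t j) x)" for x
        unfolding G_def using \<open>i < Suc n\<close> out by (intro sum.mono_neutral_right) auto
      then have "G u x = g (?t i) x" for x using i2 by (simp del: of_nat_Suc)
      moreover have "\<bar>u - ?t i\<bar> < \<delta>"
      proof -
        have "?t (Suc i) - ?t i = \<tau> / real (Suc n)"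
      unfolding diff_divide_distrib[symmetric] right_diff_distrib[symmetric] by simp
        then show ?thesis using i2 n by simp
      qed
      ultimately show ?case using d[of u "?t i"] by simp
    qed
  qed
  also have "\<dots> = ennreal \<epsilon> * ennreal \<tau>"
    using assms(1) by (simp add: emeasure_interval_measure_on)
  finally show ?thesis
    using assms(1) by (simp add: mult_right_mono power2_eq_square ennreal_mult mult_ac)
qed

lemma riemann_sum_tendsto_L2:
  assumes "0 \<le> \<tau>"
  shows "(\<lambda>n. \<integral>\<^sup>+x. ennreal (((LBINT u:{0..\<tau>}. g u x) - riemann g \<tau> n x)\<^sup>2) \<partial>m) \<longlonglongrightarrow> 0"
proof (cases "\<tau> = 0")
  case True
  have "(LBINT u:{0..0}. g u x) = 0" for x
  proof -
    have "AE u in lborel. u \<noteq> (0::real)" by (rule AE_lborel_singleton)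
    then have "AE u in lborel. indicator {0..0} u *\<^sub>R g u x = 0" by eventually_elim (simp add: indicator_def)
    then show ?thesis unfolding set_lebesgue_integral_def by (rule integral_eq_zero_AE)
  qed
  then show ?thesis using True by (simp add: riemann_def)
next
  case False
  then have "0 < \<tau>" using assms by simp
  show ?thesis
  proof (rule tendsto_0_ennrealI)
    fix \<epsilon> :: real assume "0 < \<epsilon>"
    then obtain \<delta> where \<delta>: "0 < \<delta>"
      "\<And>u w. \<bar>u - w\<bar> < \<delta> \<Longrightarrow> (\<integral>\<^sup>+x. ennreal ((g u x - g w x)\<^sup>2) \<partial>m) \<le> ennreal (\<epsilon> / \<tau>\<^sup>2)"
      using continuous_L2[of "\<epsilon> / \<tau>\<^sup>2"] \<open>0 < \<tau>\<close> by auto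
    have "(\<lambda>n. \<tau> / real (Suc n)) \<longlonglongrightarrow> 0"
      unfolding divide_inverse by (rule tendsto_mult_right_zero[OF LIMSEQ_inverse_real_of_nat])
    then have "\<forall>\<^sub>F n in sequentially. \<tau> / real (Suc n) < \<delta>" using \<delta>(1) by (rule order_tendstoD(2))
    then show "\<forall>\<^sub>F n in sequentially. (\<integral>\<^sup>+x. ennreal (((LBINT u:{0..\<tau>}. g u x) - riemann g \<tau> n x)\<^sup>2) \<partial>m) \<le> ennreal \<epsilon>"
    proof eventually_elim
      case (elim n)
      from riemann_sum_L2_bound[OF \<open>0 < \<tau>\<close> \<delta>(2) elim]
      show ?case using \<open>0 < \<tau>\<close> \<open>0 < \<epsilon>\<close> by (simp flip: ennreal_mult)
    qed
  qed
qed

end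

lemma ennreal_square_tendsto_0:
  fixes P :: "nat \<Rightarrow> ennreal"
  assumes "(\<lambda>n. (P n)\<^sup>2) \<longlonglongrightarrow> 0"
  shows "P \<longlonglongrightarrow> 0"
proof (rule tendsto_0_ennrealI)
  fix \<epsilon> :: real assume "0 < \<epsilon>"
  then have "0 < (ennreal \<epsilon>)\<^sup>2" by (simp add: ennreal_power)
  from order_tendstoD(2)[OF assms this]
  show "\<forall>\<^sub>F n in sequentially. P n \<le> ennreal \<epsilon>"
  proof eventually_elim
    case (elim n)
    show ?case
    proof (rule ccontr)
      assume "\<not> P n \<le> ennreal \<epsilon>"
      then have "(ennreal \<epsilon>)\<^sup>2 \<le> (P n)\<^sup>2" by (intro power_mono) auto
      then show False using elim by simp
    qed
  qed
qed

lemma tendsto_if_ennreal_norm_le: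
  fixes z :: "nat \<Rightarrow> 'a::real_normed_vector"
  assumes "\<And>n. ennreal (norm (z n - l)) \<le> P n" "P \<longlonglongrightarrow> 0"
  shows "z \<longlonglongrightarrow> l"
proof -
  have "(\<lambda>n. ennreal (norm (z n - l))) \<longlonglongrightarrow> 0"
    by (rule tendsto_sandwich[OF _ _ tendsto_const assms(2)]) (use assms(1) in \<open>auto intro: always_eventually\<close>)
  then have "(\<lambda>n. norm (z n - l)) \<longlonglongrightarrow> 0" by (subst (asm) ennreal_tendsto_0_iff) auto
  then show ?thesis by (intro LIM_zero_cancel[of z l]) (rule tendsto_norm_zero_cancel)
qed

lemma integrable_square_sum:
  fixes h :: "'k \<Rightarrow> 'a \<Rightarrow> real"
  assumes [measurable]: "\<And>k. k \<in> K \<Longrightarrow> h k \<in> borel_measurable N"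
    and h: "\<And>k. k \<in> K \<Longrightarrow> integrable N (\<lambda>x. (h k x)\<^sup>2)"
  shows "integrable N (\<lambda>x. (\<Sum>k\<in>K. c k * h k x)\<^sup>2)"
proof (rule Bochner_Integration.integrable_bound)
  show "integrable N (\<lambda>x. (\<Sum>k\<in>K. (c k)\<^sup>2 * (h k x)\<^sup>2) * real (card K))"
    by (intro integrable_mult_left Bochner_Integration.integrable_sum integrable_mult_right h)
  show "AE x in N. norm ((\<Sum>k\<in>K. c k * h k x)\<^sup>2) \<le> norm ((\<Sum>k\<in>K. (c k)\<^sup>2 * (h k x)\<^sup>2) * real (card K))"
  proof (rule AE_I2)
    fix x
    have "(\<Sum>k\<in>K. c k * h k x)\<^sup>2 \<le> (\<Sum>k\<in>K. (c k * h k x)\<^sup>2) * real (card K)"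
      by (rule sum_squared_le_sum_of_squares)
    then show "norm ((\<Sum>k\<in>K. c k * h k x)\<^sup>2) \<le> norm ((\<Sum>k\<in>K. (c k)\<^sup>2 * (h k x)\<^sup>2) * real (card K))"
      by (simp add: power_mult_distrib)
  qed
qed measurable

lemma sum_tendsto_L2:
  fixes y :: "'j \<Rightarrow> 'a \<Rightarrow> real" and r :: "'j \<Rightarrow> nat \<Rightarrow> 'a \<Rightarrow> real"
  assumes "finite J" and [measurable]: "\<And>j. j \<in> J \<Longrightarrow> y j \<in> borel_measurable N" "\<And>j n. j \<in> J \<Longrightarrow> r j n \<in> borel_measurable N"
    and lim: "\<And>j. j \<in> J \<Longrightarrow> (\<lambda>n. \<integral>\<^sup>+x. ennreal ((y j x - r j n x)\<^sup>2) \<partial>N) \<longlonglongrightarrow> 0"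
  shows "(\<lambda>n. \<integral>\<^sup>+x. ennreal (((\<Sum>j\<in>J. c j * r j n x) - (\<Sum>j\<in>J. c j * y j x))\<^sup>2) \<partial>N) \<longlonglongrightarrow> 0"
proof (rule tendsto_sandwich[OF _ _ tendsto_const])
  let ?u = "\<lambda>n. \<Sum>j\<in>J. ennreal (real (card J) * (c j)\<^sup>2) * (\<integral>\<^sup>+x. ennreal ((y j x - r j n x)\<^sup>2) \<partial>N)"
  have "?u \<longlonglongrightarrow> (\<Sum>j\<in>J. ennreal (real (card J) * (c j)\<^sup>2) * 0)"
    by (intro tendsto_sum ennreal_tendsto_cmult lim) auto
  then show "?u \<longlonglongrightarrow> 0" by simp
  have "(\<integral>\<^sup>+x. ennreal (((\<Sum>j\<in>J. c j * r j n x) - (\<Sum>j\<in>J. c j * y j x))\<^sup>2) \<partial>N) \<le> ?u n" for n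
  proof -
    have "(\<integral>\<^sup>+x. ennreal (((\<Sum>j\<in>J. c j * r j n x) - (\<Sum>j\<in>J. c j * y j x))\<^sup>2) \<partial>N)
        \<le> (\<integral>\<^sup>+x. (\<Sum>j\<in>J. ennreal (real (card J) * (c j)\<^sup>2) * ennreal ((y j x - r j n x)\<^sup>2)) \<partial>N)"
    proof (rule nn_integral_mono)
      fix x
      have "((\<Sum>j\<in>J. c j * r j n x) - (\<Sum>j\<in>J. c j * y j x))\<^sup>2 = (\<Sum>j\<in>J. c j * (r j n x - y j x))\<^sup>2"
        by (simp add: sum_subtractf right_diff_distrib)
      also have "\<dots> \<le> (\<Sum>j\<in>J. (c j * (r j n x - y j x))\<^sup>2) * real (card J)"
        by (rule sum_squared_le_sum_of_squares)
      also have "\<dots> = (\<Sum>j\<in>J. (real (card J) * (c j)\<^sup>2) * (y j x - r j n x)\<^sup>2)"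
        by (simp add: sum_distrib_left power_mult_distrib power2_commute mult_ac)
      finally show "ennreal (((\<Sum>j\<in>J. c j * r j n x) - (\<Sum>j\<in>J. c j * y j x))\<^sup>2)
          \<le> (\<Sum>j\<in>J. ennreal (real (card J) * (c j)\<^sup>2) * ennreal ((y j x - r j n x)\<^sup>2))"
        by (simp flip: ennreal_mult add: sum_ennreal ennreal_leI)
    qed
    also have "\<dots> = ?u n"
      by (subst nn_integral_sum) (auto intro!: sum.cong nn_integral_cmult)
    finally show ?thesis .
  qed
  then show "\<forall>\<^sub>F n in sequentially. (\<integral>\<^sup>+x. ennreal (((\<Sum>j\<in>J. c j * r j n x) - (\<Sum>j\<in>J. c j * y j x))\<^sup>2) \<partial>N) \<le> ?u n"
    by (intro always_eventually) blast
qed simp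

text \<open>On a probability space mean-square convergence implies convergence in first mean, and
  \<open>iexp\<close> is 1-Lipschitz.\<close>

lemma (in prob_space) char_tendsto_L2:
  assumes [measurable]: "\<And>n. A n \<in> borel_measurable M" "B \<in> borel_measurable M"
    and lim: "(\<lambda>n. \<integral>\<^sup>+\<omega>. ennreal ((A n \<omega> - B \<omega>)\<^sup>2) \<partial>M) \<longlonglongrightarrow> 0"
  shows "(\<lambda>n. char (distr M borel (A n)) 1) \<longlonglongrightarrow> char (distr M borel B) 1"
proof (rule tendsto_if_ennreal_norm_le)
  fix n
  have i: "integrable M (\<lambda>\<omega>. iexp (Y \<omega>))" if "Y \<in> borel_measurable M" for Y
    by (rule integrable_iexp) (use that in auto)
  have "char (distr M borel (A n)) 1 - char (distr M borel B) 1 = (\<integral>\<omega>. iexp (A n \<omega>) - iexp (B \<omega>) \<partial>M)"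
    by (simp add: char_distr i)
  also have "ennreal (norm \<dots>) \<le> (\<integral>\<^sup>+\<omega>. norm (iexp (A n \<omega>) - iexp (B \<omega>)) \<partial>M)"
    by (intro integral_norm_bound_ennreal Bochner_Integration.integrable_diff i) auto
  also have "\<dots> \<le> (\<integral>\<^sup>+\<omega>. ennreal \<bar>A n \<omega> - B \<omega>\<bar> \<partial>M)"
    by (intro nn_integral_mono ennreal_leI norm_iexp_diff_le)
  finally show "ennreal (norm (char (distr M borel (A n)) 1 - char (distr M borel B) 1))
      \<le> (\<integral>\<^sup>+\<omega>. ennreal \<bar>A n \<omega> - B \<omega>\<bar> \<partial>M)" .
next
  show "(\<lambda>n. \<integral>\<^sup>+\<omega>. ennreal \<bar>A n \<omega> - B \<omega>\<bar> \<partial>M) \<longlonglongrightarrow> 0"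
  proof (rule ennreal_square_tendsto_0, rule tendsto_sandwich[OF _ _ tendsto_const lim])
    have "(\<integral>\<^sup>+\<omega>. ennreal \<bar>A n \<omega> - B \<omega>\<bar> \<partial>M)\<^sup>2 \<le> (\<integral>\<^sup>+\<omega>. ennreal ((A n \<omega> - B \<omega>)\<^sup>2) \<partial>M)" for n
      using nn_integral_abs_square_le[of "\<lambda>\<omega>. A n \<omega> - B \<omega>" M] by (simp add: emeasure_space_1)
    then show "\<forall>\<^sub>F n in sequentially. (\<integral>\<^sup>+\<omega>. ennreal \<bar>A n \<omega> - B \<omega>\<bar> \<partial>M)\<^sup>2 \<le> (\<integral>\<^sup>+\<omega>. ennreal ((A n \<omega> - B \<omega>)\<^sup>2) \<partial>M)"
      by (intro always_eventually allI)
  qed simp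
qed

text \<open>By \<open>centred_cumulant_diff_le\<close> the difference is at most a square term plus
  a cross term |h - k| |k|; Cauchy-Schwarz makes the latter vanish with the mean-square
  distance.\<close>

lemma (in levy_measure_L2) integral_centred_cumulant_tendsto:
  assumes [measurable]: "\<And>n. h n \<in> borel_measurable N" "k \<in> borel_measurable N"
    and h2: "\<And>n. integrable N (\<lambda>x. (h n x)\<^sup>2)" and k2: "integrable N (\<lambda>x. (k x)\<^sup>2)"
    and lim: "(\<lambda>n. \<integral>\<^sup>+x. ennreal ((h n x - k x)\<^sup>2) \<partial>N) \<longlonglongrightarrow> 0"
  shows "(\<lambda>n. \<integral>x. centred_cumulant b \<mu> (h n x) \<partial>N) \<longlonglongrightarrow> (\<integral>x. centred_cumulant b \<mu> (k x) \<partial>N)"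
proof (rule tendsto_if_ennreal_norm_le)
  fix n
  let ?c = "centred_cumulant b \<mu>"
  have ih: "integrable N (\<lambda>x. ?c (h n x))" and ik: "integrable N (\<lambda>x. ?c (k x))"
    by (intro integrable_centred_cumulant(1) h2 k2; measurable)+
  have "(\<integral>x. ?c (h n x) \<partial>N) - (\<integral>x. ?c (k x) \<partial>N) = (\<integral>x. ?c (h n x) - ?c (k x) \<partial>N)"
    by (rule Bochner_Integration.integral_diff[symmetric, OF ih ik])
  also have "ennreal (norm \<dots>) \<le> (\<integral>\<^sup>+x. norm (?c (h n x) - ?c (k x)) \<partial>N)"
    by (intro integral_norm_bound_ennreal Bochner_Integration.integrable_diff ih ik)
  also have "\<dots> \<le> (\<integral>\<^sup>+x. ennreal (v / 2) * ennreal ((h n x - k x)\<^sup>2) + ennreal v * (ennreal \<bar>h n x - k x\<bar> * ennreal \<bar>k x\<bar>) \<partial>N)"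
  proof (rule nn_integral_mono)
    fix x
    have "norm (?c (h n x) - ?c (k x)) \<le> v / 2 * (h n x - k x)\<^sup>2 + v * (\<bar>h n x - k x\<bar> * \<bar>k x\<bar>)"
      using centred_cumulant_diff_le[of "h n x" "k x"] by (simp add: distrib_left)
    then show "ennreal (norm (?c (h n x) - ?c (k x)))
        \<le> ennreal (v / 2) * ennreal ((h n x - k x)\<^sup>2) + ennreal v * (ennreal \<bar>h n x - k x\<bar> * ennreal \<bar>k x\<bar>)"
      using v_nonneg by (simp flip: ennreal_mult ennreal_plus add: ennreal_leI)
  qed
  also have "\<dots> = ennreal (v / 2) * (\<integral>\<^sup>+x. ennreal ((h n x - k x)\<^sup>2) \<partial>N)
      + ennreal v * (\<integral>\<^sup>+x. ennreal \<bar>h n x - k x\<bar> * ennreal \<bar>k x\<bar> \<partial>N)"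
    by (subst nn_integral_add) (auto simp: nn_integral_cmult)
  finally show "ennreal (norm ((\<integral>x. ?c (h n x) \<partial>N) - (\<integral>x. ?c (k x) \<partial>N)))
    \<le> ennreal (v / 2) * (\<integral>\<^sup>+x. ennreal ((h n x - k x)\<^sup>2) \<partial>N)
      + ennreal v * (\<integral>\<^sup>+x. ennreal \<bar>h n x - k x\<bar> * ennreal \<bar>k x\<bar> \<partial>N)" .
next
  have "(\<lambda>n. \<integral>\<^sup>+x. ennreal \<bar>h n x - k x\<bar> * ennreal \<bar>k x\<bar> \<partial>N) \<longlonglongrightarrow> 0"
  proof (rule ennreal_square_tendsto_0, rule tendsto_sandwich[OF _ _ tendsto_const])
    let ?Q = "\<integral>\<^sup>+x. ennreal ((k x)\<^sup>2) \<partial>N"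
    have "?Q < \<infinity>" using k2 by (subst (asm) integrable_nn_square) auto
    then have "(\<lambda>n. ?Q * (\<integral>\<^sup>+x. ennreal ((h n x - k x)\<^sup>2) \<partial>N)) \<longlonglongrightarrow> ?Q * 0"
      by (intro ennreal_tendsto_cmult lim) (simp add: less_top)
    then show "(\<lambda>n. ?Q * (\<integral>\<^sup>+x. ennreal ((h n x - k x)\<^sup>2) \<partial>N)) \<longlonglongrightarrow> 0" by simp
    have "(\<integral>\<^sup>+x. ennreal \<bar>h n x - k x\<bar> * ennreal \<bar>k x\<bar> \<partial>N)\<^sup>2 \<le> ?Q * (\<integral>\<^sup>+x. ennreal ((h n x - k x)\<^sup>2) \<partial>N)" for n
      using Cauchy_Schwarz_nn_integral[of "\<lambda>x. ennreal \<bar>h n x - k x\<bar>" N "\<lambda>x. ennreal \<bar>k x\<bar>"]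
      by (simp add: ennreal_power mult.commute)
    then show "\<forall>\<^sub>F n in sequentially. (\<integral>\<^sup>+x. ennreal \<bar>h n x - k x\<bar> * ennreal \<bar>k x\<bar> \<partial>N)\<^sup>2
        \<le> ?Q * (\<integral>\<^sup>+x. ennreal ((h n x - k x)\<^sup>2) \<partial>N)"
      by (intro always_eventually allI)
  qed simp
  then have "(\<lambda>n. ennreal (v / 2) * (\<integral>\<^sup>+x. ennreal ((h n x - k x)\<^sup>2) \<partial>N)
      + ennreal v * (\<integral>\<^sup>+x. ennreal \<bar>h n x - k x\<bar> * ennreal \<bar>k x\<bar> \<partial>N)) \<longlonglongrightarrow> ennreal (v / 2) * 0 + ennreal v * 0"
    by (intro tendsto_add ennreal_tendsto_cmult lim) auto
  then show "(\<lambda>n. ennreal (v / 2) * (\<integral>\<^sup>+x. ennreal ((h n x - k x)\<^sup>2) \<partial>N)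
      + ennreal v * (\<integral>\<^sup>+x. ennreal \<bar>h n x - k x\<bar> * ennreal \<bar>k x\<bar> \<partial>N)) \<longlonglongrightarrow> 0"
    by simp
qed

lemma (in L2_continuous_process) riemann_square_integrable:
  shows "integrable m (\<lambda>x. (g u x)\<^sup>2)" and "integrable m (\<lambda>x. (riemann g \<tau> n x)\<^sup>2)"
    and "riemann g \<tau> n \<in> borel_measurable m"
proof -
  show g2: "integrable m (\<lambda>x. (g u x)\<^sup>2)" for u
    using bounded_L2[of u] by (subst integrable_nn_square) (auto intro: le_less_trans)
  show "integrable m (\<lambda>x. (riemann g \<tau> n x)\<^sup>2)"
    unfolding riemann_def by (intro integrable_square_sum g2) measurable
  show "riemann g \<tau> n \<in> borel_measurable m"
    unfolding riemann_def[abs_def] by measurable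
qed

text \<open>One Riemann sum at squared distance less than 1 suffices, since y^2 \<le> 2 (y - r)^2 +
  2 r^2.\<close>

lemma (in L2_continuous_process) time_integral_square_integrable:
  assumes "0 \<le> \<tau>"
  shows "integrable m (\<lambda>x. (LBINT u:{0..\<tau>}. g u x)\<^sup>2)"
proof -
  note [measurable] = riemann_square_integrable(3)
  have "\<forall>\<^sub>F n in sequentially. (\<integral>\<^sup>+x. ennreal (((LBINT u:{0..\<tau>}. g u x) - riemann g \<tau> n x)\<^sup>2) \<partial>m) < 1"
    by (rule order_tendstoD(2)[OF riemann_sum_tendsto_L2[OF assms]]) simp
  then obtain n where "(\<integral>\<^sup>+x. ennreal (((LBINT u:{0..\<tau>}. g u x) - riemann g \<tau> n x)\<^sup>2) \<partial>m) < 1"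
    by (auto dest: eventually_happens)
  then have d: "integrable m (\<lambda>x. ((LBINT u:{0..\<tau>}. g u x) - riemann g \<tau> n x)\<^sup>2)"
    by (subst integrable_nn_square) (auto intro: less_trans)
  have "integrable m (\<lambda>x. 2 * ((LBINT u:{0..\<tau>}. g u x) - riemann g \<tau> n x)\<^sup>2 + 2 * (riemann g \<tau> n x)\<^sup>2)"
    by (intro Bochner_Integration.integrable_add integrable_mult_right d riemann_square_integrable)
  then show ?thesis
  proof (rule Bochner_Integration.integrable_bound)
    have "y\<^sup>2 \<le> 2 * (y - r)\<^sup>2 + 2 * r\<^sup>2" for y r :: real
      using zero_le_power2[of "y - 2 * r"] by (simp add: power2_eq_square algebra_simps)
    then show "AE x in m. norm ((LBINT u:{0..\<tau>}. g u x)\<^sup>2)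
        \<le> norm (2 * ((LBINT u:{0..\<tau>}. g u x) - riemann g \<tau> n x)\<^sup>2 + 2 * (riemann g \<tau> n x)\<^sup>2)"
      by (intro AE_I2) simp
  qed measurable
qed

section \<open>Integrated processes driven by a Levy basis\<close>

locale levy_driven_process = levy_basis_noise_L2 M \<nu> a b \<mu> \<Lambda> + kernel: L2_continuous_process \<nu> f C
  for M :: "'w measure" and \<nu> :: "'e measure" and a b :: real and \<mu> :: "real measure"
    and \<Lambda> :: "'e set \<Rightarrow> 'w \<Rightarrow> real" and f :: "real \<Rightarrow> 'e \<Rightarrow> real" and C :: real +
  fixes X :: "real \<Rightarrow> 'w \<Rightarrow> real"
  assumes stoch_integral: "\<And>t. has_stoch_integral M \<nu> \<Lambda> (f t) (X t)"
    and mean: "\<And>t. (\<integral>\<omega>. X t \<omega> \<partial>M) = 0"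
    and meas_X: "(\<lambda>(t, \<omega>). X t \<omega>) \<in> borel_measurable (borel \<Otimes>\<^sub>M M)"
begin

lemma X_measurable [measurable]: "X t \<in> borel_measurable M"
  using has_stoch_integral_measurable[OF stoch_integral] by simp

lemma X_square_integrable: "integrable M (\<lambda>\<omega>. (X t \<omega>)\<^sup>2)"
  by (rule stoch_integral_square_integrable[OF stoch_integral kernel.riemann_square_integrable(1)])

lemma X_integrable: "integrable M (X t)"
  by (rule square_integrable_imp_integrable[OF X_measurable X_square_integrable])

text \<open>The isometry carries mean-square bounds from the kernel to the process: the coefficients
  (1, 0) give the size, (1, -1) the increments.\<close>

lemma nn_integral_linear_square:
  "(\<integral>\<^sup>+\<omega>. ennreal ((c * X t \<omega> + c' * X u \<omega>)\<^sup>2) \<partial>M)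
    = ennreal v * (\<integral>\<^sup>+x. ennreal ((c * f t x + c' * f u x)\<^sup>2) \<partial>\<nu>)"
proof -
  have has: "has_stoch_integral M \<nu> \<Lambda> (\<lambda>x. c * f t x + c' * f u x) (\<lambda>\<omega>. c * X t \<omega> + c' * X u \<omega>)"
    by (intro has_stoch_integral_linear stoch_integral)
  have f2: "integrable \<nu> (\<lambda>x. (c * f t x + c' * f u x)\<^sup>2)"
    using integrable_square_sum[of "{False, True}" "\<lambda>i. if i then f u else f t" \<nu> "\<lambda>i. if i then c' else c"]
    by (simp add: kernel.riemann_square_integrable(1) if_distrib cong: if_cong)
  have m: "(\<integral>\<omega>. c * X t \<omega> + c' * X u \<omega> \<partial>M) = 0"
    using X_integrable mean by simp
  have "(\<integral>\<^sup>+\<omega>. ennreal ((c * X t \<omega> + c' * X u \<omega>)\<^sup>2) \<partial>M) = ennreal (\<integral>\<omega>. (c * X t \<omega> + c' * X u \<omega>)\<^sup>2 \<partial>M)"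
    by (rule nn_integral_eq_integral[OF stoch_integral_square_integrable[OF has f2]]) simp
  also have "\<dots> = ennreal v * ennreal (\<integral>x. (c * f t x + c' * f u x)\<^sup>2 \<partial>\<nu>)"
    unfolding stoch_integral_isometry[OF has f2 m] using v_nonneg by (simp add: ennreal_mult)
  also have "ennreal (\<integral>x. (c * f t x + c' * f u x)\<^sup>2 \<partial>\<nu>) = (\<integral>\<^sup>+x. ennreal ((c * f t x + c' * f u x)\<^sup>2) \<partial>\<nu>)"
    by (rule nn_integral_eq_integral[symmetric, OF f2]) simp
  finally show ?thesis .
qed

sublocale process: L2_continuous_process M X "v * C"
proof
  show "(\<lambda>(t, \<omega>). X t \<omega>) \<in> borel_measurable (borel \<Otimes>\<^sub>M M)" by (rule meas_X)
  fix u
  have "(\<integral>\<^sup>+\<omega>. ennreal ((X u \<omega>)\<^sup>2) \<partial>M) = ennreal v * (\<integral>\<^sup>+x. ennreal ((f u x)\<^sup>2) \<partial>\<nu>)"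
    using nn_integral_linear_square[of 1 u 0 u] by simp
  also have "\<dots> \<le> ennreal v * ennreal C" by (intro mult_left_mono kernel.bounded_L2) simp
  also have "\<dots> = ennreal (v * C)" using v_nonneg by (simp add: ennreal_mult')
  finally show "(\<integral>\<^sup>+\<omega>. ennreal ((X u \<omega>)\<^sup>2) \<partial>M) \<le> ennreal (v * C)" .
next
  fix \<epsilon> :: real assume "0 < \<epsilon>"
  then have "0 < \<epsilon> / (v + 1)" using v_nonneg by simp
  from kernel.continuous_L2[OF this] obtain \<delta> where \<delta>: "0 < \<delta>"
    "\<And>u w. \<bar>u - w\<bar> < \<delta> \<Longrightarrow> (\<integral>\<^sup>+x. ennreal ((f u x - f w x)\<^sup>2) \<partial>\<nu>) \<le> ennreal (\<epsilon> / (v + 1))"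
    by blast
  show "\<exists>\<delta>>0. \<forall>u w. \<bar>u - w\<bar> < \<delta> \<longrightarrow> (\<integral>\<^sup>+\<omega>. ennreal ((X u \<omega> - X w \<omega>)\<^sup>2) \<partial>M) \<le> ennreal \<epsilon>"
  proof (intro exI conjI allI impI)
    fix u w :: real assume "\<bar>u - w\<bar> < \<delta>"
    have "(\<integral>\<^sup>+\<omega>. ennreal ((X u \<omega> - X w \<omega>)\<^sup>2) \<partial>M) = ennreal v * (\<integral>\<^sup>+x. ennreal ((f u x - f w x)\<^sup>2) \<partial>\<nu>)"
      using nn_integral_linear_square[of 1 u "-1" w] by simp
    also have "\<dots> \<le> ennreal v * ennreal (\<epsilon> / (v + 1))"
      by (intro mult_left_mono \<delta>(2) \<open>\<bar>u - w\<bar> < \<delta>\<close>) simp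
    also have "\<dots> = ennreal (v * (\<epsilon> / (v + 1)))"
      using v_nonneg \<open>0 < \<epsilon>\<close> by (intro ennreal_mult[symmetric]) auto
    also have "\<dots> \<le> ennreal \<epsilon>" using v_nonneg \<open>0 < \<epsilon>\<close> by (intro ennreal_leI) (simp add: field_simps)
    finally show "(\<integral>\<^sup>+\<omega>. ennreal ((X u \<omega> - X w \<omega>)\<^sup>2) \<partial>M) \<le> ennreal \<epsilon>" .
  qed (rule \<delta>(1))
qed

text \<open>A combination of Riemann sums is itself a centred stochastic integral, so the cumulant
  formula holds for each n. Mean-square convergence of the sums, for the process on one side and for
  the kernel on the other, carries both sides of the formula to the limit.\<close>

theorem char_integrated_process:
  assumes "finite J" and \<tau>: "\<And>j. j \<in> J \<Longrightarrow> 0 \<le> \<tau> j"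
  shows "char (distr M borel (\<lambda>\<omega>. \<Sum>j\<in>J. c j * integrated_process X (\<tau> j) \<omega>)) 1
    = exp (\<integral>x. centred_cumulant b \<mu> (\<Sum>j\<in>J. c j * (LBINT u:{0..\<tau> j}. f u x)) \<partial>\<nu>)"
proof -
  note [measurable] = process.riemann_square_integrable(3) kernel.riemann_square_integrable(3)
  let ?A = "\<lambda>n \<omega>. \<Sum>j\<in>J. c j * riemann X (\<tau> j) n \<omega>"
  let ?h = "\<lambda>n x. \<Sum>j\<in>J. c j * riemann f (\<tau> j) n x"
  have h2: "integrable \<nu> (\<lambda>x. (?h n x)\<^sup>2)" for n
    by (intro integrable_square_sum kernel.riemann_square_integrable)
  have ch: "char (distr M borel (?A n)) 1 = exp (\<integral>x. centred_cumulant b \<mu> (?h n x) \<partial>\<nu>)" for n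
  proof -
    \<comment> \<open>The double sum is flattened into one finite combination of values of the
      process. Grid times may coincide for different j, so pairs serve as indices rather than
      times.\<close>
    let ?K = "J \<times> {..<Suc n}"
    let ?c = "\<lambda>(j, i). c j * (\<tau> j / real (Suc n))" and ?t = "\<lambda>(j, i). \<tau> j * real i / real (Suc n)"
    have eq: "(\<Sum>j\<in>J. c j * riemann g (\<tau> j) n x) = (\<Sum>k\<in>?K. ?c k * g (?t k) x)" for g :: "real \<Rightarrow> 'z \<Rightarrow> real" and x
      unfolding riemann_def sum_distrib_left
      by (subst sum.cartesian_product) (simp add: case_prod_beta mult.assoc)
    have "finite ?K" using assms(1) by simp
    from has_stoch_integral_sum[OF this stoch_integral]
    have "has_stoch_integral M \<nu> \<Lambda> (?h n) (?A n)" unfolding eq .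
    moreover have "(\<integral>\<omega>. ?A n \<omega> \<partial>M) = 0"
      unfolding eq by (subst Bochner_Integration.integral_sum) (auto simp: mean intro!: integrable_mult_right X_integrable)
    ultimately show ?thesis using stoch_integral_char_centred[OF _ h2, of n "?A n" 1] by simp
  qed
  have "(\<lambda>n. char (distr M borel (?A n)) 1) \<longlonglongrightarrow> char (distr M borel (\<lambda>\<omega>. \<Sum>j\<in>J. c j * integrated_process X (\<tau> j) \<omega>)) 1"
    unfolding integrated_process_def
    by (intro char_tendsto_L2 sum_tendsto_L2 process.riemann_sum_tendsto_L2 assms) measurable
  moreover have "(\<lambda>n. \<integral>x. centred_cumulant b \<mu> (?h n x) \<partial>\<nu>)
      \<longlonglongrightarrow> (\<integral>x. centred_cumulant b \<mu> (\<Sum>j\<in>J. c j * (LBINT u:{0..\<tau> j}. f u x)) \<partial>\<nu>)"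
    by (intro integral_centred_cumulant_tendsto sum_tendsto_L2 kernel.riemann_sum_tendsto_L2 assms h2
        integrable_square_sum kernel.time_integral_square_integrable) measurable
  then have "(\<lambda>n. char (distr M borel (?A n)) 1)
      \<longlonglongrightarrow> exp (\<integral>x. centred_cumulant b \<mu> (\<Sum>j\<in>J. c j * (LBINT u:{0..\<tau> j}. f u x)) \<partial>\<nu>)"
    unfolding ch by (rule tendsto_exp)
  ultimately show ?thesis by (rule LIMSEQ_unique)
qed

end

section \<open>The supOU kernel and its scaling limit\<close>

lemma exp_neg_mult_tendsto_0:
  fixes \<alpha> :: real
  assumes "0 < \<alpha>"
  shows "((\<lambda>x. exp (- \<alpha> * x)) \<longlongrightarrow> 0) at_top"
proof (rule filterlim_compose[OF exp_at_bot])
  show "filterlim (\<lambda>x. - \<alpha> * x) at_bot at_top"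
    using assms by (intro filterlim_tendsto_neg_mult_at_bot[OF tendsto_const]) (auto simp: filterlim_ident)
qed

lemma has_bochner_integral_exp_atMost:
  fixes \<alpha> c :: real
  assumes "0 < \<alpha>"
  shows "has_bochner_integral lborel (\<lambda>s. exp (\<alpha> * s) * indicator {..c} s) (exp (\<alpha> * c) / \<alpha>)"
proof (rule has_bochner_integral_nn_integral)
  have "(\<integral>\<^sup>+s. ennreal (exp (\<alpha> * s) * indicator {..c} s) \<partial>lborel)
      = (\<integral>\<^sup>+x. ennreal \<bar>-1\<bar> * ennreal (exp (\<alpha> * (c + -1 * x)) * indicator {..c} (c + -1 * x)) \<partial>lborel)"
    by (subst nn_integral_real_affine[where c="-1" and t=c]) (auto simp: nn_integral_cmult)
  also have "\<dots> = (\<integral>\<^sup>+x. ennreal (exp (\<alpha> * (c - x))) * indicator {0..} x \<partial>lborel)"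
    by (intro nn_integral_cong) (auto simp: indicator_def)
  also have "\<dots> = ennreal (0 - (- exp (\<alpha> * (c - 0)) / \<alpha>))"
  proof (rule nn_integral_FTC_atLeast[where F="\<lambda>x. - exp (\<alpha> * (c - x)) / \<alpha>"])
    show "((\<lambda>x. - exp (\<alpha> * (c - x)) / \<alpha>) has_real_derivative exp (\<alpha> * (c - x))) (at x)" for x
      using assms by (auto intro!: derivative_eq_intros)
    have "((\<lambda>x. exp (- \<alpha> * x)) \<longlongrightarrow> 0) at_top" by (rule exp_neg_mult_tendsto_0[OF assms])
    then have "((\<lambda>x. - exp (\<alpha> * c) / \<alpha> * exp (- \<alpha> * x)) \<longlongrightarrow> 0) at_top" by (rule tendsto_mult_right_zero)
    then show "((\<lambda>x. - exp (\<alpha> * (c - x)) / \<alpha>) \<longlongrightarrow> 0) at_top"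
      by (simp add: right_diff_distrib exp_diff exp_minus divide_inverse mult_ac)
  qed auto
  finally show "(\<integral>\<^sup>+s. ennreal (exp (\<alpha> * s) * indicator {..c} s) \<partial>lborel) = ennreal (exp (\<alpha> * c) / \<alpha>)"
    by simp
qed (use assms in auto)

locale ou_measure = prob_space \<pi> for \<pi> :: "real measure" +
  assumes sets_pi: "sets \<pi> = sets (restrict_space borel {0<..})"
begin

lemma space_pi: "space \<pi> = {0<..}"
  using sets_eq_imp_space_eq[OF sets_pi] by (simp add: space_restrict_space)

lemma measurable_pi [measurable (raw)]:
  assumes "f \<in> borel_measurable borel"
  shows "f \<in> borel_measurable \<pi>"
  using measurable_restrict_space1[OF assms, of "{0<..}"] measurable_cong_sets[OF sets_pi refl] by blast

sublocale product: pair_sigma_finite \<pi> lborel ..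

lemma measurable_kernel: "(\<lambda>(u, x). supOU_kernel u x) \<in> borel_measurable (borel \<Otimes>\<^sub>M (\<pi> \<Otimes>\<^sub>M lborel))"
proof -
  have [measurable]: "(\<lambda>p. fst (snd p)) \<in> borel_measurable (borel \<Otimes>\<^sub>M (\<pi> \<Otimes>\<^sub>M lborel))"
    by (rule measurable_compose[OF _ measurable_pi[of "\<lambda>x. x"]]) simp_all
  have "(\<lambda>p. exp (- fst (snd p) * fst p + snd (snd p)) * indicator {0..} (fst (snd p) * fst p - snd (snd p)))
      \<in> borel_measurable (borel \<Otimes>\<^sub>M (\<pi> \<Otimes>\<^sub>M lborel))"
    by measurable
  then show ?thesis by (simp add: supOU_kernel_def case_prod_beta')
qed

lemma measurable_kernel_section [measurable]: "supOU_kernel u \<in> borel_measurable (\<pi> \<Otimes>\<^sub>M lborel)"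
  using measurable_compose[OF measurable_Pair1' measurable_kernel, of u] by simp

text \<open>Both indicators together cut at s \<le> \<xi> * min t u; integrating exp (2 s) up to
  there leaves the Ornstein-Uhlenbeck correlation at rate \<xi>, times 1 / 2.\<close>

lemma kernel_product_integral:
  assumes "0 < \<xi>"
  shows "has_bochner_integral lborel (\<lambda>s. supOU_kernel t (\<xi>, s) * supOU_kernel u (\<xi>, s)) (exp (- \<xi> * \<bar>t - u\<bar>) / 2)"
proof -
  have "has_bochner_integral lborel (\<lambda>s. exp (- \<xi> * t - \<xi> * u) * (exp (2 * s) * indicator {..\<xi> * min t u} s))
      (exp (- \<xi> * t - \<xi> * u) * (exp (2 * (\<xi> * min t u)) / 2))"
    by (intro has_bochner_integral_mult_right has_bochner_integral_exp_atMost) simp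
  moreover have "exp (- \<xi> * t - \<xi> * u) * (exp (2 * (\<xi> * min t u)) / 2) = exp (- \<xi> * \<bar>t - u\<bar>) / 2"
    by (simp add: min_def abs_if algebra_simps flip: exp_add)
  moreover have "exp (- \<xi> * t - \<xi> * u) * (exp (2 * s) * indicator {..\<xi> * min t u} s)
      = supOU_kernel t (\<xi>, s) * supOU_kernel u (\<xi>, s)" for s
  proof -
    have "s \<le> \<xi> * min t u \<longleftrightarrow> s \<le> \<xi> * t \<and> s \<le> \<xi> * u"
      using assms by (auto simp: min_def mult_le_cancel_left_pos intro: order_trans)
    then show ?thesis
      by (auto simp: supOU_kernel_def indicator_def algebra_simps simp flip: exp_add)
  qed
  ultimately show ?thesis by simp
qed

lemma nn_integral_kernel_square: "(\<integral>\<^sup>+x. ennreal ((supOU_kernel u x)\<^sup>2) \<partial>(\<pi> \<Otimes>\<^sub>M lborel)) = ennreal (1 / 2)"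
proof -
  have "(\<integral>\<^sup>+x. ennreal ((supOU_kernel u x)\<^sup>2) \<partial>(\<pi> \<Otimes>\<^sub>M lborel))
      = (\<integral>\<^sup>+\<xi>. (\<integral>\<^sup>+s. ennreal ((supOU_kernel u (\<xi>, s))\<^sup>2) \<partial>lborel) \<partial>\<pi>)"
    by (rule lborel.nn_integral_fst[symmetric]) measurable
  also have "\<dots> = (\<integral>\<^sup>+\<xi>. ennreal (1 / 2) \<partial>\<pi>)"
  proof (rule nn_integral_cong)
    fix \<xi> assume "\<xi> \<in> space \<pi>"
    then have "has_bochner_integral lborel (\<lambda>s. (supOU_kernel u (\<xi>, s))\<^sup>2) (1 / 2)"
      using kernel_product_integral[of \<xi> u u] by (simp add: space_pi power2_eq_square)
    then have i: "integrable lborel (\<lambda>s. (supOU_kernel u (\<xi>, s))\<^sup>2)"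
      and e: "(\<integral>s. (supOU_kernel u (\<xi>, s))\<^sup>2 \<partial>lborel) = 1 / 2"
      unfolding has_bochner_integral_iff by blast+
    show "(\<integral>\<^sup>+s. ennreal ((supOU_kernel u (\<xi>, s))\<^sup>2) \<partial>lborel) = ennreal (1 / 2)"
      unfolding e[symmetric] by (rule nn_integral_eq_integral[OF i]) simp
  qed
  also have "\<dots> = ennreal (1 / 2)" by (simp add: emeasure_space_1)
  finally show ?thesis .
qed

lemma nn_integral_kernel_diff_square:
  "(\<integral>\<^sup>+x. ennreal ((supOU_kernel t x - supOU_kernel u x)\<^sup>2) \<partial>(\<pi> \<Otimes>\<^sub>M lborel))
    = (\<integral>\<^sup>+\<xi>. ennreal (1 - exp (- \<xi> * \<bar>t - u\<bar>)) \<partial>\<pi>)"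
proof -
  have "(\<integral>\<^sup>+x. ennreal ((supOU_kernel t x - supOU_kernel u x)\<^sup>2) \<partial>(\<pi> \<Otimes>\<^sub>M lborel))
      = (\<integral>\<^sup>+\<xi>. (\<integral>\<^sup>+s. ennreal ((supOU_kernel t (\<xi>, s) - supOU_kernel u (\<xi>, s))\<^sup>2) \<partial>lborel) \<partial>\<pi>)"
    by (rule lborel.nn_integral_fst[symmetric]) measurable
  also have "\<dots> = (\<integral>\<^sup>+\<xi>. ennreal (1 - exp (- \<xi> * \<bar>t - u\<bar>)) \<partial>\<pi>)"
  proof (rule nn_integral_cong)
    fix \<xi> assume "\<xi> \<in> space \<pi>"
    then have "0 < \<xi>" by (simp add: space_pi)
    let ?f = "\<lambda>t s. supOU_kernel t (\<xi>, s)"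
    have "has_bochner_integral lborel (\<lambda>s. ?f t s * ?f t s + ?f u s * ?f u s - 2 * (?f t s * ?f u s))
        (exp (- \<xi> * \<bar>t - t\<bar>) / 2 + exp (- \<xi> * \<bar>u - u\<bar>) / 2 - 2 * (exp (- \<xi> * \<bar>t - u\<bar>) / 2))"
      by (intro has_bochner_integral_add has_bochner_integral_diff has_bochner_integral_mult_right
          kernel_product_integral \<open>0 < \<xi>\<close>)
    moreover have "?f t s * ?f t s + ?f u s * ?f u s - 2 * (?f t s * ?f u s) = (?f t s - ?f u s)\<^sup>2" for s
      by (simp add: power2_eq_square algebra_simps)
    ultimately have "has_bochner_integral lborel (\<lambda>s. (?f t s - ?f u s)\<^sup>2) (1 - exp (- \<xi> * \<bar>t - u\<bar>))"
      by simp
    then show "(\<integral>\<^sup>+s. ennreal ((?f t s - ?f u s)\<^sup>2) \<partial>lborel) = ennreal (1 - exp (- \<xi> * \<bar>t - u\<bar>))"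
      by (subst nn_integral_eq_integral) (auto simp: has_bochner_integral_iff)
  qed
  finally show ?thesis .
qed

text \<open>The squared distance of two kernels is the \<pi>-average of 1 - exp (- \<xi> |t - u|).
  It depends on the lag only and increases with it, so smallness at one lag 1 / n, from dominated
  convergence, gives a uniform modulus of continuity.\<close>

sublocale kernel: L2_continuous_process "\<pi> \<Otimes>\<^sub>M lborel" supOU_kernel "1 / 2"
proof
  show "(\<lambda>(u, x). supOU_kernel u x) \<in> borel_measurable (borel \<Otimes>\<^sub>M (\<pi> \<Otimes>\<^sub>M lborel))" by (rule measurable_kernel)
  show "(\<integral>\<^sup>+x. ennreal ((supOU_kernel u x)\<^sup>2) \<partial>(\<pi> \<Otimes>\<^sub>M lborel)) \<le> ennreal (1 / 2)" for u
    by (simp only: nn_integral_kernel_square order_refl)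
next
  fix \<epsilon> :: real assume "0 < \<epsilon>"
  have r: "(\<lambda>n. 1 / real (Suc n)) \<longlonglongrightarrow> 0" using LIMSEQ_inverse_real_of_nat by (simp add: inverse_eq_divide)
  have "(\<lambda>n. \<integral>\<^sup>+\<xi>. ennreal (1 - exp (- \<xi> * (1 / real (Suc n)))) \<partial>\<pi>) \<longlonglongrightarrow> (\<integral>\<^sup>+\<xi>. 0 \<partial>\<pi>)"
  proof (rule nn_integral_dominated_convergence[where w="\<lambda>_. 1"])
    show "AE \<xi> in \<pi>. ennreal (1 - exp (- \<xi> * (1 / real (Suc n)))) \<le> 1" for n
      by (intro AE_I2) (simp add: ennreal_le_1)
    show "AE \<xi> in \<pi>. (\<lambda>n. ennreal (1 - exp (- \<xi> * (1 / real (Suc n))))) \<longlonglongrightarrow> 0"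
    proof (rule AE_I2)
      fix \<xi>
      have "(\<lambda>n. ennreal (1 - exp (- \<xi> * (1 / real (Suc n))))) \<longlonglongrightarrow> ennreal (1 - exp (- \<xi> * 0))"
        by (intro tendsto_ennrealI tendsto_intros r)
      then show "(\<lambda>n. ennreal (1 - exp (- \<xi> * (1 / real (Suc n))))) \<longlonglongrightarrow> 0" by simp
    qed
  qed (auto simp: emeasure_space_1)
  then have "(\<lambda>n. \<integral>\<^sup>+\<xi>. ennreal (1 - exp (- \<xi> * (1 / real (Suc n)))) \<partial>\<pi>) \<longlonglongrightarrow> 0" by simp
  from order_tendstoD(2)[OF this, of "ennreal \<epsilon>"] \<open>0 < \<epsilon>\<close>
  obtain n where n: "(\<integral>\<^sup>+\<xi>. ennreal (1 - exp (- \<xi> * (1 / real (Suc n)))) \<partial>\<pi>) < ennreal \<epsilon>"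
    by (auto dest: eventually_happens)
  show "\<exists>\<delta>>0. \<forall>u w. \<bar>u - w\<bar> < \<delta> \<longrightarrow>
      (\<integral>\<^sup>+x. ennreal ((supOU_kernel u x - supOU_kernel w x)\<^sup>2) \<partial>(\<pi> \<Otimes>\<^sub>M lborel)) \<le> ennreal \<epsilon>"
  proof (intro exI[of _ "1 / real (Suc n)"] conjI allI impI)
    fix u w :: real assume "\<bar>u - w\<bar> < 1 / real (Suc n)"
    have "(\<integral>\<^sup>+\<xi>. ennreal (1 - exp (- \<xi> * \<bar>u - w\<bar>)) \<partial>\<pi>) \<le> (\<integral>\<^sup>+\<xi>. ennreal (1 - exp (- \<xi> * (1 / real (Suc n)))) \<partial>\<pi>)"
    proof (intro nn_integral_mono ennreal_leI)
      fix \<xi> assume "\<xi> \<in> space \<pi>"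
      then have "\<xi> * \<bar>u - w\<bar> \<le> \<xi> * (1 / real (Suc n))"
        using \<open>\<bar>u - w\<bar> < 1 / real (Suc n)\<close> by (intro mult_left_mono) (auto simp: space_pi)
      then show "1 - exp (- \<xi> * \<bar>u - w\<bar>) \<le> 1 - exp (- \<xi> * (1 / real (Suc n)))" by simp
    qed
    then show "(\<integral>\<^sup>+x. ennreal ((supOU_kernel u x - supOU_kernel w x)\<^sup>2) \<partial>(\<pi> \<Otimes>\<^sub>M lborel)) \<le> ennreal \<epsilon>"
      unfolding nn_integral_kernel_diff_square using n by (meson less_imp_le order_trans)
  qed simp
qed

end

section \<open>Time integral of the kernel\<close>

definition integrated_kernel :: "real \<Rightarrow> real \<Rightarrow> real \<Rightarrow> real" where
  "integrated_kernel \<tau> \<xi> s = (LBINT u:{0..\<tau>}. supOU_kernel u (\<xi>, s))"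

lemma integrated_kernel_eq:
  assumes "0 < \<xi>" "0 \<le> \<tau>"
  shows "integrated_kernel \<tau> \<xi> s = (if s \<le> \<xi> * \<tau> then (exp (min s 0) - exp (s - \<xi> * \<tau>)) / \<xi> else 0)"
proof -
  \<comment> \<open>The kernel at s vanishes before time s / \<xi>, so the effective range of u
    starts here.\<close>
  let ?m = "max 0 (s / \<xi>)"
  have eq: "indicator {0..\<tau>} u *\<^sub>R supOU_kernel u (\<xi>, s) = indicator {?m..\<tau>} u *\<^sub>R exp (s - \<xi> * u)" for u
    using assms by (auto simp: supOU_kernel_def indicator_def field_simps)
  show ?thesis
  proof (cases "s \<le> \<xi> * \<tau>")
    case True
    then have m: "?m \<le> \<tau>" using assms by (simp add: field_simps)
    have "(\<integral>u. indicator {?m..\<tau>} u *\<^sub>R exp (s - \<xi> * u) \<partial>lborel) = - exp (s - \<xi> * \<tau>) / \<xi> - (- exp (s - \<xi> * ?m) / \<xi>)"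
    proof (rule integral_FTC_atLeastAtMost[OF m])
      show "((\<lambda>u. - exp (s - \<xi> * u) / \<xi>) has_vector_derivative exp (s - \<xi> * u)) (at u within {?m..\<tau>})" for u
        using assms(1) by (auto intro!: derivative_eq_intros simp flip: has_real_derivative_iff_has_vector_derivative)
    qed (intro continuous_intros)
    moreover have "s - \<xi> * ?m = min s 0" using assms by (auto simp: max_def min_def field_simps)
    ultimately show ?thesis
      using True unfolding integrated_kernel_def set_lebesgue_integral_def eq by (simp add: diff_divide_distrib)
  next
    case False
    then have "\<tau> < s / \<xi>" using assms by (simp add: field_simps)
    then have "\<tau> < ?m" by simp
    then have "{?m..\<tau>} = {}" by simp
    then show ?thesis
      using False unfolding integrated_kernel_def set_lebesgue_integral_def eq by simp
  qed
qed

lemma integrated_kernel_nonneg: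
  assumes "0 < \<xi>" "0 \<le> \<tau>" shows "0 \<le> integrated_kernel \<tau> \<xi> s"
proof -
  have "s \<le> \<xi> * \<tau> \<Longrightarrow> s - \<xi> * \<tau> \<le> min s 0" using assms by simp
  then show ?thesis using assms by (simp add: integrated_kernel_eq)
qed

lemma integrated_kernel_le:
  assumes "0 < \<xi>" "0 \<le> \<tau>" shows "integrated_kernel \<tau> \<xi> s \<le> exp (min s 0) / \<xi>"
  using assms by (simp add: integrated_kernel_eq divide_right_mono)

text \<open>The product of the two bounds exp s * \<tau> and exp s / \<xi>. For \<tau> proportional
  to T, division by T leaves a multiple of 1 / \<xi>; the square of the first bound would grow with
  T, and that of the second would call for integrability of 1 / \<xi>^2.\<close>

lemma integrated_kernel_square_le:
  assumes "0 < \<xi>" "0 \<le> \<tau>" "s \<le> 0" shows "(integrated_kernel \<tau> \<xi> s)\<^sup>2 \<le> exp (2 * s) * \<tau> / \<xi>"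
proof -
  have "s \<le> \<xi> * \<tau>" using assms by (meson mult_nonneg_nonneg less_imp_le order_trans)
  then have "integrated_kernel \<tau> \<xi> s = exp s * (1 - exp (- (\<xi> * \<tau>))) / \<xi>"
    using assms by (simp add: integrated_kernel_eq algebra_simps exp_diff exp_minus divide_inverse)
  also have "\<dots> \<le> exp s * (\<xi> * \<tau>) / \<xi>"
    using assms exp_ge_add_one_self[of "- (\<xi> * \<tau>)"] by (intro divide_right_mono mult_left_mono) auto
  finally have 1: "integrated_kernel \<tau> \<xi> s \<le> exp s * \<tau>" using assms by simp
  have 2: "integrated_kernel \<tau> \<xi> s \<le> exp s / \<xi>" using integrated_kernel_le[OF assms(1,2), of s] assms(3) by simp
  have "(integrated_kernel \<tau> \<xi> s)\<^sup>2 \<le> exp s * \<tau> * (exp s / \<xi>)"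
    unfolding power2_eq_square using 1 2 assms integrated_kernel_nonneg[OF assms(1,2)] by (intro mult_mono) auto
  also have "\<dots> = exp (2 * s) * \<tau> / \<xi>" by (simp add: mult_exp_exp mult_ac flip: exp_add)
  finally show ?thesis .
qed

lemma abs_weighted_sum_le:
  fixes k :: "'j \<Rightarrow> real"
  assumes "\<And>j. j \<in> J \<Longrightarrow> \<bar>k j\<bar> \<le> B"
  shows "\<bar>\<Sum>j\<in>J. c j * k j\<bar> \<le> (\<Sum>j\<in>J. \<bar>c j\<bar>) * B"
proof -
  have "\<bar>\<Sum>j\<in>J. c j * k j\<bar> \<le> (\<Sum>j\<in>J. \<bar>c j * k j\<bar>)" by (rule sum_abs)
  also have "\<dots> \<le> (\<Sum>j\<in>J. \<bar>c j\<bar> * B)"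
    using assms by (intro sum_mono) (simp add: abs_mult mult_left_mono)
  finally show ?thesis by (simp add: sum_distrib_right)
qed

text \<open>Noise at w becomes active at time T w. For w < 0 it has decayed before time 0, for 0 < w
  < j its whole response 1 / \<xi> falls into the window in the limit, and for w > j it comes too
  late.\<close>

lemma integrated_kernel_rescaled_tendsto:
  assumes "0 < \<xi>" "0 \<le> j" "w \<noteq> 0" "w \<noteq> j"
  shows "((\<lambda>T. integrated_kernel (T * j) \<xi> (\<xi> * T * w)) \<longlongrightarrow> indicator {0<..<j} w / \<xi>) at_top"
proof -
  have pos: "eventually (\<lambda>T::real. 0 < T) at_top" by (rule eventually_gt_at_top)
  consider "w < 0" | "0 < w" "w < j" | "0 < w" "j < w" using assms by linarith
  then show ?thesis
  proof cases
    case 1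
    have "((\<lambda>T. exp (- (\<xi> * - w) * T) / \<xi>) \<longlongrightarrow> 0 / \<xi>) at_top"
      using assms(1) 1 by (intro tendsto_divide exp_neg_mult_tendsto_0) (auto simp: mult_pos_neg)
    then have lim: "((\<lambda>T. exp (\<xi> * T * w) / \<xi>) \<longlongrightarrow> 0) at_top" by (simp add: mult_ac)
    have "((\<lambda>T. integrated_kernel (T * j) \<xi> (\<xi> * T * w)) \<longlongrightarrow> 0) at_top"
    proof (rule tendsto_sandwich[OF _ _ tendsto_const lim])
      show "eventually (\<lambda>T. 0 \<le> integrated_kernel (T * j) \<xi> (\<xi> * T * w)) at_top"
        using pos by eventually_elim (use assms in \<open>auto intro: integrated_kernel_nonneg\<close>)
      show "eventually (\<lambda>T. integrated_kernel (T * j) \<xi> (\<xi> * T * w) \<le> exp (\<xi> * T * w) / \<xi>) at_top"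
        using pos
      proof eventually_elim
        case (elim T)
        have "\<xi> * T * w \<le> 0" using elim assms 1 by (intro mult_nonneg_nonpos) auto
        then show ?case using integrated_kernel_le[OF assms(1), of "T * j" "\<xi> * T * w"] elim assms by simp
      qed
    qed
    then show ?thesis using 1 by simp
  next
    case 2
    have "((\<lambda>T. (1 - exp (- (\<xi> * (j - w)) * T)) / \<xi>) \<longlongrightarrow> (1 - 0) / \<xi>) at_top"
      using assms(1) 2 by (intro tendsto_divide tendsto_diff tendsto_const exp_neg_mult_tendsto_0) auto
    moreover have "eventually (\<lambda>T. (1 - exp (- (\<xi> * (j - w)) * T)) / \<xi> = integrated_kernel (T * j) \<xi> (\<xi> * T * w)) at_top"
      using pos
    proof eventually_elim
      case (elim T)
      have "\<xi> * T * w \<le> \<xi> * T * j" using elim assms(1) 2 by (intro mult_left_mono) auto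
      moreover have "0 \<le> \<xi> * T * w" using elim assms(1) 2 by simp
      ultimately show ?case
        using elim assms by (simp add: integrated_kernel_eq algebra_simps)
    qed
    ultimately have "((\<lambda>T. integrated_kernel (T * j) \<xi> (\<xi> * T * w)) \<longlongrightarrow> (1 - 0) / \<xi>) at_top"
      by (rule Lim_transform_eventually)
    then show ?thesis using 2 by simp
  next
    case 3
    have "eventually (\<lambda>T. integrated_kernel (T * j) \<xi> (\<xi> * T * w) = 0) at_top"
      using pos
    proof eventually_elim
      case (elim T)
      have "\<xi> * T * j < \<xi> * T * w" using elim assms(1) 3 by (intro mult_strict_left_mono) auto
      then show ?case using elim assms by (simp add: integrated_kernel_eq mult.assoc)
    qed
    then show ?thesis using 3 by (auto intro: tendsto_eventually)
  qed
qed

section \<open>Scaling limit of the joint cumulants\<close>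

locale supOU_limit = levy_measure_L2 a b \<mu> + ou_measure \<pi>
  for a b :: real and \<mu> \<pi> :: "real measure" +
  fixes J :: "real set" and c :: "real \<Rightarrow> real"
  assumes integrable_inverse: "integrable \<pi> (\<lambda>\<xi>. 1 / \<xi>)"
    and J: "finite J" "J \<subseteq> {0..}"
begin

definition H :: "real \<Rightarrow> real \<Rightarrow> real \<Rightarrow> real" where
  "H T \<xi> s = (\<Sum>j\<in>J. c j / sqrt T * integrated_kernel (T * j) \<xi> s)"

definition step :: "real \<Rightarrow> real" where
  "step w = (\<Sum>j\<in>J. c j * indicator {0<..<j} w)"

text \<open>An upper bound for all times in \<open>J\<close>; the sum, unlike a maximum, also makes
  sense for empty \<open>J\<close>.\<close>

definition horizon :: real where "horizon = (\<Sum>j\<in>J. j)"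

definition weight :: real where "weight = (\<Sum>j\<in>J. \<bar>c j\<bar>)"

lemma horizon: "j \<in> J \<Longrightarrow> j \<le> horizon" "0 \<le> horizon"
  using J by (auto simp: horizon_def intro!: member_le_sum sum_nonneg)

lemma measurable_H_joint [measurable]: "(\<lambda>(\<xi>, s). H T \<xi> s) \<in> borel_measurable (\<pi> \<Otimes>\<^sub>M lborel)"
  using kernel.measurable_time_integral unfolding H_def integrated_kernel_def case_prod_beta' by simp

lemma measurable_kernel_s: "0 < \<xi> \<Longrightarrow> integrated_kernel \<tau> \<xi> \<in> borel_measurable borel"
  using measurable_compose[OF measurable_Pair1' kernel.measurable_time_integral, of \<xi> \<tau>]
  by (simp add: space_pi integrated_kernel_def[abs_def])

lemma H_rescaled:
  assumes "0 < T"
  shows "centred_cumulant b \<mu> (H T \<xi> s)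
    = centred_cumulant b \<mu> ((\<Sum>j\<in>J. c j * integrated_kernel (T * j) \<xi> s) * (1 / sqrt T))"
  unfolding H_def by (simp add: sum_divide_distrib)

text \<open>The Jacobian \<xi> T of the substitution splits: T becomes the division by (1 / sqrt
  T)^2, which produces the quadratic limit of the cumulant, and \<xi> turns (step / \<xi>)^2 into
  step^2 / \<xi>.\<close>

lemma fixed_rate_limit:
  assumes "0 < \<xi>"
  shows "((\<lambda>T. \<integral>s. centred_cumulant b \<mu> (H T \<xi> s) \<partial>lborel)
    \<longlongrightarrow> of_real (- v / 2 * (\<integral>w. (step w)\<^sup>2 \<partial>lborel) * (1 / \<xi>))) at_top"
proof -
  note [measurable] = measurable_kernel_s[OF assms]
  let ?k = "centred_cumulant b \<mu>"
  let ?y = "\<lambda>T w. \<Sum>j\<in>J. c j * integrated_kernel (T * j) \<xi> (\<xi> * T * w)"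
  let ?g = "\<lambda>T w. of_real \<xi> * (?k (?y T w * (1 / sqrt T)) / of_real ((1 / sqrt T)\<^sup>2))"
  \<comment> \<open>A majorant for T \<ge> 1, where exp (\<xi> T w) \<le> exp (\<xi> w) for negative
    w. Its integral contains 1 / \<xi>^2, which does no harm while \<xi> is fixed.\<close>
  let ?B = "\<lambda>w. v / 2 * (weight\<^sup>2 / \<xi>) * (exp (2 * \<xi> * w) * indicator {..0} w + indicator {0..horizon} w)"
  have "((\<lambda>T. \<integral>w. ?g T w \<partial>lborel) \<longlongrightarrow> (\<integral>w. of_real (\<xi> * (- v / 2 * (step w / \<xi>)\<^sup>2)) \<partial>lborel)) at_top"
  proof (rule integral_dominated_convergence_at_top[where w="?B"])
    show "(\<lambda>w. of_real (\<xi> * (- v / 2 * (step w / \<xi>)\<^sup>2)) :: complex) \<in> borel_measurable lborel"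
      unfolding step_def by measurable
    show "?g T \<in> borel_measurable lborel" for T by measurable
    have "integrable lborel (\<lambda>w. exp (2 * \<xi> * w) * indicator {..0} w)"
      using has_bochner_integral_exp_atMost[of "2 * \<xi>" 0] assms by (simp add: has_bochner_integral_iff)
    then show "integrable lborel ?B"
      by (intro integrable_mult_right Bochner_Integration.integrable_add) (auto simp: integrable_indicator_iff emeasure_lborel_Icc_eq)
    have g0: "((\<lambda>T. 1 / sqrt T) \<longlongrightarrow> 0) at_top"
      by (intro tendsto_divide_0[OF tendsto_const] filterlim_at_top_imp_at_infinity sqrt_at_top)
    have gn: "eventually (\<lambda>T. 1 / sqrt T \<noteq> 0) at_top"
      using eventually_gt_at_top[of 0] by eventually_elim simp
    show "AE w in lborel. ((\<lambda>T. ?g T w) \<longlongrightarrow> of_real (\<xi> * (- v / 2 * (step w / \<xi>)\<^sup>2))) at_top"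
    proof -
      have "AE w in lborel. \<forall>j\<in>J. w \<noteq> j" by (rule AE_finite_allI[OF J(1) AE_lborel_singleton])
      moreover have "AE w in lborel. w \<noteq> (0::real)" by (rule AE_lborel_singleton)
      ultimately show ?thesis
      proof eventually_elim
        case (elim w)
        have "((\<lambda>T. ?y T w) \<longlongrightarrow> (\<Sum>j\<in>J. c j * (indicator {0<..<j} w / \<xi>))) at_top"
          using elim J assms by (intro tendsto_sum tendsto_mult tendsto_const integrated_kernel_rescaled_tendsto) auto
        also have "(\<Sum>j\<in>J. c j * (indicator {0<..<j} w / \<xi>)) = step w / \<xi>"
          by (simp add: step_def sum_divide_distrib)
        finally have "((\<lambda>T. ?y T w) \<longlongrightarrow> step w / \<xi>) at_top" .
        from centred_cumulant_scaled[OF this g0 gn]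
        have "((\<lambda>T. ?g T w) \<longlongrightarrow> of_real \<xi> * of_real (- v / 2 * (step w / \<xi>)\<^sup>2)) at_top"
          by (intro tendsto_mult tendsto_const)
        then show ?case by (simp only: of_real_mult)
      qed
    qed
    show "\<forall>\<^sub>F T in at_top. AE w in lborel. norm (?g T w) \<le> ?B w"
      using eventually_ge_at_top[of 1]
    proof eventually_elim
      case (elim T)
      show ?case
      proof (rule AE_I2)
        fix w
        define \<beta> where "\<beta> = (if w \<le> 0 then exp (\<xi> * w) else if w \<le> horizon then 1 else 0 :: real)"
        have kb: "\<bar>integrated_kernel (T * j) \<xi> (\<xi> * T * w)\<bar> \<le> \<beta> / \<xi>" if "j \<in> J" for j
        proof -
          have "0 \<le> j" using that J by auto
          then have Tj: "0 \<le> T * j" using elim by simp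
          note n = integrated_kernel_nonneg[OF assms Tj, of "\<xi> * T * w"]
          note l = integrated_kernel_le[OF assms Tj, of "\<xi> * T * w"]
          consider "w \<le> 0" | "0 < w" "w \<le> horizon" | "0 < w" "horizon < w" by linarith
          then show ?thesis
          proof cases
            case 1
            have "T * (\<xi> * w) \<le> 1 * (\<xi> * w)"
              using elim 1 assms by (intro mult_right_mono_neg) (auto simp: mult_nonneg_nonpos)
            then have "exp (min (\<xi> * T * w) 0) \<le> exp (\<xi> * w)" by (simp add: mult_ac)
            then have "exp (min (\<xi> * T * w) 0) / \<xi> \<le> exp (\<xi> * w) / \<xi>" using assms by (intro divide_right_mono) auto
            then show ?thesis using n l 1 by (simp add: \<beta>_def)
          next
            case 2
            have "exp (min (\<xi> * T * w) 0) / \<xi> \<le> 1 / \<xi>" using assms by (intro divide_right_mono) auto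
            then show ?thesis using n l 2 by (simp add: \<beta>_def)
          next
            case 3
            then have "j < w" using horizon(1)[OF that] by simp
            then have "\<xi> * T * j < \<xi> * T * w" using elim assms by (intro mult_strict_left_mono) auto
            then have "integrated_kernel (T * j) \<xi> (\<xi> * T * w) = 0"
              using integrated_kernel_eq[OF assms Tj, of "\<xi> * T * w"] by (simp add: mult.assoc)
            then show ?thesis using 3 by (simp add: \<beta>_def)
          qed
        qed
        have yb: "\<bar>?y T w\<bar> \<le> weight * (\<beta> / \<xi>)"
          unfolding weight_def by (rule abs_weighted_sum_le[OF kb])
        have y2: "(?y T w)\<^sup>2 \<le> (weight * (\<beta> / \<xi>))\<^sup>2"
          using power_mono[OF yb abs_ge_zero, of 2] by (simp only: power2_abs)
        have \<beta>2: "\<beta>\<^sup>2 \<le> exp (2 * \<xi> * w) * indicator {..0} w + indicator {0..horizon} w"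
          by (auto simp: \<beta>_def indicator_def mult.assoc exp_double)
        have "norm (?k (?y T w * (1 / sqrt T))) \<le> v / 2 * (?y T w * (1 / sqrt T))\<^sup>2"
          by (rule norm_centred_cumulant_le)
        then have "norm (?k (?y T w * (1 / sqrt T))) / (1 / sqrt T)\<^sup>2 \<le> v / 2 * (?y T w * (1 / sqrt T))\<^sup>2 / (1 / sqrt T)\<^sup>2"
          by (rule divide_right_mono) simp
        also have "\<dots> = v / 2 * (?y T w)\<^sup>2" using elim by (simp add: power_mult_distrib power_divide)
        finally have q: "norm (?k (?y T w * (1 / sqrt T))) / (1 / sqrt T)\<^sup>2 \<le> v / 2 * (?y T w)\<^sup>2" .
        have "norm (?g T w) = \<xi> * (norm (?k (?y T w * (1 / sqrt T))) / (1 / sqrt T)\<^sup>2)"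
          unfolding norm_mult norm_divide norm_of_real abs_power2 abs_of_pos[OF assms] ..
        also have "\<dots> \<le> \<xi> * (v / 2 * (?y T w)\<^sup>2)" by (rule mult_left_mono[OF q]) (use assms in simp)
        also have "\<dots> \<le> \<xi> * (v / 2 * (weight * (\<beta> / \<xi>))\<^sup>2)"
          using y2 v_nonneg assms by (intro mult_left_mono) auto
        also have "\<dots> = v / 2 * (weight\<^sup>2 / \<xi>) * \<beta>\<^sup>2"
          using assms by (simp add: power_mult_distrib power_divide power2_eq_square)
        also have "\<dots> \<le> ?B w" using \<beta>2 v_nonneg assms by (intro mult_left_mono) auto
        finally show "norm (?g T w) \<le> ?B w" .
      qed
    qed
  qed
  also have "(\<integral>w. of_real (\<xi> * (- v / 2 * (step w / \<xi>)\<^sup>2)) \<partial>lborel)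
      = complex_of_real (- v / 2 * (\<integral>w. (step w)\<^sup>2 \<partial>lborel) * (1 / \<xi>))"
  proof -
    have "\<xi> * (- v / 2 * (step w / \<xi>)\<^sup>2) = - v / 2 * (1 / \<xi>) * (step w)\<^sup>2" for w
      using assms by (simp add: power_divide power2_eq_square)
    then show ?thesis
      unfolding integral_complex_of_real by (simp only: integral_mult_right_zero) (simp add: mult_ac)
  qed
  finally have lim: "((\<lambda>T. \<integral>w. ?g T w \<partial>lborel)
      \<longlongrightarrow> of_real (- v / 2 * (\<integral>w. (step w)\<^sup>2 \<partial>lborel) * (1 / \<xi>))) at_top" .
  have "eventually (\<lambda>T. (\<integral>w. ?g T w \<partial>lborel) = (\<integral>s. ?k (H T \<xi> s) \<partial>lborel)) at_top"
    using eventually_gt_at_top[of 0]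
  proof eventually_elim
    case (elim T)
    have "(\<integral>s. ?k (H T \<xi> s) \<partial>lborel) = \<bar>\<xi> * T\<bar> *\<^sub>R (\<integral>w. ?k (H T \<xi> (0 + \<xi> * T * w)) \<partial>lborel)"
      by (rule lborel_integral_real_affine) (use elim assms in auto)
    also have "\<dots> = (\<integral>w. of_real (\<xi> * T) * ?k (?y T w * (1 / sqrt T)) \<partial>lborel)"
      using elim assms by (simp add: H_rescaled[OF elim] scaleR_conv_of_real)
    also have "\<dots> = (\<integral>w. ?g T w \<partial>lborel)"
      using elim by (intro Bochner_Integration.integral_cong) (auto simp: power_divide)
    finally show ?case by simp
  qed
  with lim show ?thesis by (rule Lim_transform_eventually)
qed

text \<open>Uniform in T and proportional to 1 / \<xi>, as domination under \<pi> demands. The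
  majorant from \<open>fixed_rate_limit\<close> would contribute 1 / \<xi>^2 from the negative
  half-line; \<open>integrated_kernel_square_le\<close> gives a better one there.\<close>

lemma fixed_rate_bound:
  assumes "0 < \<xi>" "1 \<le> T"
  shows "norm (\<integral>s. centred_cumulant b \<mu> (H T \<xi> s) \<partial>lborel) \<le> v / 2 * weight\<^sup>2 * (horizon * 3 / 2) * (1 / \<xi>)"
proof -
  note [measurable] = measurable_kernel_s[OF assms(1)]
  let ?k = "centred_cumulant b \<mu>"
  \<comment> \<open>The two summands integrate to horizon / (2 \<xi>) and horizon / \<xi>, whence
    the factor 3 / 2; T cancels in both.\<close>
  let ?B = "\<lambda>s. v / 2 * weight\<^sup>2 * (horizon / \<xi> * (exp (2 * s) * indicator {..0} s) + 1 / (\<xi>\<^sup>2 * T) * indicator {0..\<xi> * T * horizon} s)"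
  have e: "has_bochner_integral lborel (\<lambda>s. exp (2 * s) * indicator {..0} s) (1 / 2 :: real)"
    using has_bochner_integral_exp_atMost[of 2 0] by simp
  have hi: "0 \<le> \<xi> * T * horizon" using assms horizon(2) by simp
  have i: "has_bochner_integral lborel (\<lambda>s. indicator {0..\<xi> * T * horizon} s) (\<xi> * T * horizon)"
    using hi by (simp add: has_bochner_integral_iff integrable_indicator_iff emeasure_lborel_Icc_eq)
  have B: "has_bochner_integral lborel ?B (v / 2 * weight\<^sup>2 * (horizon / \<xi> * (1 / 2) + 1 / (\<xi>\<^sup>2 * T) * (\<xi> * T * horizon)))"
    by (intro has_bochner_integral_mult_right has_bochner_integral_add e i)
  have pt: "norm (?k (H T \<xi> s)) \<le> ?B s" for s
  proof -
    \<comment> \<open>For s \<le> 0 this is the square root of the mixed bound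
      \<open>integrated_kernel_square_le\<close> at \<tau> = T * horizon; squaring and dividing by T
      removes T.\<close>
    define \<beta> where "\<beta> = (if s \<le> 0 then exp s * sqrt (T * horizon / \<xi>) else if s \<le> \<xi> * T * horizon then 1 / \<xi> else 0)"
    have kb: "\<bar>integrated_kernel (T * j) \<xi> s\<bar> \<le> \<beta>" if "j \<in> J" for j
    proof -
      have "0 \<le> j" using that J by auto
      then have Tj: "0 \<le> T * j" using assms by simp
      note n = integrated_kernel_nonneg[OF assms(1) Tj, of s]
      note l = integrated_kernel_le[OF assms(1) Tj, of s]
      consider "s \<le> 0" | "0 < s" "s \<le> \<xi> * T * horizon" | "0 < s" "\<xi> * T * horizon < s" by linarith
      then show ?thesis
      proof cases
        case 1
        have "(integrated_kernel (T * j) \<xi> s)\<^sup>2 \<le> exp (2 * s) * (T * j) / \<xi>"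
          by (rule integrated_kernel_square_le[OF assms(1) Tj 1])
        also have "\<dots> \<le> exp (2 * s) * (T * horizon) / \<xi>"
          using assms horizon(1)[OF that] by (intro divide_right_mono mult_left_mono) auto
        also have "\<dots> = (exp s * sqrt (T * horizon / \<xi>))\<^sup>2"
          using assms horizon(2) by (simp add: power_mult_distrib exp_double)
        finally have "\<bar>integrated_kernel (T * j) \<xi> s\<bar> \<le> \<bar>exp s * sqrt (T * horizon / \<xi>)\<bar>"
          by (simp only: abs_le_square_iff)
        then show ?thesis using 1 assms horizon(2) by (simp add: \<beta>_def)
      next
        case 2
        then show ?thesis using n l by (simp add: \<beta>_def)
      next
        case 3
        have "\<xi> * (T * j) \<le> \<xi> * T * horizon"
          using assms horizon(1)[OF that] by (simp add: mult.assoc mult_left_mono)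
        then have "integrated_kernel (T * j) \<xi> s = 0"
          using 3 integrated_kernel_eq[OF assms(1) Tj, of s] by simp
        then show ?thesis using 3 by (simp add: \<beta>_def)
      qed
    qed
    have yb: "\<bar>\<Sum>j\<in>J. c j * integrated_kernel (T * j) \<xi> s\<bar> \<le> weight * \<beta>"
      unfolding weight_def by (rule abs_weighted_sum_le[OF kb])
    have y2: "(\<Sum>j\<in>J. c j * integrated_kernel (T * j) \<xi> s)\<^sup>2 \<le> (weight * \<beta>)\<^sup>2"
      using power_mono[OF yb abs_ge_zero, of 2] by (simp only: power2_abs)
    have \<beta>2: "\<beta>\<^sup>2 / T \<le> horizon / \<xi> * (exp (2 * s) * indicator {..0} s) + 1 / (\<xi>\<^sup>2 * T) * indicator {0..\<xi> * T * horizon} s"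
    proof -
      consider "s \<le> 0" | "0 < s" "s \<le> \<xi> * T * horizon" | "0 < s" "\<xi> * T * horizon < s" by linarith
      then show ?thesis
      proof cases
        case 1
        then have "\<beta>\<^sup>2 / T = horizon / \<xi> * exp (2 * s)"
          using assms horizon(2) by (simp add: \<beta>_def power_mult_distrib exp_double)
        then show ?thesis using 1 assms by (simp add: indicator_def)
      next
        case 2
        then show ?thesis using assms by (simp add: \<beta>_def power_divide)
      next
        case 3
        then show ?thesis by (simp add: \<beta>_def)
      qed
    qed
    have "norm (?k (H T \<xi> s)) \<le> v / 2 * ((\<Sum>j\<in>J. c j * integrated_kernel (T * j) \<xi> s) * (1 / sqrt T))\<^sup>2"
      using assms by (subst H_rescaled) (linarith, rule norm_centred_cumulant_le)
    also have "\<dots> = v / 2 * ((\<Sum>j\<in>J. c j * integrated_kernel (T * j) \<xi> s)\<^sup>2 / T)"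
      using assms by (simp add: power_mult_distrib power_divide)
    also have "\<dots> \<le> v / 2 * ((weight * \<beta>)\<^sup>2 / T)"
      using y2 v_nonneg assms by (intro mult_left_mono divide_right_mono) auto
    also have "\<dots> = v / 2 * weight\<^sup>2 * (\<beta>\<^sup>2 / T)" by (simp add: power_mult_distrib)
    also have "\<dots> \<le> ?B s" using \<beta>2 v_nonneg by (intro mult_left_mono) auto
    finally show ?thesis .
  qed
  have iB: "integrable lborel ?B" using B by (simp only: has_bochner_integral_iff)
  have "norm (\<integral>s. ?k (H T \<xi> s) \<partial>lborel) \<le> (\<integral>s. ?B s \<partial>lborel)"
  proof (rule order_trans[OF integral_norm_bound integral_mono[OF _ iB pt]])
    have [measurable]: "H T \<xi> \<in> borel_measurable borel" unfolding H_def[abs_def] by measurable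
    show "integrable lborel (\<lambda>s. norm (?k (H T \<xi> s)))"
      by (rule integrable_norm, rule Bochner_Integration.integrable_bound[OF iB])
        (auto intro!: AE_I2 order_trans[OF pt abs_ge_self] simp del: times_divide_eq_left)
  qed
  also have "\<dots> = v / 2 * weight\<^sup>2 * (horizon / \<xi> * (1 / 2) + 1 / (\<xi>\<^sup>2 * T) * (\<xi> * T * horizon))"
    using B by (simp only: has_bochner_integral_iff)
  also have "1 / (\<xi>\<^sup>2 * T) * (\<xi> * T * horizon) = horizon / \<xi>"
    using assms by (simp add: power2_eq_square)
  also have "v / 2 * weight\<^sup>2 * (horizon / \<xi> * (1 / 2) + horizon / \<xi>) = v / 2 * weight\<^sup>2 * (horizon * 3 / 2) * (1 / \<xi>)"
    by (simp add: field_simps)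
  finally show ?thesis .
qed

text \<open>Dominated convergence is nested: in w at fixed \<xi>, and then under \<pi>, where
  \<open>fixed_rate_bound\<close> and the integrability of 1 / \<xi> supply the majorant. Fubini
  returns to the product space.\<close>

theorem cumulant_limit:
  "((\<lambda>T. \<integral>x. centred_cumulant b \<mu> (\<Sum>j\<in>J. c j / sqrt T * (LBINT u:{0..T * j}. supOU_kernel u x)) \<partial>(\<pi> \<Otimes>\<^sub>M lborel))
    \<longlongrightarrow> of_real (- v / 2 * (\<integral>w. (step w)\<^sup>2 \<partial>lborel) * (\<integral>\<xi>. 1 / \<xi> \<partial>\<pi>))) at_top"
proof -
  let ?k = "centred_cumulant b \<mu>" and ?G = "\<integral>w. (step w)\<^sup>2 \<partial>lborel"
  have "((\<lambda>T. \<integral>\<xi>. (\<integral>s. ?k (H T \<xi> s) \<partial>lborel) \<partial>\<pi>) \<longlongrightarrow> (\<integral>\<xi>. of_real (- v / 2 * ?G * (1 / \<xi>)) \<partial>\<pi>)) at_top"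
  proof (rule integral_dominated_convergence_at_top)
    show "(\<lambda>\<xi>. of_real (- v / 2 * ?G * (1 / \<xi>)) :: complex) \<in> borel_measurable \<pi>"
      by (rule measurable_pi) measurable
    show "(\<lambda>\<xi>. \<integral>s. ?k (H T \<xi> s) \<partial>lborel) \<in> borel_measurable \<pi>" for T by measurable
    show "integrable \<pi> (\<lambda>\<xi>. v / 2 * weight\<^sup>2 * (horizon * 3 / 2) * (1 / \<xi>))"
      by (intro integrable_mult_right integrable_inverse)
    show "AE \<xi> in \<pi>. ((\<lambda>T. \<integral>s. ?k (H T \<xi> s) \<partial>lborel) \<longlongrightarrow> of_real (- v / 2 * ?G * (1 / \<xi>))) at_top"
      by (intro AE_I2 fixed_rate_limit) (simp add: space_pi)
    show "\<forall>\<^sub>F T in at_top. AE \<xi> in \<pi>. norm (\<integral>s. ?k (H T \<xi> s) \<partial>lborel) \<le> v / 2 * weight\<^sup>2 * (horizon * 3 / 2) * (1 / \<xi>)"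
      using eventually_ge_at_top[of 1] by eventually_elim (intro AE_I2 fixed_rate_bound, auto simp: space_pi)
  qed
  also have "(\<integral>\<xi>. of_real (- v / 2 * ?G * (1 / \<xi>)) \<partial>\<pi>) = complex_of_real (- v / 2 * ?G * (\<integral>\<xi>. 1 / \<xi> \<partial>\<pi>))"
    unfolding integral_complex_of_real by (simp only: integral_mult_right_zero)
  finally have lim: "((\<lambda>T. \<integral>\<xi>. (\<integral>s. ?k (H T \<xi> s) \<partial>lborel) \<partial>\<pi>) \<longlongrightarrow> of_real (- v / 2 * ?G * (\<integral>\<xi>. 1 / \<xi> \<partial>\<pi>))) at_top" .
  have "\<forall>\<^sub>F T in at_top. (\<integral>\<xi>. (\<integral>s. ?k (H T \<xi> s) \<partial>lborel) \<partial>\<pi>)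
      = (\<integral>x. ?k (\<Sum>j\<in>J. c j / sqrt T * (LBINT u:{0..T * j}. supOU_kernel u x)) \<partial>(\<pi> \<Otimes>\<^sub>M lborel))"
    using eventually_ge_at_top[of 0]
  proof eventually_elim
    case (elim T)
    let ?h = "\<lambda>x. \<Sum>j\<in>J. c j / sqrt T * (LBINT u:{0..T * j}. supOU_kernel u x)"
    have "integrable (\<pi> \<Otimes>\<^sub>M lborel) (\<lambda>x. (?h x)\<^sup>2)"
      using elim J by (intro integrable_square_sum kernel.time_integral_square_integrable) auto
    then have "integrable (\<pi> \<Otimes>\<^sub>M lborel) (\<lambda>x. ?k (?h x))"
      by (intro integrable_centred_cumulant(1)) measurable
    from product.integral_fst'[OF this] show ?case by (simp add: H_def integrated_kernel_def)
  qed
  with lim show ?thesis by (rule Lim_transform_eventually)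
qed

end

section \<open>Convergence of random vectors from characteristic functions\<close>

text \<open>The phases provide constants and sines and let a product of waves be a sum of waves, so
  this class is an algebra. Expectations of its members are determined by characteristic functions
  of linear combinations.\<close>

inductive trig_poly :: "'j set \<Rightarrow> (('j \<Rightarrow> real) \<Rightarrow> real) \<Rightarrow> bool" for J :: "'j set" where
  wave: "trig_poly J (\<lambda>x. cos ((\<Sum>j\<in>J. c j * x j) + \<alpha>))"
| add: "trig_poly J f \<Longrightarrow> trig_poly J g \<Longrightarrow> trig_poly J (\<lambda>x. f x + g x)"
| scale: "trig_poly J f \<Longrightarrow> trig_poly J (\<lambda>x. r * f x)"

lemma trig_poly_const: "trig_poly J (\<lambda>_. r)"
  using trig_poly.scale[OF trig_poly.wave[of J "\<lambda>_. 0" 0], of r] by simp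

lemma trig_poly_mult:
  assumes "trig_poly J f" "trig_poly J g"
  shows "trig_poly J (\<lambda>x. f x * g x)"
  using assms
proof (induction rule: trig_poly.induct)
  case (wave c \<alpha>)
  from wave.prems show ?case
  proof (induction rule: trig_poly.induct)
    case (wave d \<beta>)
    have "trig_poly J (\<lambda>x. 1 / 2 * (cos ((\<Sum>j\<in>J. (c j - d j) * x j) + (\<alpha> - \<beta>)) + cos ((\<Sum>j\<in>J. (c j + d j) * x j) + (\<alpha> + \<beta>))))"
      by (intro trig_poly.intros)
    moreover have "1 / 2 * (cos ((\<Sum>j\<in>J. (c j - d j) * x j) + (\<alpha> - \<beta>)) + cos ((\<Sum>j\<in>J. (c j + d j) * x j) + (\<alpha> + \<beta>)))
        = cos ((\<Sum>j\<in>J. c j * x j) + \<alpha>) * cos ((\<Sum>j\<in>J. d j * x j) + \<beta>)" for x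
      by (simp add: cos_times_cos left_diff_distrib distrib_right sum_subtractf sum.distrib algebra_simps)
    ultimately show ?case by simp
  qed (auto simp: distrib_left mult.left_commute intro: trig_poly.intros)
qed (auto simp: distrib_right mult.assoc intro: trig_poly.intros)

text \<open>Extensional functions on I form a product over the whole type with singleton factors
  outside I; in this form compactness of products over all indices applies.\<close>

lemma cube_eq_PiE_UNIV: "PiE I (\<lambda>_. A) = PiE UNIV (\<lambda>i. if i \<in> I then A else {undefined})"
  by (auto simp: PiE_def Pi_def extensional_def split: if_splits)

lemma compact_cube: "compact (PiE I (\<lambda>_. {-1..1::real}))"
proof -
  have "compactin (product_topology (\<lambda>_. euclideanreal) UNIV) (PiE UNIV (\<lambda>i. if i \<in> I then {-1..1} else {undefined}))"
    by (subst compactin_PiE) auto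
  then show ?thesis by (simp add: cube_eq_PiE_UNIV euclidean_product_topology)
qed

text \<open>On a box of half-width \<open>r\<close> one has \<open>x j = L * arcsin (sin (x j / L))\<close> for \<open>L = 2 * r / pi\<close>, so
  \<open>\<phi>\<close> is a continuous function of the \<open>sin (x j / L)\<close> there. Approximating it on the cube \<open>[-1, 1]\<^sup>J\<close> by
  Stone--Weierstrass gives trigonometric polynomials that are bounded uniformly outside the box too.
  The cube is indexed by natural numbers because Stone--Weierstrass requires a Hausdorff type.\<close>

lemma trig_poly_approx:
  fixes J :: "'j set" and \<phi> :: "('j \<Rightarrow> real) \<Rightarrow> real"
  assumes "finite J" and cont: "continuous_map (powertop_real J) euclideanreal \<phi>"
    and B: "\<And>x. x \<in> extensional J \<Longrightarrow> \<bar>\<phi> x\<bar> \<le> B"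
    and "0 < r" "0 < \<epsilon>"
  obtains p where "trig_poly J p" "\<And>x. x \<in> extensional J \<Longrightarrow> \<bar>p x\<bar> \<le> B + \<epsilon>"
    "\<And>x. x \<in> PiE J (\<lambda>_. {-r..r}) \<Longrightarrow> \<bar>\<phi> x - p x\<bar> < \<epsilon>"
proof -
  define L where "L = 2 * r / pi"
  have L: "0 < L" "L * (pi / 2) = r" using \<open>0 < r\<close> by (simp_all add: L_def)
  obtain h where h: "bij_betw h {..<card J} J"
    using ex_bij_betw_nat_finite[OF \<open>finite J\<close>] by (auto simp: atLeast0LessThan)
  let ?I = "{..<card J}" and ?h' = "the_inv_into {..<card J} h"
  have hJ: "h i \<in> J" if "i < card J" for i using h that by (auto simp: bij_betw_def)
  have h': "?h' j < card J" "h (?h' j) = j" if "j \<in> J" for j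
    using that h the_inv_into_into[of h ?I j ?I] f_the_inv_into_f[of h ?I j] by (auto simp: bij_betw_def)
  let ?S = "PiE ?I (\<lambda>_. {-1..1::real})"
  define \<Phi> where "\<Phi> y = \<phi> (\<lambda>j\<in>J. L * arcsin (y (?h' j)))" for y :: "nat \<Rightarrow> real"
  let ?y = "\<lambda>x. \<lambda>i\<in>?I. sin (x (h i) / L)"
  let ?P = "\<lambda>g. continuous_on ?S g \<and> trig_poly J (\<lambda>x. g (?y x))"
  have coord: "continuous_on ?S (\<lambda>y. y i)" for i
    by (rule continuous_on_subset[OF continuous_on_product_coordinates]) simp
  have "continuous_on ?S \<Phi>"
  proof -
    have "continuous_map (top_of_set ?S) (powertop_real J) (\<lambda>y. \<lambda>j\<in>J. L * arcsin (y (?h' j)))"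
      unfolding continuous_map_componentwise
    proof (intro conjI ballI)
      fix j assume "j \<in> J"
      then have "continuous_on ?S (\<lambda>y. L * arcsin (y (?h' j)))"
        using h'(1)[of j] by (intro continuous_intros coord) (auto simp: PiE_iff)
      then show "continuous_map (top_of_set ?S) euclideanreal (\<lambda>y. (\<lambda>j\<in>J. L * arcsin (y (?h' j))) j)"
        using \<open>j \<in> J\<close> by simp
    qed auto
    from continuous_map_compose[OF this cont] show ?thesis by (simp add: \<Phi>_def[abs_def] o_def)
  qed
  have sep: "\<exists>g. ?P g \<and> g x \<noteq> g y" if xy: "x \<in> ?S" "y \<in> ?S" "x \<noteq> y" for x y
  proof -
    obtain i where i: "x i \<noteq> y i" using xy(3) by blast
    then have "i < card J" using xy by (auto simp: PiE_def extensional_def)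
    \<comment> \<open>A coordinate sine is a wave with phase - pi / 2 whose coefficients select one
      index; it is the pullback of a coordinate of the cube, and coordinates separate
      points.\<close>
    have "trig_poly J (\<lambda>x. cos ((\<Sum>j\<in>J. (if j = h i then 1 / L else 0) * x j) + - (pi / 2)))"
      by (rule trig_poly.wave)
    moreover have "(\<Sum>j\<in>J. (if j = h i then 1 / L else 0) * x j) = x (h i) / L" for x :: "'j \<Rightarrow> real"
      using \<open>finite J\<close> hJ[OF \<open>i < card J\<close>] by (simp add: if_distrib[of "\<lambda>c. c * _"] cong: if_cong)
    moreover have "cos (t + - (pi / 2)) = sin t" for t :: real by (simp add: cos_diff flip: diff_conv_add_uminus)
    ultimately have "trig_poly J (\<lambda>x. sin (x (h i) / L))" by simp
    then show ?thesis using coord[of i] i \<open>i < card J\<close> by (intro exI[of _ "\<lambda>y. y i"]) simp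
  qed
  \<comment> \<open>The algebra consists of the continuous functions on the cube whose pullback
    along \<open>?y\<close> is a trigonometric polynomial.\<close>
  have "\<exists>g. ?P g \<and> (\<forall>y\<in>?S. \<bar>\<Phi> y - g y\<bar> < \<epsilon>)"
    by (rule Stone_Weierstrass_HOL[where P="?P", OF compact_cube])
      (use sep \<open>continuous_on ?S \<Phi>\<close> \<open>0 < \<epsilon>\<close> in \<open>auto intro: trig_poly_const trig_poly.intros trig_poly_mult continuous_intros\<close>)
  then obtain g where g: "trig_poly J (\<lambda>x. g (?y x))" "\<And>y. y \<in> ?S \<Longrightarrow> \<bar>\<Phi> y - g y\<bar> < \<epsilon>"
    by blast
  have inS: "?y x \<in> ?S" for x :: "'j \<Rightarrow> real" by (auto simp: PiE_iff)
  show ?thesis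
  proof (rule that[OF g(1)])
    fix x :: "'j \<Rightarrow> real"
    have "\<bar>\<Phi> (?y x)\<bar> \<le> B" unfolding \<Phi>_def by (rule B) auto
    then show "\<bar>g (?y x)\<bar> \<le> B + \<epsilon>" using g(2)[OF inS[of x]] by linarith
    assume x: "x \<in> PiE J (\<lambda>_. {-r..r})"
    have "(\<lambda>j\<in>J. L * arcsin (?y x (?h' j))) = x"
    proof
      fix j
      show "(\<lambda>j\<in>J. L * arcsin (?y x (?h' j))) j = x j"
      proof (cases "j \<in> J")
        case True
        then have "- r \<le> x j" "x j \<le> r" using x by (auto simp: PiE_iff)
        then have "- (pi / 2) \<le> x j / L" "x j / L \<le> pi / 2" using L by (auto simp: field_simps)
        then show ?thesis using True L h'[OF True] by (simp add: arcsin_sin)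
      next
        case False
        then show ?thesis using x by (auto simp: PiE_def extensional_def)
      qed
    qed
    then have "\<Phi> (?y x) = \<phi> x" by (simp add: \<Phi>_def)
    then show "\<bar>\<phi> x - g (?y x)\<bar> < \<epsilon>" using g(2)[OF inS[of x]] by simp
  qed
qed

lemma (in prob_space) trig_poly_expectation:
  assumes "finite J" and V: "\<And>j. j \<in> J \<Longrightarrow> V j \<in> borel_measurable M" and "trig_poly J p"
  shows "integrable M (\<lambda>\<omega>. p (\<lambda>j\<in>J. V j \<omega>))"
  using assms(3)
proof (induction rule: trig_poly.induct)
  case (wave c \<alpha>)
  show ?case
    by (rule integrable_const_bound[where B=1]) (use V in auto)
qed auto

lemma trig_poly_expectation_tendsto:
  assumes M: "prob_space M" "prob_space N" and "finite J"
    and V: "\<And>n j. j \<in> J \<Longrightarrow> V n j \<in> borel_measurable M" "\<And>j. j \<in> J \<Longrightarrow> W j \<in> borel_measurable N"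
    and conv: "\<And>c. ((\<lambda>n. char (distr M borel (\<lambda>\<omega>. \<Sum>j\<in>J. c j * V n j \<omega>)) 1)
        \<longlongrightarrow> char (distr N borel (\<lambda>\<omega>. \<Sum>j\<in>J. c j * W j \<omega>)) 1) F"
    and "trig_poly J p"
  shows "((\<lambda>n. \<integral>\<omega>. p (\<lambda>j\<in>J. V n j \<omega>) \<partial>M) \<longlongrightarrow> (\<integral>\<omega>. p (\<lambda>j\<in>J. W j \<omega>) \<partial>N)) F"
  using assms(7)
proof (induction rule: trig_poly.induct)
  case (wave c \<alpha>)
  have eq: "(\<integral>\<omega>. cos ((\<Sum>j\<in>J. c j * (\<lambda>j\<in>J. U j \<omega>) j) + \<alpha>) \<partial>P)
      = Re (iexp \<alpha> * char (distr P borel (\<lambda>\<omega>. \<Sum>j\<in>J. c j * U j \<omega>)) 1)"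
    if "prob_space P" and [measurable]: "\<And>j. j \<in> J \<Longrightarrow> U j \<in> borel_measurable P" for P :: "'z measure" and U
  proof -
    interpret P: prob_space P by fact
    have i: "integrable P (\<lambda>\<omega>. iexp \<alpha> * iexp (1 * (\<Sum>j\<in>J. c j * U j \<omega>)))"
      by (intro integrable_mult_right P.integrable_iexp) auto
    have "iexp \<alpha> * char (distr P borel (\<lambda>\<omega>. \<Sum>j\<in>J. c j * U j \<omega>)) 1 = (\<integral>\<omega>. iexp \<alpha> * iexp (1 * (\<Sum>j\<in>J. c j * U j \<omega>)) \<partial>P)"
      by (subst char_distr) auto
    also have "Re \<dots> = (\<integral>\<omega>. Re (iexp \<alpha> * iexp (1 * (\<Sum>j\<in>J. c j * U j \<omega>))) \<partial>P)"
      by (rule integral_Re[OF i, symmetric])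
    also have "\<dots> = (\<integral>\<omega>. cos ((\<Sum>j\<in>J. c j * (\<lambda>j\<in>J. U j \<omega>) j) + \<alpha>) \<partial>P)"
    proof (intro Bochner_Integration.integral_cong refl)
      fix \<omega>
      have "iexp \<alpha> * iexp (1 * (\<Sum>j\<in>J. c j * U j \<omega>)) = iexp ((\<Sum>j\<in>J. c j * U j \<omega>) + \<alpha>)"
        by (simp add: algebra_simps flip: exp_add)
      then show "Re (iexp \<alpha> * iexp (1 * (\<Sum>j\<in>J. c j * U j \<omega>))) = cos ((\<Sum>j\<in>J. c j * (\<lambda>j\<in>J. U j \<omega>) j) + \<alpha>)"
        by (simp add: Re_exp)
    qed
    finally show ?thesis by simp
  qed
  show ?case
    using eq[OF M(1) V(1)] eq[OF M(2) V(2)] by (simp only:) (intro tendsto_Re tendsto_mult tendsto_const conv)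
next
  case (add f g)
  have i: "integrable M (\<lambda>\<omega>. h (\<lambda>j\<in>J. V n j \<omega>))" "integrable N (\<lambda>\<omega>. h (\<lambda>j\<in>J. W j \<omega>))" if "trig_poly J h" for h n
    by (rule prob_space.trig_poly_expectation[OF _ \<open>finite J\<close> _ that], fact M, fact V)+
  show ?case
    unfolding Bochner_Integration.integral_add[OF i(1)[OF add.hyps(1)] i(1)[OF add.hyps(2)]]
      Bochner_Integration.integral_add[OF i(2)[OF add.hyps(1)] i(2)[OF add.hyps(2)]]
    by (rule tendsto_add[OF add.IH])
next
  case (scale f r)
  then show ?case by (simp add: tendsto_mult_left)
qed

text \<open>A continuous substitute for the indicator of a tail: it is 0 for |x| \<le> k and 1 for
  |x| \<ge> k + 1, so its expectation passes through weak convergence.\<close>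

definition excess :: "real \<Rightarrow> real \<Rightarrow> real" where
  "excess k x = min 1 (max 0 (\<bar>x\<bar> - k))"

lemma excess_bounds: "0 \<le> excess k x" "excess k x \<le> 1"
  and excess_eq_1: "k + 1 \<le> \<bar>x\<bar> \<Longrightarrow> excess k x = 1"
  by (auto simp: excess_def)

lemma isCont_excess: "isCont (excess k) x"
proof -
  have "continuous_on UNIV (excess k)"
    unfolding excess_def[abs_def] by (intro continuous_intros)
  then show ?thesis by (simp add: continuous_on_eq_continuous_at)
qed

lemma measurable_excess [measurable]: "excess k \<in> borel_measurable borel"
  by (intro borel_measurable_continuous_onI continuous_at_imp_continuous_on ballI isCont_excess)

lemma (in prob_space) excess_expectation_tendsto_0:
  assumes [measurable]: "W \<in> borel_measurable M"
  shows "(\<lambda>n. \<integral>\<omega>. excess (real n) (W \<omega>) \<partial>M) \<longlonglongrightarrow> 0"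
proof -
  have "(\<lambda>n. \<integral>\<omega>. excess (real n) (W \<omega>) \<partial>M) \<longlonglongrightarrow> (\<integral>\<omega>. 0 \<partial>M)"
  proof (rule integral_dominated_convergence[where w="\<lambda>_. 1"])
    show "AE \<omega> in M. (\<lambda>n. excess (real n) (W \<omega>)) \<longlonglongrightarrow> 0"
    proof (rule AE_I2, rule tendsto_eventually)
      fix \<omega>
      obtain m :: nat where "\<bar>W \<omega>\<bar> \<le> real m" using real_arch_simple by blast
      then show "\<forall>\<^sub>F n in sequentially. excess (real n) (W \<omega>) = 0"
        by (intro eventually_sequentiallyI[of m]) (auto simp: excess_def)
    qed
    show "AE \<omega> in M. norm (excess (real n) (W \<omega>)) \<le> 1" for n
      using excess_bounds by (intro AE_I2) (simp add: abs_le_iff order_trans[OF _ excess_bounds(1)])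
  qed auto
  then show ?thesis by simp
qed

text \<open>Where some coordinate reaches k + 1 in modulus, its excess is 1 and pays for the crude
  bound 2 B + \<epsilon> on |\<phi> - p|; elsewhere the approximation on the box applies.\<close>

lemma (in prob_space) expectation_approx:
  assumes "finite J" and V[measurable]: "\<And>j. j \<in> J \<Longrightarrow> V j \<in> borel_measurable M"
    and \<phi>: "(\<lambda>\<omega>. \<phi> (\<lambda>j\<in>J. V j \<omega>)) \<in> borel_measurable M" "\<And>x. x \<in> extensional J \<Longrightarrow> \<bar>\<phi> x\<bar> \<le> B"
    and p: "trig_poly J p" "\<And>x. x \<in> extensional J \<Longrightarrow> \<bar>p x\<bar> \<le> B + \<epsilon>"
      "\<And>x. x \<in> PiE J (\<lambda>_. {-(k+1)..k+1}) \<Longrightarrow> \<bar>\<phi> x - p x\<bar> < \<epsilon>"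
    and "0 < \<epsilon>" "0 \<le> B"
  shows "\<bar>(\<integral>\<omega>. \<phi> (\<lambda>j\<in>J. V j \<omega>) \<partial>M) - (\<integral>\<omega>. p (\<lambda>j\<in>J. V j \<omega>) \<partial>M)\<bar>
    \<le> \<epsilon> + (2 * B + \<epsilon>) * (\<Sum>j\<in>J. \<integral>\<omega>. excess k (V j \<omega>) \<partial>M)"
proof -
  have pt: "\<bar>\<phi> x - p x\<bar> \<le> \<epsilon> + (2 * B + \<epsilon>) * (\<Sum>j\<in>J. excess k (x j))" if x: "x \<in> extensional J" for x
  proof (cases "\<exists>j\<in>J. k + 1 \<le> \<bar>x j\<bar>")
    case True
    then obtain j where j: "j \<in> J" "k + 1 \<le> \<bar>x j\<bar>" by blast
    have "1 \<le> (\<Sum>j\<in>J. excess k (x j))"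
      using member_le_sum[OF j(1), of "\<lambda>j. excess k (x j)"] excess_bounds(1) \<open>finite J\<close> excess_eq_1[OF j(2)] by simp
    then have "(2 * B + \<epsilon>) * 1 \<le> (2 * B + \<epsilon>) * (\<Sum>j\<in>J. excess k (x j))"
      using \<open>0 < \<epsilon>\<close> \<open>0 \<le> B\<close> by (intro mult_left_mono) auto
    moreover have "\<bar>\<phi> x - p x\<bar> \<le> 2 * B + \<epsilon>" using \<phi>(2)[OF x] p(2)[OF x] by linarith
    moreover have "u \<le> e + s" if "u \<le> q" "q * 1 \<le> s" "0 < e" for u q s e :: real
      using that by simp
    ultimately show ?thesis using \<open>0 < \<epsilon>\<close> by blast
  next
    case False
    then have "x \<in> PiE J (\<lambda>_. {-(k+1)..k+1})" using x by (force simp: PiE_iff abs_le_iff not_le)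
    from p(3)[OF this] have "\<bar>\<phi> x - p x\<bar> < \<epsilon>" .
    moreover have "0 \<le> (2 * B + \<epsilon>) * (\<Sum>j\<in>J. excess k (x j))"
      using \<open>0 < \<epsilon>\<close> \<open>0 \<le> B\<close> by (intro mult_nonneg_nonneg sum_nonneg excess_bounds) auto
    ultimately show ?thesis by linarith
  qed
  have i\<phi>: "integrable M (\<lambda>\<omega>. \<phi> (\<lambda>j\<in>J. V j \<omega>))"
    by (rule integrable_const_bound[OF _ \<phi>(1), where B=B]) (auto intro!: AE_I2 \<phi>(2))
  have ip: "integrable M (\<lambda>\<omega>. p (\<lambda>j\<in>J. V j \<omega>))" by (rule trig_poly_expectation[OF \<open>finite J\<close> V p(1)])
  have ie: "integrable M (\<lambda>\<omega>. excess k (V j \<omega>))" if "j \<in> J" for j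
    using excess_bounds that by (intro integrable_const_bound[where B=1]) (auto simp: abs_le_iff order_trans[OF _ excess_bounds(1)])
  have "\<bar>(\<integral>\<omega>. \<phi> (\<lambda>j\<in>J. V j \<omega>) \<partial>M) - (\<integral>\<omega>. p (\<lambda>j\<in>J. V j \<omega>) \<partial>M)\<bar> = norm (\<integral>\<omega>. \<phi> (\<lambda>j\<in>J. V j \<omega>) - p (\<lambda>j\<in>J. V j \<omega>) \<partial>M)"
    by (simp add: Bochner_Integration.integral_diff[OF i\<phi> ip])
  also have "\<dots> \<le> (\<integral>\<omega>. norm (\<phi> (\<lambda>j\<in>J. V j \<omega>) - p (\<lambda>j\<in>J. V j \<omega>)) \<partial>M)" by (rule integral_norm_bound)
  also have "\<dots> \<le> (\<integral>\<omega>. \<epsilon> + (2 * B + \<epsilon>) * (\<Sum>j\<in>J. excess k (V j \<omega>)) \<partial>M)"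
  proof (rule integral_mono)
    show "norm (\<phi> (\<lambda>j\<in>J. V j \<omega>) - p (\<lambda>j\<in>J. V j \<omega>)) \<le> \<epsilon> + (2 * B + \<epsilon>) * (\<Sum>j\<in>J. excess k (V j \<omega>))" for \<omega>
      using pt[of "\<lambda>j\<in>J. V j \<omega>"] by simp
  qed (auto intro!: Bochner_Integration.integrable_diff i\<phi> ip Bochner_Integration.integrable_add integrable_mult_right Bochner_Integration.integrable_sum ie)
  also have "\<dots> = \<epsilon> + (2 * B + \<epsilon>) * (\<Sum>j\<in>J. \<integral>\<omega>. excess k (V j \<omega>) \<partial>M)"
    by (subst Bochner_Integration.integral_add)
      (auto simp: prob_space Bochner_Integration.integral_sum[OF ie] intro!: integrable_mult_right Bochner_Integration.integrable_sum ie)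
  finally show ?thesis .
qed

text \<open>\<phi> is the pointwise limit of trigonometric polynomials that are accurate to 1 / n on
  boxes of half-width n, since each point lies in all late boxes. Measurability of these polynomials
  is immediate.\<close>

lemma (in prob_space) measurable_continuous_finite_product:
  assumes "finite J" and V: "\<And>j. j \<in> J \<Longrightarrow> V j \<in> borel_measurable M"
    and cont: "continuous_map (powertop_real J) euclideanreal \<phi>"
    and B: "\<And>x. x \<in> extensional J \<Longrightarrow> \<bar>\<phi> x\<bar> \<le> B"
  shows "(\<lambda>\<omega>. \<phi> (\<lambda>j\<in>J. V j \<omega>)) \<in> borel_measurable M"
proof -
  have "\<exists>p. trig_poly J p \<and> (\<forall>x\<in>PiE J (\<lambda>_. {- real (Suc n)..real (Suc n)}). \<bar>\<phi> x - p x\<bar> < 1 / real (Suc n))" for n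
    using trig_poly_approx[OF \<open>finite J\<close> cont B, of "real (Suc n)" "1 / real (Suc n)"] by (metis of_nat_0_less_iff zero_less_Suc zero_less_divide_1_iff)
  then obtain p where p: "\<And>n. trig_poly J (p n)"
    "\<And>n x. x \<in> PiE J (\<lambda>_. {- real (Suc n)..real (Suc n)}) \<Longrightarrow> \<bar>\<phi> x - p n x\<bar> < 1 / real (Suc n)"
    by metis
  show ?thesis
  proof (rule borel_measurable_LIMSEQ_real)
    show "(\<lambda>\<omega>. p n (\<lambda>j\<in>J. V j \<omega>)) \<in> borel_measurable M" for n
      using trig_poly_expectation[OF \<open>finite J\<close> V p(1)] by (rule borel_measurable_integrable)
    fix \<omega>
    let ?x = "\<lambda>j\<in>J. V j \<omega>"
    obtain m :: nat where "(\<Sum>j\<in>J. \<bar>V j \<omega>\<bar>) \<le> real m" using real_arch_simple by blast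
    then have m: "\<bar>V j \<omega>\<bar> \<le> real m" if "j \<in> J" for j
      using member_le_sum[OF that, of "\<lambda>j. \<bar>V j \<omega>\<bar>"] \<open>finite J\<close> by simp
    have "\<forall>\<^sub>F n in sequentially. norm (p n ?x - \<phi> ?x) \<le> 1 / real (Suc n)"
    proof (rule eventually_sequentiallyI[of m])
      fix n assume "m \<le> n"
      then have "?x \<in> PiE J (\<lambda>_. {- real (Suc n)..real (Suc n)})"
        using m by (fastforce simp: PiE_iff abs_le_iff)
      from p(2)[OF this] show "norm (p n ?x - \<phi> ?x) \<le> 1 / real (Suc n)" by (simp add: abs_minus_commute del: of_nat_Suc)
    qed
    then have "(\<lambda>n. p n ?x - \<phi> ?x) \<longlonglongrightarrow> 0"
      by (rule Lim_null_comparison) (use LIMSEQ_inverse_real_of_nat in \<open>simp add: inverse_eq_divide\<close>)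
    then show "(\<lambda>n. p n ?x) \<longlonglongrightarrow> \<phi> ?x" by (rule LIM_zero_cancel)
  qed
qed

text \<open>Weak convergence of the single coordinates controls the tails of \<open>V n\<close> for
  all large n by those of \<open>W\<close>. With the tails under control, the expectation of \<phi>
  is close to that of a trigonometric polynomial on both spaces.\<close>

theorem cramer_wold_sequence:
  fixes V :: "nat \<Rightarrow> 'j \<Rightarrow> 'w \<Rightarrow> real" and W :: "'j \<Rightarrow> 'v \<Rightarrow> real"
  assumes M: "prob_space M" "prob_space N" and J: "finite J"
    and V: "\<And>n j. j \<in> J \<Longrightarrow> V n j \<in> borel_measurable M" and W: "\<And>j. j \<in> J \<Longrightarrow> W j \<in> borel_measurable N"
    and conv: "\<And>c. (\<lambda>n. char (distr M borel (\<lambda>\<omega>. \<Sum>j\<in>J. c j * V n j \<omega>)) 1)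
        \<longlonglongrightarrow> char (distr N borel (\<lambda>\<omega>. \<Sum>j\<in>J. c j * W j \<omega>)) 1"
    and cont: "continuous_map (powertop_real J) euclideanreal \<phi>"
    and B: "\<And>x. x \<in> extensional J \<Longrightarrow> \<bar>\<phi> x\<bar> \<le> B"
  shows "(\<lambda>n. \<integral>\<omega>. \<phi> (\<lambda>j\<in>J. V n j \<omega>) \<partial>M) \<longlonglongrightarrow> (\<integral>\<omega>. \<phi> (\<lambda>j\<in>J. W j \<omega>) \<partial>N)"
proof (rule LIMSEQ_I)
  interpret M: prob_space M by fact
  interpret N: prob_space N by fact
  note [measurable] = V W
  have B0: "0 \<le> B" using B[of "\<lambda>j\<in>J. 0"] by (meson abs_ge_zero order_trans restrict_extensional)
  fix r :: real assume "0 < r"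
  \<comment> \<open>The minimum with 1 bounds 2 B + \<epsilon> by 2 B + 1, so each approximation
    error is at most 2 (B + 1) \<epsilon> \<le> r / 4. Two of these and r / 4 for the polynomial
    stay below r.\<close>
  define \<epsilon> where "\<epsilon> = min 1 (r / (8 * (B + 1)))"
  have \<epsilon>: "0 < \<epsilon>" "\<epsilon> \<le> 1" "\<epsilon> * (8 * (B + 1)) \<le> r"
  proof -
    have "\<epsilon> \<le> r / (8 * (B + 1))" by (simp add: \<epsilon>_def)
    then show "\<epsilon> * (8 * (B + 1)) \<le> r" using B0 by (subst (asm) pos_le_divide_eq) auto
  qed (use \<open>0 < r\<close> B0 in \<open>auto simp: \<epsilon>_def\<close>)
  have small: "\<epsilon> + (2 * B + \<epsilon>) * q \<le> r / 4" if "q < \<epsilon>" for q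
  proof -
    have "(2 * B + \<epsilon>) * q \<le> (2 * B + 1) * \<epsilon>" 
    proof (cases "0 \<le> q")
      case True
      then show ?thesis using that \<epsilon> B0 by (intro mult_mono) auto
    next
      case False
      then have "(2 * B + \<epsilon>) * q \<le> 0" using \<epsilon> B0 by (intro mult_nonneg_nonpos) auto
      also have "0 \<le> (2 * B + 1) * \<epsilon>" using \<epsilon> B0 by simp
      finally show ?thesis .
    qed
    then have "\<epsilon> + (2 * B + \<epsilon>) * q \<le> \<epsilon> * (8 * (B + 1)) / 4" by (simp add: algebra_simps)
    also have "\<dots> \<le> r / 4" using \<epsilon>(3) by (rule divide_right_mono) simp
    finally show ?thesis .
  qed
  have "(\<lambda>k. \<Sum>j\<in>J. \<integral>\<omega>. excess (real k) (W j \<omega>) \<partial>N) \<longlonglongrightarrow> (\<Sum>j\<in>J. 0)"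
    by (intro tendsto_sum N.excess_expectation_tendsto_0 W)
  then have "(\<lambda>k. \<Sum>j\<in>J. \<integral>\<omega>. excess (real k) (W j \<omega>) \<partial>N) \<longlonglongrightarrow> 0" by simp
  from order_tendstoD(2)[OF this \<epsilon>(1)] obtain k :: nat
    where k: "(\<Sum>j\<in>J. \<integral>\<omega>. excess (real k) (W j \<omega>) \<partial>N) < \<epsilon>"
    by (auto dest: eventually_happens)
  have "(\<lambda>n. \<integral>\<omega>. excess (real k) (V n j \<omega>) \<partial>M) \<longlonglongrightarrow> (\<integral>\<omega>. excess (real k) (W j \<omega>) \<partial>N)" if j: "j \<in> J" for j
  proof -
    note [measurable] = V[OF j] W[OF j]
    \<comment> \<open>Weights concentrated on one index turn the assumption on linear combinations
      into convergence of the characteristic function of that coordinate.\<close>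
    have "weak_conv_m (\<lambda>n. distr M borel (V n j)) (distr N borel (W j))"
    proof (rule levy_continuity)
      fix t
      have s: "(\<Sum>i\<in>J. (if i = j then t else 0) * U i) = t * U j" for U :: "'j \<Rightarrow> real"
        using j J by (simp add: if_distrib[of "\<lambda>c. c * _"] cong: if_cong)
      have e: "char (distr P borel (\<lambda>\<omega>. t * U \<omega>)) 1 = char (distr P borel U) t"
        if "U \<in> borel_measurable P" for P :: "'z measure" and U
        using that by (simp add: char_distr)
      show "(\<lambda>n. char (distr M borel (V n j)) t) \<longlonglongrightarrow> char (distr N borel (W j)) t"
        using conv[of "\<lambda>i. if i = j then t else 0"] unfolding s e[OF V[OF j]] e[OF W[OF j]] .
    qed (simp_all add: M.real_distribution_distr N.real_distribution_distr)
    then have "(\<lambda>n. integral\<^sup>L (distr M borel (V n j)) (excess (real k))) \<longlonglongrightarrow> integral\<^sup>L (distr N borel (W j)) (excess (real k))"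
      using excess_bounds by (intro weak_conv_imp_integral_bdd_continuous_conv[where B=1])
        (auto simp: M.real_distribution_distr N.real_distribution_distr abs_le_iff isCont_excess order_trans[OF _ excess_bounds(1)])
    then show ?thesis by (simp add: integral_distr)
  qed
  then have "(\<lambda>n. \<Sum>j\<in>J. \<integral>\<omega>. excess (real k) (V n j \<omega>) \<partial>M) \<longlonglongrightarrow> (\<Sum>j\<in>J. \<integral>\<omega>. excess (real k) (W j \<omega>) \<partial>N)"
    by (intro tendsto_sum)
  from order_tendstoD(2)[OF this k]
  have ev1: "\<forall>\<^sub>F n in sequentially. (\<Sum>j\<in>J. \<integral>\<omega>. excess (real k) (V n j \<omega>) \<partial>M) < \<epsilon>" .
  obtain p where p: "trig_poly J p" "\<And>x. x \<in> extensional J \<Longrightarrow> \<bar>p x\<bar> \<le> B + \<epsilon>"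
    "\<And>x. x \<in> PiE J (\<lambda>_. {-(real k + 1)..real k + 1}) \<Longrightarrow> \<bar>\<phi> x - p x\<bar> < \<epsilon>"
    using trig_poly_approx[OF J cont B, of "real k + 1" \<epsilon>] \<epsilon>(1) by (metis add_nonneg_pos of_nat_0_le_iff zero_less_one)
  have "(\<lambda>n. \<integral>\<omega>. p (\<lambda>j\<in>J. V n j \<omega>) \<partial>M) \<longlonglongrightarrow> (\<integral>\<omega>. p (\<lambda>j\<in>J. W j \<omega>) \<partial>N)"
    by (rule trig_poly_expectation_tendsto[OF M J V W conv p(1)])
  from tendstoD[OF this, of "r / 4"] \<open>0 < r\<close>
  have ev2: "\<forall>\<^sub>F n in sequentially. \<bar>(\<integral>\<omega>. p (\<lambda>j\<in>J. V n j \<omega>) \<partial>M) - (\<integral>\<omega>. p (\<lambda>j\<in>J. W j \<omega>) \<partial>N)\<bar> < r / 4"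
    by (simp add: dist_real_def)
  have mV: "(\<lambda>\<omega>. \<phi> (\<lambda>j\<in>J. V n j \<omega>)) \<in> borel_measurable M" for n
    by (rule M.measurable_continuous_finite_product[OF J _ cont], fact V, fact B)
  have mW: "(\<lambda>\<omega>. \<phi> (\<lambda>j\<in>J. W j \<omega>)) \<in> borel_measurable N"
    by (rule N.measurable_continuous_finite_product[OF J _ cont], fact W, fact B)
  have b: "\<bar>(\<integral>\<omega>. \<phi> (\<lambda>j\<in>J. W j \<omega>) \<partial>N) - (\<integral>\<omega>. p (\<lambda>j\<in>J. W j \<omega>) \<partial>N)\<bar> \<le> r / 4"
    by (rule order_trans[OF N.expectation_approx small[OF k]])
      (fact J W mW B p \<epsilon>(1) B0)+
  have "\<forall>\<^sub>F n in sequentially. norm ((\<integral>\<omega>. \<phi> (\<lambda>j\<in>J. V n j \<omega>) \<partial>M) - (\<integral>\<omega>. \<phi> (\<lambda>j\<in>J. W j \<omega>) \<partial>N)) < r"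
    using ev1 ev2
  proof eventually_elim
    case (elim n)
    have "\<bar>(\<integral>\<omega>. \<phi> (\<lambda>j\<in>J. V n j \<omega>) \<partial>M) - (\<integral>\<omega>. p (\<lambda>j\<in>J. V n j \<omega>) \<partial>M)\<bar> \<le> r / 4"
      by (rule order_trans[OF M.expectation_approx small[OF elim(1)]])
        (fact J V mV B p \<epsilon>(1) B0)+
    moreover have "norm (x - w) < r" if "\<bar>x - p\<bar> \<le> r / 4" "\<bar>w - q\<bar> \<le> r / 4" "\<bar>p - q\<bar> < r / 4" for x w p q :: real
    proof -
      have "x - w = (x - p) + (p - q) + (q - w)" by simp
      then have "norm (x - w) \<le> \<bar>x - p\<bar> + \<bar>p - q\<bar> + \<bar>w - q\<bar>"
        by (metis abs_minus_commute abs_triangle_ineq add_mono_thms_linordered_semiring(3) order_trans real_norm_def)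
      also have "\<dots> < r / 4 + r / 4 + r / 4" by (intro add_less_le_mono add_le_less_mono that)
      also have "\<dots> \<le> r" using \<open>0 < r\<close> by simp
      finally show ?thesis .
    qed
    ultimately show ?case using b elim(2) by blast
  qed
  then show "\<exists>no. \<forall>n\<ge>no. norm ((\<integral>\<omega>. \<phi> (\<lambda>j\<in>J. V n j \<omega>) \<partial>M) - (\<integral>\<omega>. \<phi> (\<lambda>j\<in>J. W j \<omega>) \<partial>N)) < r"
    by (simp add: eventually_sequentially)
qed

section \<open>Linear combinations of Brownian motion and the limit theorem\<close>

lemma (in prob_space) char_normal:
  assumes "0 < s" and D: "distributed M lborel D (normal_density 0 s)"
  shows "char (distr M borel D) \<zeta> = of_real (exp (- (s\<^sup>2 * \<zeta>\<^sup>2) / 2))"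
proof -
  have [measurable]: "D \<in> borel_measurable M" using distributed_measurable[OF D] by simp
  have "distributed M lborel (\<lambda>\<omega>. (D \<omega> - 0) / s) std_normal_density"
    using D normal_standard_normal_convert[OF \<open>0 < s\<close>, of D 0] by simp
  then have "distr M borel (\<lambda>\<omega>. D \<omega> / s) = std_normal_distribution"
    by (simp add: distributed_def cong: distr_cong)
  then have "char (distr M borel (\<lambda>\<omega>. D \<omega> / s)) (s * \<zeta>) = of_real (exp (- ((s * \<zeta>)\<^sup>2) / 2))"
    by (simp add: char_std_normal_distribution)
  moreover have "char (distr M borel (\<lambda>\<omega>. D \<omega> / s)) (s * \<zeta>) = char (distr M borel D) \<zeta>"
    using \<open>0 < s\<close> by (simp add: char_distr)
  ultimately show ?thesis by (simp add: power_mult_distrib)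
qed

text \<open>Summation by parts along an increasing enumeration \<open>0 = t 0 < \<dots> < t n\<close> of \<open>insert 0 J\<close>.\<close>

locale time_grid =
  fixes J :: "real set" and c :: "real \<Rightarrow> real" and t :: "nat \<Rightarrow> real" and n :: nat
  assumes finite_J: "finite J" and t0: "t 0 = 0" and mono_t: "mono t"
    and strict_t: "\<And>i k. i < k \<Longrightarrow> k \<le> n \<Longrightarrow> t i < t k" and J_t: "J \<subseteq> t ` {..n}"
begin

text \<open>The total weight of the times still ahead at \<open>t i\<close>: the coefficient of the
  i-th increment and also the value of the step function between \<open>t i\<close> and
  \<open>t (Suc i)\<close>.\<close>

definition slope :: "nat \<Rightarrow> real" where "slope i = (\<Sum>j\<in>J. if t i < j then c j else 0)"

lemma sum_by_parts:
  fixes \<beta> :: "real \<Rightarrow> real"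
  shows "(\<Sum>j\<in>J. c j * (\<beta> j - \<beta> 0)) = (\<Sum>i<n. slope i * (\<beta> (t (Suc i)) - \<beta> (t i)))"
proof -
  have "\<beta> j - \<beta> 0 = (\<Sum>i<n. if t i < j then \<beta> (t (Suc i)) - \<beta> (t i) else 0)" if j: "j \<in> J" for j
  proof -
    obtain m where m: "m \<le> n" "j = t m" using j J_t by auto
    have "t i < t m \<longleftrightarrow> i < m" if "i < n" for i
      using strict_t[of i m] strict_t[of m i] m that by (cases i m rule: linorder_cases) auto
    then have "(\<Sum>i<n. if t i < j then \<beta> (t (Suc i)) - \<beta> (t i) else 0) = (\<Sum>i<n. if i < m then \<beta> (t (Suc i)) - \<beta> (t i) else 0)"
      using m(2) by (intro sum.cong) auto
    also have "\<dots> = (\<Sum>i<m. \<beta> (t (Suc i)) - \<beta> (t i))"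
      using m(1) by (simp add: sum.If_cases Int_absorb1 lessThan_def[symmetric] flip: lessThan_def)
    also have "\<dots> = \<beta> (t m) - \<beta> (t 0)" by (rule sum_lessThan_telescope)
    finally show ?thesis using m t0 by simp
  qed
  then have "(\<Sum>j\<in>J. c j * (\<beta> j - \<beta> 0)) = (\<Sum>j\<in>J. \<Sum>i<n. (if t i < j then c j else 0) * (\<beta> (t (Suc i)) - \<beta> (t i)))"
    by (intro sum.cong refl) (auto simp: sum_distrib_left intro!: sum.cong)
  also have "\<dots> = (\<Sum>i<n. slope i * (\<beta> (t (Suc i)) - \<beta> (t i)))"
    unfolding slope_def sum_distrib_right by (rule sum.swap)
  finally show ?thesis .
qed

lemma integral_step_square:
  "(\<integral>w. (\<Sum>j\<in>J. c j * indicator {0<..<j} w)\<^sup>2 \<partial>lborel) = (\<Sum>i<n. (slope i)\<^sup>2 * (t (Suc i) - t i))"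
proof -
  let ?e = "\<lambda>i w. indicator {t i..<t (Suc i)} w :: real"
  have le: "t i \<le> t k" if "i \<le> k" for i k using mono_t that by (rule monoD)
  \<comment> \<open>The cell starting at \<open>t 0\<close> may contain w = 0, whereas the open
    intervals from 0 do not; this single point is discarded.\<close>
  have "AE w in lborel. w \<noteq> (0::real)" by (rule AE_lborel_singleton)
  then have "AE w in lborel. (\<Sum>j\<in>J. c j * indicator {0<..<j} w)\<^sup>2 = (\<Sum>i<n. (slope i)\<^sup>2 * ?e i w)"
  proof eventually_elim
    case (elim w)
    have d: "indicator {0<..<t (Suc i)} w - indicator {0<..<t i} w = ?e i w" for i
      using elim le[of i "Suc i"] le[of 0 i] t0 by (auto simp: indicator_def)
    \<comment> \<open>Summation by parts in the right endpoint u of the interval (0, u) with w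
      fixed; the increments are indicators of disjoint cells.\<close>
    have "(\<Sum>j\<in>J. c j * indicator {0<..<j} w) = (\<Sum>i<n. slope i * ?e i w)"
      using sum_by_parts[of "\<lambda>u. indicator {0<..<u} w"] unfolding d by simp
    then have "(\<Sum>j\<in>J. c j * indicator {0<..<j} w)\<^sup>2 = (\<Sum>i<n. \<Sum>k<n. slope i * ?e i w * (slope k * ?e k w))"
      by (simp only: power2_eq_square sum_product)
    also have "\<dots> = (\<Sum>i<n. \<Sum>k<n. if k = i then (slope i)\<^sup>2 * ?e i w else 0)"
    proof (intro sum.cong refl)
      fix i k
      show "slope i * ?e i w * (slope k * ?e k w) = (if k = i then (slope i)\<^sup>2 * ?e i w else 0)"
      proof (cases i k rule: linorder_cases)
        case less
        then have "t (Suc i) \<le> t k" by (intro le) simp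
        then show ?thesis using less by (auto simp: indicator_def)
      next
        case greater
        then have "t (Suc k) \<le> t i" by (intro le) simp
        then show ?thesis using greater by (auto simp: indicator_def)
      qed (simp add: power2_eq_square indicator_def)
    qed
    also have "\<dots> = (\<Sum>i<n. (slope i)\<^sup>2 * ?e i w)" by simp
    finally show ?case .
  qed
  then have "(\<integral>w. (\<Sum>j\<in>J. c j * indicator {0<..<j} w)\<^sup>2 \<partial>lborel) = (\<integral>w. (\<Sum>i<n. (slope i)\<^sup>2 * ?e i w) \<partial>lborel)"
    by (intro integral_cong_AE) measurable
  also have "\<dots> = (\<Sum>i<n. \<integral>w. (slope i)\<^sup>2 * ?e i w \<partial>lborel)"
    by (intro Bochner_Integration.integral_sum integrable_mult_right) (simp add: integrable_indicator_iff le)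
  also have "\<dots> = (\<Sum>i<n. (slope i)\<^sup>2 * (t (Suc i) - t i))"
    using le by (intro sum.cong refl) simp
  finally show ?thesis .
qed

text \<open>The increments over the grid are independent centred Gaussians, so the variance is the
  sum of slope^2 times cell length. \<open>integral_step_square\<close> turns it into the integral
  that occurs in the cumulant limit.\<close>

lemma char_brownian_combination:
  assumes B: "standard_brownian_motion N B"
  shows "char (distr N borel (\<lambda>\<omega>. \<Sum>j\<in>J. c j * (\<sigma> * B j \<omega>))) 1
    = exp (of_real (- (\<sigma>\<^sup>2 / 2 * (\<integral>w. (\<Sum>j\<in>J. c j * indicator {0<..<j} w)\<^sup>2 \<partial>lborel))))"
proof -
  interpret prob_space N using B by (simp add: standard_brownian_motion_def)
  have tpos: "0 \<le> t i" for i using monoD[OF mono_t, of 0 i] t0 by simp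
  have Bm[measurable]: "B u \<in> borel_measurable N" if "0 \<le> u" for u
    using B that by (simp add: standard_brownian_motion_def)
  have Jpos: "0 \<le> j" if "j \<in> J" for j using that J_t tpos by auto
  let ?D = "\<lambda>i \<omega>. B (t (Suc i)) \<omega> - B (t i) \<omega>"
  have Dm[measurable]: "?D i \<in> borel_measurable N" for i using tpos by simp
  have "indep_vars (\<lambda>_. borel) ?D {..<n}"
    using B mono_t t0 unfolding standard_brownian_motion_def by auto
  then have indep: "indep_vars (\<lambda>_. borel) (\<lambda>i \<omega>. \<sigma> * slope i * ?D i \<omega>) {..<n}"
    by (rule indep_vars_compose2) measurable
  have "AE \<omega> in N. B 0 \<omega> = 0" using B by (simp add: standard_brownian_motion_def)
  then have eq: "AE \<omega> in N. (\<Sum>j\<in>J. c j * (\<sigma> * B j \<omega>)) = (\<Sum>i<n. \<sigma> * slope i * ?D i \<omega>)"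
  proof eventually_elim
    case (elim \<omega>)
    have "(\<Sum>j\<in>J. c j * (\<sigma> * B j \<omega>)) = \<sigma> * (\<Sum>j\<in>J. c j * (B j \<omega> - B 0 \<omega>))"
      by (simp add: elim sum_distrib_left mult_ac)
    then show ?case using sum_by_parts[of "\<lambda>u. B u \<omega>"] by (simp add: sum_distrib_left mult.assoc)
  qed
  have "distr N borel (\<lambda>\<omega>. \<Sum>j\<in>J. c j * (\<sigma> * B j \<omega>)) = distr N borel (\<lambda>\<omega>. \<Sum>i<n. \<sigma> * slope i * ?D i \<omega>)"
    using Jpos by (intro distr_cong_AE eq) auto
  then have "char (distr N borel (\<lambda>\<omega>. \<Sum>j\<in>J. c j * (\<sigma> * B j \<omega>))) 1
      = (\<Prod>i<n. char (distr N borel (\<lambda>\<omega>. \<sigma> * slope i * ?D i \<omega>)) 1)"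
    using char_distr_sum[OF indep] by simp
  also have "\<dots> = (\<Prod>i<n. exp (of_real (- (\<sigma>\<^sup>2 / 2 * ((slope i)\<^sup>2 * (t (Suc i) - t i))))))"
  proof (rule prod.cong[OF refl])
    fix i assume "i \<in> {..<n}"
    then have lt: "t i < t (Suc i)" by (intro strict_t) auto
    have "distributed N lborel (?D i) (normal_density 0 (sqrt (t (Suc i) - t i)))"
      using B lt tpos[of i] by (simp add: standard_brownian_motion_def)
    from char_normal[OF _ this, of "\<sigma> * slope i"] lt
    have "char (distr N borel (?D i)) (\<sigma> * slope i) = of_real (exp (- ((t (Suc i) - t i) * (\<sigma> * slope i)\<^sup>2) / 2))"
      by simp
    moreover have "char (distr N borel (\<lambda>\<omega>. \<sigma> * slope i * ?D i \<omega>)) 1 = char (distr N borel (?D i)) (\<sigma> * slope i)"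
      by (subst (1 2) char_distr) auto
    moreover have "- ((t (Suc i) - t i) * (\<sigma> * slope i)\<^sup>2) / 2 = - (\<sigma>\<^sup>2 / 2 * ((slope i)\<^sup>2 * (t (Suc i) - t i)))"
      by (simp add: power_mult_distrib)
    ultimately show "char (distr N borel (\<lambda>\<omega>. \<sigma> * slope i * ?D i \<omega>)) 1
        = exp (of_real (- (\<sigma>\<^sup>2 / 2 * ((slope i)\<^sup>2 * (t (Suc i) - t i)))))"
      by (simp only: exp_of_real)
  qed
  also have "\<dots> = exp (of_real (\<Sum>i<n. - (\<sigma>\<^sup>2 / 2 * ((slope i)\<^sup>2 * (t (Suc i) - t i)))))"
    by (simp only: exp_sum[symmetric] finite_lessThan of_real_sum)
  finally show ?thesis by (simp only: integral_step_square sum_negf sum_distrib_left)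
qed

end

lemma time_grid_exists:
  assumes "finite J" "J \<subseteq> {0..}"
  obtains t n where "time_grid J t n"
proof -
  define ts where "ts = sorted_list_of_set (insert 0 J)"
  define n where "n = length ts - 1"
  \<comment> \<open>Constant beyond n, because independence of Brownian increments is stated for
    time sequences that are monotone on all natural numbers.\<close>
  define t where "t i = ts ! min i n" for i
  have ts: "set ts = insert 0 J" "sorted_wrt (<) ts"
    unfolding ts_def by (rule set_sorted_list_of_set, simp add: assms(1)) (rule strict_sorted_list_of_set)
  then have "ts \<noteq> []" by auto
  then have len: "length ts = Suc n" by (simp add: n_def)
  have lt: "t i < t k" if "i < k" "k \<le> n" for i k
    using sorted_wrt_nth_less[OF ts(2), of i k] that len by (simp add: t_def)
  have "time_grid J t n"
  proof
    show "J \<subseteq> t ` {..n}"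
    proof
      fix j assume "j \<in> J"
      then obtain i where "i < length ts" "ts ! i = j" using ts(1) by (metis in_set_conv_nth insertI2)
      then show "j \<in> t ` {..n}" using len by (intro image_eqI[of _ _ i]) (auto simp: t_def)
    qed
    show "mono t"
    proof (rule monoI)
      fix i k :: nat assume "i \<le> k"
      then have "min i n = min k n \<or> min i n < min k n" by auto
      moreover have "t l = t (min l n)" for l by (simp add: t_def)
      moreover have "t (min i n) < t (min k n)" if "min i n < min k n" using that by (intro lt) auto
      ultimately show "t i \<le> t k" by (metis less_imp_le order_refl)
    qed
    obtain i where i: "i < length ts" "ts ! i = 0" using ts(1) by (metis in_set_conv_nth insertI1)
    have "ts ! 0 \<in> insert 0 J" using nth_mem[of 0 ts] len by (simp flip: ts(1))
    then have "0 \<le> t 0" using assms(2) by (auto simp: t_def)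
    moreover have "t 0 \<le> 0" using monoD[OF \<open>mono t\<close>, of 0 i] i len by (simp add: t_def)
    ultimately show "t 0 = 0" by simp
  qed (use assms lt in auto)
  then show ?thesis by (rule that)
qed

theorem theorem3p4:
  fixes M :: "'w measure" and N :: "'v measure"
    and a b \<sigma> \<sigma>' :: real and \<mu> \<pi> :: "real measure"
    and X :: "real \<Rightarrow> 'w \<Rightarrow> real" and B :: "real \<Rightarrow> 'v \<Rightarrow> real"
  assumes supOU: "supOU_process M a b \<mu> \<pi> X"
    and measurable: "(\<lambda>(t, \<omega>). X t \<omega>) \<in> borel_measurable (borel \<Otimes>\<^sub>M M)"
    and finite_variance: "integrable M (\<lambda>\<omega>. (X 1 \<omega>)\<^sup>2)"
    and zero_mean: "\<And>t. (\<integral>\<omega>. X t \<omega> \<partial>M) = 0"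
    and variance: "\<sigma>\<^sup>2 = prob_space.variance M (X 1)"
    and integrable_inverse: "integrable \<pi> (\<lambda>\<xi>. 1 / \<xi>)"
    and limit_variance: "\<sigma>'\<^sup>2 = 2 * \<sigma>\<^sup>2 * (\<integral>\<xi>. 1 / \<xi> \<partial>\<pi>)"
    and brownian: "standard_brownian_motion N B"
  shows "fdd_tendsto {0..} M (\<lambda>T t \<omega>. integrated_process X (T * t) \<omega> / sqrt T)
           N (\<lambda>t \<omega>. \<sigma>' * B t \<omega>) at_top"
proof -
  obtain \<Lambda> where prob: "prob_space M" and triplet: "levy_triplet a b \<mu>" and pi: "prob_space \<pi>"
    and sets_pi: "sets \<pi> = sets (restrict_space borel {0<..})"
    and basis: "levy_basis M (\<pi> \<Otimes>\<^sub>M lborel) (levy_cumulant a b \<mu>) \<Lambda>"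
    and has: "\<And>t. has_stoch_integral M (\<pi> \<Otimes>\<^sub>M lborel) \<Lambda> (supOU_kernel t) (X t)"
    using supOU unfolding supOU_process_def by blast
  interpret ou: ou_measure \<pi> using pi sets_pi by (simp add: ou_measure_def ou_measure_axioms_def)
  interpret M: prob_space M by (rule prob)
  interpret noise: levy_basis_noise M "\<pi> \<Otimes>\<^sub>M lborel" a b \<mu> \<Lambda>
    by unfold_locales (fact triplet basis)+
  \<comment> \<open>The kernel at time 1 has squared norm 1 / 2, hence nonzero, so the finite
    variance of X(1) reaches the jump measure.\<close>
  have square: "integrable \<mu> (\<lambda>x. x\<^sup>2)"
    by (rule noise.second_moment_levy_measure[OF has finite_variance]) (simp add: ou.nn_integral_kernel_square)
  interpret driven: levy_driven_process M "\<pi> \<Otimes>\<^sub>M lborel" a b \<mu> \<Lambda> supOU_kernel "1 / 2" X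
    by unfold_locales (fact square has zero_mean measurable)+
  have v: "driven.v = 2 * \<sigma>\<^sup>2"
  proof -
    have "(\<integral>x. (supOU_kernel 1 x)\<^sup>2 \<partial>(\<pi> \<Otimes>\<^sub>M lborel)) = 1 / 2"
      by (subst integral_eq_nn_integral) (simp_all only: ou.nn_integral_kernel_square enn2real_ennreal, auto)
    moreover have "\<sigma>\<^sup>2 = (\<integral>\<omega>. (X 1 \<omega>)\<^sup>2 \<partial>M)" by (simp add: variance zero_mean)
    ultimately show ?thesis
      using driven.stoch_integral_isometry[OF has[of 1] ou.kernel.riemann_square_integrable(1) zero_mean] by simp
  qed
  have N: "prob_space N" using brownian by (simp add: standard_brownian_motion_def)
  show ?thesis
    unfolding fdd_tendsto_def
  proof (intro allI impI, elim conjE)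
    fix J :: "real set" and \<phi> :: "(real \<Rightarrow> real) \<Rightarrow> real"
    assume J: "finite J" "J \<subseteq> {0..}" and cont: "continuous_map (powertop_real J) euclideanreal \<phi>"
      and bdd: "bounded (\<phi> ` topspace (powertop_real J))"
    obtain C where C: "\<And>x. x \<in> extensional J \<Longrightarrow> \<bar>\<phi> x\<bar> \<le> C"
      using bdd by (auto simp: bounded_iff PiE_def)
    obtain t n where "time_grid J t n" by (rule time_grid_exists[OF J])
    then interpret grid: time_grid J c t n for c .
    show "((\<lambda>T. \<integral>\<omega>. \<phi> (\<lambda>t\<in>J. integrated_process X (T * t) \<omega> / sqrt T) \<partial>M) \<longlongrightarrow> (\<integral>\<omega>. \<phi> (\<lambda>t\<in>J. \<sigma>' * B t \<omega>) \<partial>N)) at_top"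
    \<comment> \<open>Levy continuity concerns sequences, so the limit is tested along an arbitrary
      sequence tending to infinity.\<close>
    proof (rule tendsto_at_topI_sequentially)
      fix T :: "nat \<Rightarrow> real" assume T: "filterlim T at_top sequentially"
      show "(\<lambda>n. \<integral>\<omega>. \<phi> (\<lambda>t\<in>J. integrated_process X (T n * t) \<omega> / sqrt (T n)) \<partial>M) \<longlonglongrightarrow> (\<integral>\<omega>. \<phi> (\<lambda>t\<in>J. \<sigma>' * B t \<omega>) \<partial>N)"
      proof (rule cramer_wold_sequence[OF prob N J(1) _ _ _ cont C])
        show "(\<lambda>\<omega>. integrated_process X (T n * j) \<omega> / sqrt (T n)) \<in> borel_measurable M" for n j
          unfolding integrated_process_def by measurable
        show "(\<lambda>\<omega>. \<sigma>' * B j \<omega>) \<in> borel_measurable N" if "j \<in> J" for j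
          using brownian J(2) that by (auto simp: standard_brownian_motion_def)
        fix c
        interpret lim: supOU_limit a b \<mu> \<pi> J c
          by unfold_locales (fact integrable_inverse J)+
        let ?I = "\<lambda>T. \<integral>x. centred_cumulant b \<mu> (\<Sum>j\<in>J. c j / sqrt T * (LBINT u:{0..T * j}. supOU_kernel u x)) \<partial>(\<pi> \<Otimes>\<^sub>M lborel)"
        let ?Z = "\<lambda>n \<omega>. \<Sum>j\<in>J. c j * (integrated_process X (T n * j) \<omega> / sqrt (T n))"
        have "- driven.v / 2 * (\<integral>w. (lim.step w)\<^sup>2 \<partial>lborel) * (\<integral>\<xi>. 1 / \<xi> \<partial>\<pi>)
            = - (\<sigma>'\<^sup>2 / 2 * (\<integral>w. (\<Sum>j\<in>J. c j * indicator {0<..<j} w)\<^sup>2 \<partial>lborel))"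
          unfolding v limit_variance lim.step_def by simp
        then have "char (distr N borel (\<lambda>\<omega>. \<Sum>j\<in>J. c j * (\<sigma>' * B j \<omega>))) 1
            = exp (of_real (- driven.v / 2 * (\<integral>w. (lim.step w)\<^sup>2 \<partial>lborel) * (\<integral>\<xi>. 1 / \<xi> \<partial>\<pi>)))"
          unfolding grid.char_brownian_combination[OF brownian] by (simp only:)
        then have "(\<lambda>n. exp (?I (T n))) \<longlonglongrightarrow> char (distr N borel (\<lambda>\<omega>. \<Sum>j\<in>J. c j * (\<sigma>' * B j \<omega>))) 1"
          using tendsto_exp[OF filterlim_compose[OF lim.cumulant_limit T]] by (simp only:)
        moreover have "\<forall>\<^sub>F n in sequentially. exp (?I (T n)) = char (distr M borel (?Z n)) 1"
          using filterlim_at_top[THEN iffD1, OF T, rule_format, of 0]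
        proof eventually_elim
          case (elim n)
          have "?Z n = (\<lambda>\<omega>. \<Sum>j\<in>J. c j / sqrt (T n) * integrated_process X (T n * j) \<omega>)" by simp
          then show ?case
            using elim J by (simp only:) (intro driven.char_integrated_process[symmetric], auto)
        qed
        ultimately show "(\<lambda>n. char (distr M borel (?Z n)) 1) \<longlonglongrightarrow> char (distr N borel (\<lambda>\<omega>. \<Sum>j\<in>J. c j * (\<sigma>' * B j \<omega>))) 1"
          by (rule Lim_transform_eventually)
      qed
    qed
  qed
qed

end
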